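(* There exists a countable relational structure $\mathbb{S}$ such that: (1) $\mathbb{S}$ is $\omega$-categorical and has less than doubly exponential orbit growth; (2) there exists a minion homomorphism from $\mathrm{Pol}(\mathbb{S})$ to $\mathcal{P}$; (3) there exists no uniformly continuous minion homomorphism from $\mathrm{Pol}(\mathbb{S})$ to $\mathcal{P}$.
   Context: A clone on a set $A$ is a set of finitary operations on $A$ that contains all projections and is closed under composition; $\mathcal{A}^{(n)}$ denotes its $n$-ary members. $\mathcal{P}$ denotes the clone on $\{0,1\}$ consisting of all projections. For a relational structure $\mathbb{A}$, a polymorphism is a homomorphism from the power $\mathbb{A}^n$ (domain $A^n$, relations defined componentwise) to $\mathbb{A}$; $\mathrm{Pol}(\mathbb{A})$ is the clone of all polymorphisms. A minion homomorphism between clones $\mathcal{A}\to\mathcal{B}$ is an arity-preserving map $\xi$ such that for all $n$-ary $f\in\mathcal{A}$ and all $\pi:\{1,\dots,n\}\to\{1,\dots,k\}$, $\xi$ maps the function $(x_1,\dots,x_k)\mapsto f(x_{\pi(1)},\dots,x_{\pi(n)})$ to $(x_1,\dots,x_k)\mapsto \xi(f)(x_{\pi(1)},\dots,x_{\pi(n)})$. An arity-preserving map $\xi:\mathcal{A}\to\mathcal{B}$ between clones on sets $A,B$ is uniformly continuous if for every $n\ge1$ and every finite $F\subseteq B^n$ there is a finite $S\subseteq A^n$ such that for all $f,g\in\mathcal{A}^{(n)}$, $f|_S=g|_S$ implies $\xi(f)|_F=\xi(g)|_F$. A countable structure $\mathbb{A}$ is $\omega$-categorical if for every $k\ge1$ its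 automorphism group has finitely many orbits on $A^k$ (under the componentwise action). Writing $o(k)$ for the number of orbits on $k$-tuples, $\mathbb{A}$ has less than doubly exponential orbit growth if $\lim_{k\to\infty} o(k)/2^{2^k}=0$. *)

theory Defs
  imports "HOL-Library.FuncSet" Complex_Main
begin

text \<open>Conventions. A countable relational structure is represented (up to isomorphism)
by a carrier set A of natural numbers together with a set Rels of relations; each
relation is a pair (m, r) of an arity m and a set r of m-tuples (lists of length m)
over A. Tuples of A^n are represented as extensional functions in
{0..<n} ->E A (PiE); an n-ary operation is an extensional function on A^n
(value undefined outside A^n), so equality of operations is equality on A^n.
Arities are \<ge> 1. Countability of the structure is automatic as the carrier is a set of naturals.\<close>

definition rel_structure :: "nat set \<Rightarrow> (nat \<times> nat list set) set \<Rightarrow> bool" where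
  "rel_structure A Rels \<longleftrightarrow> A \<noteq> {} \<and>
     (\<forall>(m, r) \<in> Rels. r \<subseteq> {t. length t = m \<and> set t \<subseteq> A})"

definition tuples :: "nat \<Rightarrow> 'a set \<Rightarrow> (nat \<Rightarrow> 'a) set" where
  "tuples n A = {0..<n} \<rightarrow>\<^sub>E A"

definition is_op :: "'a set \<Rightarrow> nat \<Rightarrow> ((nat \<Rightarrow> 'a) \<Rightarrow> 'a) \<Rightarrow> bool" where
  "is_op A n f \<longleftrightarrow> f \<in> tuples n A \<rightarrow>\<^sub>E A"

definition preserves :: "nat \<Rightarrow> ((nat \<Rightarrow> 'a) \<Rightarrow> 'a) \<Rightarrow> nat \<times> 'a list set \<Rightarrow> bool" where
  "preserves n f R \<longleftrightarrow> (case R of (m, r) \<Rightarrow>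
     (\<forall>x. (\<forall>i<n. x i \<in> r) \<longrightarrow>
        map (\<lambda>j. f (restrict (\<lambda>i. x i ! j) {0..<n})) [0..<m] \<in> r))"

definition Pol :: "'a set \<Rightarrow> (nat \<times> 'a list set) set \<Rightarrow> nat \<Rightarrow> ((nat \<Rightarrow> 'a) \<Rightarrow> 'a) set" where
  "Pol A Rels n = {f. is_op A n f \<and> (\<forall>R \<in> Rels. preserves n f R)}"

definition proj :: "nat \<Rightarrow> nat \<Rightarrow> (nat \<Rightarrow> bool) \<Rightarrow> bool" where
  "proj n i = restrict (\<lambda>x. x i) (tuples n (UNIV :: bool set))"

definition Proj_clone :: "nat \<Rightarrow> ((nat \<Rightarrow> bool) \<Rightarrow> bool) set" where
  "Proj_clone n = {proj n i | i. i < n}"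

definition minor :: "'a set \<Rightarrow> nat \<Rightarrow> nat \<Rightarrow> (nat \<Rightarrow> nat) \<Rightarrow> ((nat \<Rightarrow> 'a) \<Rightarrow> 'a) \<Rightarrow> (nat \<Rightarrow> 'a) \<Rightarrow> 'a" where
  "minor A n k \<pi> f = restrict (\<lambda>x. f (restrict (\<lambda>i. x (\<pi> i)) {0..<n})) (tuples k A)"

definition minion_hom ::
  "'a set \<Rightarrow> (nat \<Rightarrow> ((nat \<Rightarrow> 'a) \<Rightarrow> 'a) set) \<Rightarrow> 'b set \<Rightarrow> (nat \<Rightarrow> ((nat \<Rightarrow> 'b) \<Rightarrow> 'b) set)
    \<Rightarrow> (nat \<Rightarrow> ((nat \<Rightarrow> 'a) \<Rightarrow> 'a) \<Rightarrow> ((nat \<Rightarrow> 'b) \<Rightarrow> 'b)) \<Rightarrow> bool" where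
  "minion_hom A CA B CB \<xi> \<longleftrightarrow>
     (\<forall>n\<ge>1. \<forall>f \<in> CA n. \<xi> n f \<in> CB n) \<and>
     (\<forall>n\<ge>1. \<forall>k\<ge>1. \<forall>f \<in> CA n. \<forall>\<pi>. (\<forall>i<n. \<pi> i < k) \<longrightarrow>
        \<xi> k (minor A n k \<pi> f) = minor B n k \<pi> (\<xi> n f))"

definition unif_continuous ::
  "'a set \<Rightarrow> (nat \<Rightarrow> ((nat \<Rightarrow> 'a) \<Rightarrow> 'a) set) \<Rightarrow> 'b set
    \<Rightarrow> (nat \<Rightarrow> ((nat \<Rightarrow> 'a) \<Rightarrow> 'a) \<Rightarrow> ((nat \<Rightarrow> 'b) \<Rightarrow> 'b)) \<Rightarrow> bool" where
  "unif_continuous A CA B \<xi> \<longleftrightarrow>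
     (\<forall>n\<ge>1. \<forall>F. finite F \<and> F \<subseteq> tuples n B \<longrightarrow>
        (\<exists>S. finite S \<and> S \<subseteq> tuples n A \<and>
           (\<forall>f \<in> CA n. \<forall>g \<in> CA n. (\<forall>x\<in>S. f x = g x) \<longrightarrow> (\<forall>y\<in>F. \<xi> n f y = \<xi> n g y))))"

definition automorphism :: "'a set \<Rightarrow> (nat \<times> 'a list set) set \<Rightarrow> ('a \<Rightarrow> 'a) \<Rightarrow> bool" where
  "automorphism A Rels \<sigma> \<longleftrightarrow> bij_betw \<sigma> A A \<and>
     (\<forall>(m, r) \<in> Rels. \<forall>t. length t = m \<and> set t \<subseteq> A \<longrightarrow> (t \<in> r \<longleftrightarrow> map \<sigma> t \<in> r))"

definition orbits :: "'a set \<Rightarrow> (nat \<times> 'a list set) set \<Rightarrow> nat \<Rightarrow> 'a list set set" where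
  "orbits A Rels k = {{map \<sigma> t | \<sigma>. automorphism A Rels \<sigma>} | t. length t = k \<and> set t \<subseteq> A}"

definition omega_categorical :: "'a set \<Rightarrow> (nat \<times> 'a list set) set \<Rightarrow> bool" where
  "omega_categorical A Rels \<longleftrightarrow> (\<forall>k\<ge>1. finite (orbits A Rels k))"

definition less_than_doubly_exp_growth :: "'a set \<Rightarrow> (nat \<times> 'a list set) set \<Rightarrow> bool" where
  "less_than_doubly_exp_growth A Rels \<longleftrightarrow>
     (\<lambda>k. real (card (orbits A Rels k)) / 2 ^ (2 ^ k)) \<longlonglongrightarrow> 0"

end

theory Submission
  imports Defs "HOL-Library.Nat_Bijection" "HOL-Analysis.Analysis"
begin

text \<open>
  For every \<open>L\<close> and every \<open>m L\<close>-element context \<open>Z\<close> the structure carries a relation whose members,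
  the hyperedges, are \<open>2 ^ L\<close>-tuples \<open>e\<close> of points; a \<open>0\<close>-\<open>1\<close> labelling of the points satisfies \<open>e\<close>
  if its restriction to \<open>e\<close> is a projection \<open>{0,1}^L \<rightarrow> {0,1}\<close>. The structure is generic subject to the
  condition that any \<open>L\<close> hyperedges with the same context are simultaneously satisfiable. To amalgamate,
  one keeps track of all constraints \<open>V\<close> (sets of labellings with finite support) that are implied by
  some \<open>k \<le> L\<close> hyperedges; these pairs \<open>(k, V)\<close> form a graded filter. Since a level \<open>L\<close> is visible only on
  sets with at least \<open>m L\<close> points and contexts are unordered, a fast growing \<open>m\<close> keeps the number of
  orbits on \<open>k\<close>-tuples below \<open>2 ^ 2 ^ k\<close>.

  Applying finitely many polymorphisms, at most \<open>L\<close> in number and of arity at most \<open>L\<close>, to the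
  \<open>L\<close> columns of the table of \<open>{0,1}^L\<close> (with \<open>0\<close>, \<open>1\<close> replaced by two points) yields hyperedges; those
  with a common context have a common satisfying labelling, which selects a coordinate of each
  polymorphism compatibly with minors. Compactness gives a minion homomorphism to the projections.

  Locally, however, the identities \<open>f (x\<^sub>c)\<^sub>c = g (x\<^sub>c)\<^sub>c\<close>, where for each \<open>i < K\<close> one puts \<open>x\<^sub>c = y\<close> if
  \<open>i \<in> c\<close> and \<open>x\<^sub>c = x\<close> otherwise, and where \<open>c\<close> ranges over the even subsets of \<open>{..<K}\<close> for \<open>f\<close> and over
  the odd ones for \<open>g\<close>, hold for \<open>x, y\<close> in a given finite set \<open>F\<close>: identify the two powers of the
  structure along these equations. A level with \<open>m L > card F\<close> does not notice the identification as its
  contexts stay in one of the two powers, and for a level with \<open>m L \<le> card F\<close> the few points of \<open>L\<close>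
  hyperedges leave some \<open>i < K\<close> unused, so that the coordinates \<open>{}\<close> of \<open>f\<close> and \<open>{i}\<close> of \<open>g\<close> project them
  consistently to the structure. Projections satisfy no such system, since no even set is odd.
\<close>

section \<open>Chains meeting countably many requirements\<close>

text \<open>Dovetailing: stage i serves the requirement indexed by the first component of the pair
  coded by i, and the second component makes every requirement come back beyond any N. Recurrence
  matters because a task about a finite set D has content only once D lies in the current
  stage.\<close>

lemma chain_meeting_requirements:
  fixes step :: "'r \<Rightarrow> 'p \<Rightarrow> 'p \<Rightarrow> bool"
  assumes R: "countable R" "R \<noteq> {}" and p0: "p0 \<in> I"
    and ex: "\<And>r p. r \<in> R \<Longrightarrow> p \<in> I \<Longrightarrow> \<exists>p'\<in>I. step r p p'"
  shows "\<exists>p. p 0 = p0 \<and> (\<forall>i. p i \<in> I) \<and> (\<forall>i. \<exists>r\<in>R. step r (p i) (p (Suc i))) \<and>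
    (\<forall>r\<in>R. \<forall>N. \<exists>i\<ge>N. step r (p i) (p (Suc i)))"
proof -
  define task where "task i = from_nat_into R (fst (prod_decode i))" for i
  have task: "task i \<in> R" for i
    unfolding task_def using R(2) by (rule from_nat_into)
  define p where "p = rec_nat p0 (\<lambda>i q. SOME q'. q' \<in> I \<and> step (task i) q q')"
  have pS: "p (Suc i) = (SOME q'. q' \<in> I \<and> step (task i) (p i) q')" for i
    by (simp add: p_def)
  have pI: "p i \<in> I" for i
  proof (induction i)
    case 0
    show ?case using p0 by (simp add: p_def)
  next
    case (Suc i)
    have "\<exists>q'. q' \<in> I \<and> step (task i) (p i) q'" using ex[OF task Suc] by blast
    from someI_ex[OF this] show ?case unfolding pS by blast
  qed
  have pstep: "step (task i) (p i) (p (Suc i))" for i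
  proof -
    have "\<exists>q'. q' \<in> I \<and> step (task i) (p i) q'" using ex[OF task pI] by blast
    from someI_ex[OF this] show ?thesis unfolding pS by blast
  qed
  have "\<exists>i\<ge>N. step r (p i) (p (Suc i))" if r: "r \<in> R" for r N
  proof -
    obtain a where a: "from_nat_into R a = r"
      using from_nat_into_surj[OF R(1) r] by blast
    have "task (prod_encode (a, N)) = r" by (simp add: task_def a)
    moreover have "prod_encode (a, N) \<ge> N" by (rule le_prod_encode_2)
    ultimately show ?thesis using pstep[of "prod_encode (a, N)"] by auto
  qed
  moreover have "p 0 = p0" by (simp add: p_def)
  ultimately show ?thesis using pI pstep task by (intro exI[of _ p]) blast
qed

section \<open>Constraints and graded filters\<close>

text \<open>A labelling is encoded by the set \<theta> of all points labelled 1, a constraint by the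
  set of labellings that satisfy it. Labellings are defined on all naturals, so constraints with
  different supports can be intersected directly.\<close>

definition supp :: "nat set \<Rightarrow> nat set set \<Rightarrow> bool" where
  "supp P V \<longleftrightarrow> (\<forall>\<theta> \<mu>. \<theta> \<inter> P = \<mu> \<inter> P \<longrightarrow> (\<theta> \<in> V \<longleftrightarrow> \<mu> \<in> V))"

definition adm :: "nat \<Rightarrow> nat set \<Rightarrow> nat \<Rightarrow> nat set set \<Rightarrow> bool" where
  "adm L A k V \<longleftrightarrow> (\<exists>P\<subseteq>A. finite P \<and> card P \<le> k * 2 ^ L \<and> (\<forall>x\<in>P. even x) \<and> supp P V)"

text \<open>In \<open>(k, V) \<in> U\<close>, the number \<open>k\<close> bounds how many hyperedges are needed to imply \<open>V\<close>; the bound on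
  supports in \<open>adm\<close> matches this, as a hyperedge has at most \<open>2 ^ L\<close> points.\<close>

definition sys :: "nat \<Rightarrow> nat set \<Rightarrow> (nat \<times> nat set set) set \<Rightarrow> bool" where
  "sys L A U \<longleftrightarrow>
     (\<forall>k V. (k, V) \<in> U \<longrightarrow> k \<le> L \<and> adm L A k V \<and> V \<noteq> {}) \<and>
     (0, UNIV) \<in> U \<and>
     (\<forall>k V k' V'. (k, V) \<in> U \<longrightarrow> V \<subseteq> V' \<longrightarrow> k \<le> k' \<longrightarrow> k' \<le> L \<longrightarrow> adm L A k' V' \<longrightarrow> (k', V') \<in> U) \<and>
     (\<forall>k V k' V'. (k, V) \<in> U \<longrightarrow> (k', V') \<in> U \<longrightarrow> k + k' \<le> L \<longrightarrow> (k + k', V \<inter> V') \<in> U)"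

text \<open>Renaming of the variables of a constraint. It acts through preimages of labellings and
  therefore makes sense for maps that identify points; \<open>projectable_consistent\<close> applies
  it to maps of this kind.\<close>

definition push :: "(nat \<Rightarrow> nat) \<Rightarrow> nat set set \<Rightarrow> nat set set" where
  "push \<rho> V = {\<theta>. \<rho> -` \<theta> \<in> V}"

lemma suppD: "supp P V \<Longrightarrow> \<theta> \<inter> P = \<mu> \<inter> P \<Longrightarrow> \<theta> \<in> V \<longleftrightarrow> \<mu> \<in> V"
  unfolding supp_def by blast

lemma suppI: "(\<And>\<theta> \<mu>. \<theta> \<inter> P = \<mu> \<inter> P \<Longrightarrow> \<theta> \<in> V \<longleftrightarrow> \<mu> \<in> V) \<Longrightarrow> supp P V"
  unfolding supp_def by blast

lemma supp_Int:
  assumes "supp P V" "supp Q W"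
  shows "supp (P \<union> Q) (V \<inter> W)"
proof (rule suppI)
  fix \<theta> \<mu> :: "nat set"
  assume e: "\<theta> \<inter> (P \<union> Q) = \<mu> \<inter> (P \<union> Q)"
  then have "\<theta> \<inter> P = \<mu> \<inter> P" "\<theta> \<inter> Q = \<mu> \<inter> Q" by auto
  then show "\<theta> \<in> V \<inter> W \<longleftrightarrow> \<mu> \<in> V \<inter> W" using suppD assms by blast
qed

lemma supp_push:
  assumes "supp P V"
  shows "supp (\<rho> ` P) (push \<rho> V)"
proof (rule suppI)
  fix \<theta> \<mu> :: "nat set"
  assume "\<theta> \<inter> \<rho> ` P = \<mu> \<inter> \<rho> ` P"
  then have "\<rho> -` \<theta> \<inter> P = \<rho> -` \<mu> \<inter> P" by blast
  from suppD[OF assms this] show "\<theta> \<in> push \<rho> V \<longleftrightarrow> \<mu> \<in> push \<rho> V" by (simp add: push_def)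
qed

lemma push_cong:
  assumes "supp P V" "\<And>x. x \<in> P \<Longrightarrow> \<rho> x = \<rho>' x"
  shows "push \<rho> V = push \<rho>' V"
proof -
  have "\<rho> -` \<theta> \<inter> P = \<rho>' -` \<theta> \<inter> P" for \<theta> using assms(2) by auto
  then have "\<rho> -` \<theta> \<in> V \<longleftrightarrow> \<rho>' -` \<theta> \<in> V" for \<theta> by (rule suppD[OF assms(1)])
  then show ?thesis unfolding push_def by simp
qed

lemma push_comp: "push \<rho>' (push \<rho> V) = push (\<rho>' \<circ> \<rho>) V"
  by (simp add: push_def vimage_comp)

lemma push_id [simp]: "push id V = V" "push (\<lambda>x. x) V = V"
  by (simp_all add: push_def)

lemma push_Int: "push \<rho> (V \<inter> W) = push \<rho> V \<inter> push \<rho> W"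
  by (auto simp: push_def)

lemma push_UNIV [simp]: "push \<rho> UNIV = UNIV" and push_empty [simp]: "push \<rho> {} = {}"
  by (simp_all add: push_def)

lemma push_mono: "V \<subseteq> W \<Longrightarrow> push \<rho> V \<subseteq> push \<rho> W"
  by (auto simp: push_def)

lemma adm_mono:
  assumes "adm L A k V" "A \<subseteq> B" "k \<le> k'"
  shows "adm L B k' V"
proof -
  obtain P where P: "P \<subseteq> A" "finite P" "card P \<le> k * 2 ^ L" "\<forall>x\<in>P. even x" "supp P V"
    using assms(1) unfolding adm_def by blast
  have "k * 2 ^ L \<le> k' * 2 ^ L" using assms(3) by simp
  with P(3) have "card P \<le> k' * 2 ^ L" by linarith
  with P assms(2) show ?thesis unfolding adm_def by blast
qed

lemma adm_UNIV [simp]: "adm L A k UNIV"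
  unfolding adm_def by (intro exI[of _ "{}"]) (simp add: suppI)

lemma adm_Int:
  assumes "adm L A k V" "adm L A k' V'"
  shows "adm L A (k + k') (V \<inter> V')"
proof -
  obtain P P' where P: "P \<subseteq> A" "finite P" "card P \<le> k * 2 ^ L" "\<forall>x\<in>P. even x" "supp P V"
    and P': "P' \<subseteq> A" "finite P'" "card P' \<le> k' * 2 ^ L" "\<forall>x\<in>P'. even x" "supp P' V'"
    using assms unfolding adm_def by blast
  have "card (P \<union> P') \<le> (k + k') * 2 ^ L"
    using card_Un_le[of P P'] P(3) P'(3) by (simp add: algebra_simps)
  then show ?thesis unfolding adm_def
    using P(1,2,4) P'(1,2,4) supp_Int[OF P(5) P'(5)] by (intro exI[of _ "P \<union> P'"]) auto
qed

lemma adm_push: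
  assumes "adm L D k V" "\<And>x. x \<in> D \<Longrightarrow> even (\<rho> x) = even x" "\<rho> ` D \<subseteq> A"
  shows "adm L A k (push \<rho> V)"
proof -
  obtain P where P: "P \<subseteq> D" "finite P" "card P \<le> k * 2 ^ L" "\<forall>x\<in>P. even x" "supp P V"
    using assms(1) unfolding adm_def by blast
  have "card (\<rho> ` P) \<le> k * 2 ^ L" using card_image_le[OF P(2), of \<rho>] P(3) by linarith
  moreover have "\<rho> ` P \<subseteq> A" using P(1) assms(3) by blast
  ultimately show ?thesis unfolding adm_def
    using P assms(2) supp_push[OF P(5), of \<rho>] by (intro exI[of _ "\<rho> ` P"]) auto
qed

lemma sysD:
  assumes "sys L A U"
  shows "(k, V) \<in> U \<Longrightarrow> k \<le> L" "(k, V) \<in> U \<Longrightarrow> adm L A k V" "(k, {}) \<notin> U" "(0, UNIV) \<in> U"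
    "(k, V) \<in> U \<Longrightarrow> V \<subseteq> V' \<Longrightarrow> k \<le> k' \<Longrightarrow> k' \<le> L \<Longrightarrow> adm L A k' V' \<Longrightarrow> (k', V') \<in> U"
    "(k, V) \<in> U \<Longrightarrow> (k', V') \<in> U \<Longrightarrow> k + k' \<le> L \<Longrightarrow> (k + k', V \<inter> V') \<in> U"
proof -
  note * = assms[unfolded sys_def]
  note 1 = conjunct1[OF *] and 2 = conjunct2[OF *]
  note 3 = conjunct2[OF 2]
  show "(k, V) \<in> U \<Longrightarrow> k \<le> L" "(k, V) \<in> U \<Longrightarrow> adm L A k V" "(k, {}) \<notin> U" "(0, UNIV) \<in> U"
    using 1 conjunct1[OF 2] by (simp, simp, blast, simp)
  show "(k, V) \<in> U \<Longrightarrow> V \<subseteq> V' \<Longrightarrow> k \<le> k' \<Longrightarrow> k' \<le> L \<Longrightarrow> adm L A k' V' \<Longrightarrow> (k', V') \<in> U"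
    using conjunct1[OF 3] by simp
  show "(k, V) \<in> U \<Longrightarrow> (k', V') \<in> U \<Longrightarrow> k + k' \<le> L \<Longrightarrow> (k + k', V \<inter> V') \<in> U"
    using conjunct2[OF 3] by simp
qed

text \<open>The least graded filter. It stands in for a missing filter when a context lies on only
  one side of an amalgamation.\<close>

definition triv_sys :: "nat \<Rightarrow> (nat \<times> nat set set) set" where
  "triv_sys L = {(k, UNIV) | k. k \<le> L}"

lemma sys_triv: "sys L A (triv_sys L)"
  unfolding sys_def triv_sys_def by (simp add: top_unique)

lemma adm_empty:
  assumes "adm L {} k V"
  shows "V = {} \<or> V = UNIV"
proof -
  have "supp {} V" using assms unfolding adm_def by auto
  then have "\<theta> \<in> V \<longleftrightarrow> \<mu> \<in> V" for \<theta> \<mu> by (rule suppD) simp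
  then show ?thesis by blast
qed

text \<open>A constraint with empty support is \<open>UNIV\<close> or \<open>{}\<close>; the former
  costs no hyperedge and the latter is inconsistent. Hence all graded filters of level L agree on
  such constraints, which settles the agreement in \<open>amalgamation\<close> for contexts not
  common to both sides.\<close>

lemma sys_empty_part:
  assumes U: "sys L A U" and V: "adm L {} k V"
  shows "(k, V) \<in> U \<longleftrightarrow> (k, V) \<in> triv_sys L"
proof (cases "V = UNIV")
  case True
  have "(k, UNIV) \<in> U" if "k \<le> L"
    by (rule sysD(5)[OF U sysD(4)[OF U]]) (use that in auto)
  with True sysD(1)[OF U] show ?thesis unfolding triv_sys_def by blast
next
  case False
  then have "V = {}" using adm_empty[OF V] by blast
  with sysD(3)[OF U] show ?thesis unfolding triv_sys_def by simp
qed

section \<open>Joining two graded filters over their common points\<close>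

definition amalg ::
  "nat \<Rightarrow> nat set \<Rightarrow> (nat \<times> nat set set) set \<Rightarrow> (nat \<times> nat set set) set \<Rightarrow> (nat \<times> nat set set) set" where
  "amalg L C U U' = {(k, V). k \<le> L \<and> adm L C k V \<and>
     (\<exists>k1 V1 k2 V2. (k1, V1) \<in> U \<and> (k2, V2) \<in> U' \<and> k1 + k2 \<le> k \<and> V1 \<inter> V2 \<subseteq> V)}"

lemma amalgI:
  "(k1, V1) \<in> U \<Longrightarrow> (k2, V2) \<in> U' \<Longrightarrow> k1 + k2 \<le> k \<Longrightarrow> V1 \<inter> V2 \<subseteq> V \<Longrightarrow> k \<le> L \<Longrightarrow> adm L C k V
    \<Longrightarrow> (k, V) \<in> amalg L C U U'"
  unfolding amalg_def by blast

lemma amalgE: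
  assumes "(k, V) \<in> amalg L C U U'"
  obtains k1 V1 k2 V2 where "(k1, V1) \<in> U" "(k2, V2) \<in> U'" "k1 + k2 \<le> k" "V1 \<inter> V2 \<subseteq> V"
    "k \<le> L" "adm L C k V"
  using assms unfolding amalg_def by blast

lemma amalg_commute: "amalg L C U U' = amalg L C U' U"
proof -
  have "(k, V) \<in> amalg L C U' U" if "(k, V) \<in> amalg L C U U'" for U U' k V
    using that
  proof (rule amalgE)
    fix k1 V1 k2 V2
    assume *: "(k1, V1) \<in> U" "(k2, V2) \<in> U'" "k1 + k2 \<le> k" "V1 \<inter> V2 \<subseteq> V" "k \<le> L" "adm L C k V"
    show "(k, V) \<in> amalg L C U' U"
      using * by (intro amalgI[OF *(2,1)]) auto
  qed
  then show ?thesis by auto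
qed

text \<open>The part of a constraint of one side that is visible on the other side is its projection to
  the common points; this is where the hypothesis of agreement on \<open>A \<inter> B\<close> enters.\<close>

lemma amalg_core:
  assumes U: "sys L A U" and U': "sys L B U'"
    and agree: "\<And>k V. adm L (A \<inter> B) k V \<Longrightarrow> (k, V) \<in> U \<longleftrightarrow> (k, V) \<in> U'"
    and V1: "(k1, V1) \<in> U" and V2: "(k2, V2) \<in> U'" and k: "k1 + k2 \<le> L"
  obtains V where "(k1 + k2, V) \<in> U"
    "\<And>\<theta>. \<theta> \<in> V \<Longrightarrow> \<exists>\<nu>\<in>V1 \<inter> V2. \<nu> \<inter> A = \<theta> \<inter> A"
proof -
  obtain P1 where P1: "P1 \<subseteq> A" "supp P1 V1"
    using sysD(2)[OF U V1] unfolding adm_def by blast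
  obtain P2 where P2: "P2 \<subseteq> B" "finite P2" "card P2 \<le> k2 * 2 ^ L" "\<forall>x\<in>P2. even x" "supp P2 V2"
    using sysD(2)[OF U' V2] unfolding adm_def by blast
  define V2' where "V2' = {\<theta>. \<exists>\<mu>\<in>V2. \<mu> \<inter> (P2 \<inter> A) = \<theta> \<inter> (P2 \<inter> A)}"
  have "supp (P2 \<inter> A) V2'" by (rule suppI) (simp add: V2'_def)
  moreover have "card (P2 \<inter> A) \<le> k2 * 2 ^ L"
    using P2(2,3) card_mono[of P2 "P2 \<inter> A"] by auto
  ultimately have adm: "adm L (A \<inter> B) k2 V2'"
    unfolding adm_def using P2 by (intro exI[of _ "P2 \<inter> A"]) auto
  have "V2 \<subseteq> V2'" unfolding V2'_def by blast
  then have "(k2, V2') \<in> U'"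
    using sysD(5)[OF U' V2 _ order_refl] sysD(1)[OF U' V2] adm_mono[OF adm, of B k2] by auto
  then have "(k2, V2') \<in> U" using agree[OF adm] by blast
  from sysD(6)[OF U V1 this k] have mem: "(k1 + k2, V1 \<inter> V2') \<in> U" .
  show thesis
  proof (rule that[OF mem])
    fix \<theta> assume "\<theta> \<in> V1 \<inter> V2'"
    then obtain \<mu> where \<theta>: "\<theta> \<in> V1" and \<mu>: "\<mu> \<in> V2" "\<mu> \<inter> (P2 \<inter> A) = \<theta> \<inter> (P2 \<inter> A)"
      unfolding V2'_def by blast
    let ?\<nu> = "(\<theta> \<inter> A) \<union> (\<mu> - A)"
    have "?\<nu> \<inter> P1 = \<theta> \<inter> P1" using P1(1) by auto
    then have "?\<nu> \<in> V1" using suppD[OF P1(2)] \<theta> by blast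
    moreover have "?\<nu> \<inter> P2 = \<mu> \<inter> P2" using \<mu>(2) by auto
    then have "?\<nu> \<in> V2" using suppD[OF P2(5)] \<mu>(1) by blast
    moreover have "?\<nu> \<inter> A = \<theta> \<inter> A" by auto
    ultimately show "\<exists>\<nu>\<in>V1 \<inter> V2. \<nu> \<inter> A = \<theta> \<inter> A" by blast
  qed
qed

text \<open>Conservativity: a constraint supported in A cannot distinguish labellings that agree on
  A, so \<open>amalg_core\<close> turns a joint consequence of both sides into a consequence of one
  element of U of the same total grade.\<close>

lemma amalg_left:
  assumes U: "sys L A U" and U': "sys L B U'"
    and agree: "\<And>k V. adm L (A \<inter> B) k V \<Longrightarrow> (k, V) \<in> U \<longleftrightarrow> (k, V) \<in> U'"
    and C: "A \<subseteq> C" and V: "adm L A k V"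
  shows "(k, V) \<in> amalg L C U U' \<longleftrightarrow> (k, V) \<in> U"
proof
  assume "(k, V) \<in> U"
  then show "(k, V) \<in> amalg L C U U'"
    using sysD(1)[OF U] adm_mono[OF V C order_refl] by (intro amalgI[OF _ sysD(4)[OF U']]) auto
next
  assume "(k, V) \<in> amalg L C U U'"
  then obtain k1 V1 k2 V2 where *: "k \<le> L" "(k1, V1) \<in> U" "(k2, V2) \<in> U'" "k1 + k2 \<le> k"
    "V1 \<inter> V2 \<subseteq> V" by (elim amalgE)
  have "k1 + k2 \<le> L" using * by linarith
  from amalg_core[OF U U' agree *(2,3) this] obtain W where W: "(k1 + k2, W) \<in> U"
    "\<And>\<theta>. \<theta> \<in> W \<Longrightarrow> \<exists>\<nu>\<in>V1 \<inter> V2. \<nu> \<inter> A = \<theta> \<inter> A" by blast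
  obtain P where P: "P \<subseteq> A" "supp P V" using V unfolding adm_def by blast
  have "W \<subseteq> V"
  proof
    fix \<theta> assume "\<theta> \<in> W"
    then obtain \<nu> where "\<nu> \<in> V" "\<nu> \<inter> A = \<theta> \<inter> A" using W(2) *(5) by blast
    moreover from this have "\<nu> \<inter> P = \<theta> \<inter> P" using P(1) by blast
    ultimately show "\<theta> \<in> V" using suppD[OF P(2)] by blast
  qed
  then show "(k, V) \<in> U" using sysD(5)[OF U W(1) _ *(4,1) V] by blast
qed

text \<open>The clause with content is consistency: the element of U supplied by
  \<open>amalg_core\<close> is nonempty, and each labelling in it can be changed outside A so as to
  satisfy both sides.\<close>

lemma sys_amalg:
  assumes U: "sys L A U" and U': "sys L B U'"
    and agree: "\<And>k V. adm L (A \<inter> B) k V \<Longrightarrow> (k, V) \<in> U \<longleftrightarrow> (k, V) \<in> U'"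
  shows "sys L C (amalg L C U U')"
  unfolding sys_def
proof (intro conjI allI impI)
  fix k V assume kV: "(k, V) \<in> amalg L C U U'"
  then obtain k1 V1 k2 V2 where *: "k \<le> L" "(k1, V1) \<in> U" "(k2, V2) \<in> U'" "k1 + k2 \<le> k"
    "V1 \<inter> V2 \<subseteq> V" by (elim amalgE)
  show "k \<le> L" "adm L C k V" using kV unfolding amalg_def by auto
  have "k1 + k2 \<le> L" using * by linarith
  from amalg_core[OF U U' agree *(2,3) this] obtain W where W: "(k1 + k2, W) \<in> U"
    "\<And>\<theta>. \<theta> \<in> W \<Longrightarrow> \<exists>\<nu>\<in>V1 \<inter> V2. \<nu> \<inter> A = \<theta> \<inter> A" by blast
  have "W \<noteq> {}" using W(1) sysD(3)[OF U] by blast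
  then show "V \<noteq> {}" using W(2) *(5) by blast
next
  show "(0, UNIV) \<in> amalg L C U U'"
    by (rule amalgI[OF sysD(4)[OF U] sysD(4)[OF U']]) auto
next
  fix k V k' V'
  assume kV: "(k, V) \<in> amalg L C U U'" and le: "V \<subseteq> V'" "k \<le> k'" "k' \<le> L" "adm L C k' V'"
  show "(k', V') \<in> amalg L C U U'"
    using kV
  proof (rule amalgE)
    fix k1 V1 k2 V2
    assume *: "(k1, V1) \<in> U" "(k2, V2) \<in> U'" "k1 + k2 \<le> k" "V1 \<inter> V2 \<subseteq> V"
    show ?thesis using * le by (intro amalgI[OF *(1,2)]) auto
  qed
next
  fix k V k' V'
  assume kV: "(k, V) \<in> amalg L C U U'" and kV': "(k', V') \<in> amalg L C U U'" and le: "k + k' \<le> L"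
  obtain k1 V1 k2 V2 where *: "adm L C k V" "(k1, V1) \<in> U" "(k2, V2) \<in> U'" "k1 + k2 \<le> k"
    "V1 \<inter> V2 \<subseteq> V" using kV by (elim amalgE)
  obtain k1' V1' k2' V2' where **: "adm L C k' V'" "(k1', V1') \<in> U" "(k2', V2') \<in> U'" "k1' + k2' \<le> k'"
    "V1' \<inter> V2' \<subseteq> V'" using kV' by (elim amalgE)
  have "(k1 + k1', V1 \<inter> V1') \<in> U" using sysD(6)[OF U *(2) **(2)] *(4) **(4) le by linarith
  moreover have "(k2 + k2', V2 \<inter> V2') \<in> U'" using sysD(6)[OF U' *(3) **(3)] *(4) **(4) le by linarith
  moreover have "(k1 + k1') + (k2 + k2') \<le> k + k'" using *(4) **(4) by linarith
  moreover have "(V1 \<inter> V1') \<inter> (V2 \<inter> V2') \<subseteq> V \<inter> V'" using *(5) **(5) by blast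
  ultimately show "(k + k', V \<inter> V') \<in> amalg L C U U'"
    using adm_Int[OF *(1) **(1)] le by (intro amalgI)
qed

section \<open>Amalgamation and the generic structure\<close>

text \<open>Even numbers serve as points, odd numbers are only used to form contexts: the constraints
  are indexed by \<open>m L\<close>-element sets \<open>Z\<close> of odd numbers, and constraints in different contexts do
  not interact.\<close>

locale sizes =
  fixes m :: "nat \<Rightarrow> nat"
  assumes m_gt: "L < m L"
begin

definition ctx :: "nat \<Rightarrow> nat set \<Rightarrow> nat set \<Rightarrow> bool" where
  "ctx L A Z \<longleftrightarrow> Z \<subseteq> A \<and> finite Z \<and> card Z = m L \<and> (\<forall>z\<in>Z. odd z)"

text \<open>Prescribing \<open>{}\<close> off contexts makes a structure determined by its facts.
  Structures on a finite set can then be counted by sets of facts, and types of tuples can be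
  compared by plain equality.\<close>

definition good :: "nat set \<Rightarrow> (nat \<Rightarrow> nat set \<Rightarrow> (nat \<times> nat set set) set) \<Rightarrow> bool" where
  "good A M \<longleftrightarrow> (\<forall>L Z. (ctx L A Z \<longrightarrow> sys L A (M L Z)) \<and> (\<not> ctx L A Z \<longrightarrow> M L Z = {}))"

text \<open>A partial isomorphism: only contexts inside D and constraints supported in D are
  compared, while M and M' may live on larger sets. This avoids passing to substructures whenever
  such maps are restricted, composed or inverted.\<close>

definition emb ::
  "(nat \<Rightarrow> nat) \<Rightarrow> nat set \<Rightarrow> (nat \<Rightarrow> nat set \<Rightarrow> (nat \<times> nat set set) set) \<Rightarrow>
    (nat \<Rightarrow> nat set \<Rightarrow> (nat \<times> nat set set) set) \<Rightarrow> bool" where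
  "emb \<rho> D M M' \<longleftrightarrow> inj_on \<rho> D \<and> (\<forall>x\<in>D. even (\<rho> x) = even x) \<and>
     (\<forall>L Z k V. Z \<subseteq> D \<longrightarrow> adm L D k V \<longrightarrow> ((k, V) \<in> M L Z \<longleftrightarrow> (k, push \<rho> V) \<in> M' L (\<rho> ` Z)))"

definition pull ::
  "(nat \<Rightarrow> nat) \<Rightarrow> nat set \<Rightarrow> (nat \<Rightarrow> nat set \<Rightarrow> (nat \<times> nat set set) set) \<Rightarrow>
    nat \<Rightarrow> nat set \<Rightarrow> (nat \<times> nat set set) set" where
  "pull \<rho> D M L Z = {(k, V). Z \<subseteq> D \<and> adm L D k V \<and> (k, push \<rho> V) \<in> M L (\<rho> ` Z)}"

lemma goodD: "good A M \<Longrightarrow> ctx L A Z \<Longrightarrow> sys L A (M L Z)"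
  and good_empty: "good A M \<Longrightarrow> \<not> ctx L A Z \<Longrightarrow> M L Z = {}"
  and good_ctx: "good A M \<Longrightarrow> x \<in> M L Z \<Longrightarrow> ctx L A Z"
  unfolding good_def by blast+

lemma good_adm: "good A M \<Longrightarrow> (k, V) \<in> M L Z \<Longrightarrow> adm L A k V"
  using good_ctx goodD sysD(2) by metis

lemma ctx_mono: "ctx L A Z \<Longrightarrow> A \<subseteq> B \<Longrightarrow> ctx L B Z"
  unfolding ctx_def by blast

lemma ctx_subset: "ctx L B Z \<Longrightarrow> Z \<subseteq> A \<Longrightarrow> ctx L A Z"
  unfolding ctx_def by blast

lemma embD:
  assumes "emb \<rho> D M M'"
  shows "inj_on \<rho> D" "x \<in> D \<Longrightarrow> even (\<rho> x) = even x"
    "Z \<subseteq> D \<Longrightarrow> adm L D k V \<Longrightarrow> (k, V) \<in> M L Z \<longleftrightarrow> (k, push \<rho> V) \<in> M' L (\<rho> ` Z)"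
  using assms unfolding emb_def by simp_all

lemma embI:
  assumes "inj_on \<rho> D" "\<And>x. x \<in> D \<Longrightarrow> even (\<rho> x) = even x"
    "\<And>L Z k V. Z \<subseteq> D \<Longrightarrow> adm L D k V \<Longrightarrow> (k, V) \<in> M L Z \<longleftrightarrow> (k, push \<rho> V) \<in> M' L (\<rho> ` Z)"
  shows "emb \<rho> D M M'"
  using assms unfolding emb_def by simp

lemma emb_subset:
  assumes e: "emb \<rho> D M M'" and "D' \<subseteq> D"
  shows "emb \<rho> D' M M'"
proof (rule embI)
  show "inj_on \<rho> D'" using embD(1)[OF e] assms(2) by (rule inj_on_subset)
  show "x \<in> D' \<Longrightarrow> even (\<rho> x) = even x" for x using embD(2)[OF e] assms(2) by blast
  show "(k, V) \<in> M L Z \<longleftrightarrow> (k, push \<rho> V) \<in> M' L (\<rho> ` Z)" if "Z \<subseteq> D'" "adm L D' k V" for L Z k V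
    by (rule embD(3)[OF e]) (use that assms(2) adm_mono in blast)+
qed

lemma emb_cong:
  assumes e: "emb \<rho> D M M'" and eq: "\<And>x. x \<in> D \<Longrightarrow> \<rho>' x = \<rho> x"
  shows "emb \<rho>' D M M'"
proof (rule embI)
  show "inj_on \<rho>' D" using embD(1)[OF e] inj_on_cong[of D \<rho>' \<rho>] eq by simp
  show "x \<in> D \<Longrightarrow> even (\<rho>' x) = even x" for x using embD(2)[OF e] eq by simp
  show "(k, V) \<in> M L Z \<longleftrightarrow> (k, push \<rho>' V) \<in> M' L (\<rho>' ` Z)" if Z: "Z \<subseteq> D" and V: "adm L D k V" for L Z k V
  proof -
    obtain P where P: "P \<subseteq> D" "supp P V" using V unfolding adm_def by blast
    have "push \<rho>' V = push \<rho> V" by (rule push_cong[OF P(2)]) (use P(1) eq in blast)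
    moreover have "\<rho>' ` Z = \<rho> ` Z" by (rule image_cong) (use Z eq in auto)
    ultimately show ?thesis using embD(3)[OF e Z V] by simp
  qed
qed

lemma emb_comp:
  assumes e: "emb \<rho> D M M'" and e': "emb \<rho>' D' M' M''" and sub: "\<rho> ` D \<subseteq> D'"
  shows "emb (\<rho>' \<circ> \<rho>) D M M''"
proof (rule embI)
  show "inj_on (\<rho>' \<circ> \<rho>) D"
    using embD(1)[OF e] inj_on_subset[OF embD(1)[OF e'] sub] by (rule comp_inj_on)
  show "x \<in> D \<Longrightarrow> even ((\<rho>' \<circ> \<rho>) x) = even x" for x
    using embD(2)[OF e, of x] embD(2)[OF e', of "\<rho> x"] sub by auto
  show "(k, V) \<in> M L Z \<longleftrightarrow> (k, push (\<rho>' \<circ> \<rho>) V) \<in> M'' L ((\<rho>' \<circ> \<rho>) ` Z)"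
    if Z: "Z \<subseteq> D" and V: "adm L D k V" for L Z k V
  proof -
    have "adm L D' k (push \<rho> V)" by (rule adm_push[OF V embD(2)[OF e] sub])
    moreover have "\<rho> ` Z \<subseteq> D'" using Z sub by blast
    ultimately show ?thesis
      using embD(3)[OF e Z V] embD(3)[OF e'] by (simp add: push_comp image_comp)
  qed
qed

lemma emb_inverse:
  assumes e: "emb \<rho> D M M'" and inv: "\<And>x. x \<in> D \<Longrightarrow> \<rho>' (\<rho> x) = x"
  shows "emb \<rho>' (\<rho> ` D) M' M"
proof (rule embI)
  show "inj_on \<rho>' (\<rho> ` D)" using inv by (auto intro!: inj_onI)
  show par: "even (\<rho>' y) = even y" if "y \<in> \<rho> ` D" for y
    using that embD(2)[OF e] inv by auto
  have img: "\<rho>' ` \<rho> ` D \<subseteq> D" using inv by auto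
  show "(k, V) \<in> M' L Z \<longleftrightarrow> (k, push \<rho>' V) \<in> M L (\<rho>' ` Z)"
    if Z: "Z \<subseteq> \<rho> ` D" and V: "adm L (\<rho> ` D) k V" for L Z k V
  proof -
    obtain P where P: "P \<subseteq> \<rho> ` D" "supp P V" using V unfolding adm_def by blast
    have "push (\<rho> \<circ> \<rho>') V = push id V"
      by (rule push_cong[OF P(2)]) (use P(1) inv in auto)
    then have "push \<rho> (push \<rho>' V) = V" by (simp add: push_comp)
    moreover have "\<rho> ` \<rho>' ` Z = (\<lambda>x. x) ` Z" unfolding image_image
      by (rule image_cong) (use Z inv in auto)
    moreover have "\<rho>' ` Z \<subseteq> D" using Z inv by auto
    ultimately show ?thesis
      using embD(3)[OF e _ adm_push[OF V par img]] by simp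
  qed
qed

lemma emb_id: "emb id D M M"
  by (rule embI) simp_all

lemma good_pull:
  assumes g: "good A M" and inj: "inj_on \<rho> D" and par: "\<And>x. x \<in> D \<Longrightarrow> even (\<rho> x) = even x"
    and sub: "\<rho> ` D \<subseteq> A"
  shows "good D (pull \<rho> D M)" and "emb \<rho> D (pull \<rho> D M) M"
proof -
  have ctx: "ctx L D Z \<longleftrightarrow> ctx L A (\<rho> ` Z)" if "Z \<subseteq> D" for L Z
  proof -
    have "inj_on \<rho> Z" using inj that by (rule inj_on_subset)
    then have "card (\<rho> ` Z) = card Z" "finite (\<rho> ` Z) = finite Z"
      by (auto simp: card_image dest: finite_imageD)
    moreover have "(\<forall>z\<in>Z. odd z) \<longleftrightarrow> (\<forall>z\<in>\<rho> ` Z. odd z)" using par that by auto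
    moreover have "\<rho> ` Z \<subseteq> A" using sub that by blast
    ultimately show ?thesis using that unfolding ctx_def by simp
  qed
  show "good D (pull \<rho> D M)" unfolding good_def
  proof (intro allI conjI impI)
    fix L Z assume Z: "ctx L D Z"
    then have ZD: "Z \<subseteq> D" by (simp add: ctx_def)
    have S: "sys L A (M L (\<rho> ` Z))" using goodD[OF g] ctx[OF ZD] Z by blast
    show "sys L D (pull \<rho> D M L Z)" unfolding sys_def
    proof (intro conjI allI impI)
      fix k V assume "(k, V) \<in> pull \<rho> D M L Z"
      then have V: "adm L D k V" "(k, push \<rho> V) \<in> M L (\<rho> ` Z)" by (auto simp: pull_def)
      show "k \<le> L" using sysD(1)[OF S V(2)] .
      show "adm L D k V" by (rule V)
      show "V \<noteq> {}" using V(2) sysD(3)[OF S] by auto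
    next
      show "(0, UNIV) \<in> pull \<rho> D M L Z" using sysD(4)[OF S] ZD by (simp add: pull_def)
    next
      fix k V k' V'
      assume a: "(k, V) \<in> pull \<rho> D M L Z" "V \<subseteq> V'" "k \<le> k'" "k' \<le> L" "adm L D k' V'"
      have "(k, push \<rho> V) \<in> M L (\<rho> ` Z)" using a(1) by (simp add: pull_def)
      from sysD(5)[OF S this push_mono[OF a(2)] a(3,4) adm_push[OF a(5) par sub]]
      show "(k', V') \<in> pull \<rho> D M L Z" using a(5) ZD by (simp add: pull_def)
    next
      fix k V k' V'
      assume a: "(k, V) \<in> pull \<rho> D M L Z" "(k', V') \<in> pull \<rho> D M L Z" "k + k' \<le> L"
      then have "(k + k', push \<rho> V \<inter> push \<rho> V') \<in> M L (\<rho> ` Z)"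
        by (intro sysD(6)[OF S]) (simp_all add: pull_def)
      moreover have "adm L D (k + k') (V \<inter> V')"
        using a by (intro adm_Int) (simp_all add: pull_def)
      ultimately show "(k + k', V \<inter> V') \<in> pull \<rho> D M L Z"
        using ZD by (simp add: pull_def push_Int)
    qed
  next
    fix L Z assume "\<not> ctx L D Z"
    then have "\<not> ctx L A (\<rho> ` Z) \<or> \<not> Z \<subseteq> D" using ctx by blast
    then show "pull \<rho> D M L Z = {}" using good_empty[OF g] by (auto simp: pull_def)
  qed
  show "emb \<rho> D (pull \<rho> D M) M"
    by (rule embI[OF inj par]) (simp_all add: pull_def)
qed

text \<open>Strong amalgamation, carried out separately for each level and context, since different
  contexts do not interact.\<close>

lemma amalgamation:
  assumes gA: "good A M" and gB: "good B M'" and e: "emb id (A \<inter> B) M M'"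
  obtains N where "good (A \<union> B) N" "emb id A M N" "emb id B M' N"
proof -
  define U where "U L Z = (if Z \<subseteq> A then M L Z else triv_sys L)" for L Z
  define U' where "U' L Z = (if Z \<subseteq> B then M' L Z else triv_sys L)" for L Z
  define N where "N L Z = (if ctx L (A \<union> B) Z then amalg L (A \<union> B) (U L Z) (U' L Z) else {})" for L Z
  \<comment> \<open>A side that does not contain Z contributes the least filter over the empty set,
    so that agreement on the intersection follows from \<open>sys_empty_part\<close>.\<close>
  define a where "a Z = (if Z \<subseteq> A then A else {})" for Z
  define b where "b Z = (if Z \<subseteq> B then B else {})" for Z
  have sA: "sys L (a Z) (U L Z)" and sB: "sys L (b Z) (U' L Z)" if "ctx L (A \<union> B) Z" for L Z
    using goodD[OF gA ctx_subset[OF that]] goodD[OF gB ctx_subset[OF that]]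
    by (auto simp: U_def U'_def a_def b_def sys_triv)
  have agree: "(k, V) \<in> U L Z \<longleftrightarrow> (k, V) \<in> U' L Z"
    if Z: "ctx L (A \<union> B) Z" and V: "adm L (a Z \<inter> b Z) k V" for L Z k V
  proof (cases "Z \<subseteq> A \<and> Z \<subseteq> B")
    case True
    then show ?thesis using embD(3)[OF e, of Z L k V] V by (simp add: U_def U'_def a_def b_def)
  next
    case False
    then have "adm L {} k V" using V by (auto simp: a_def b_def split: if_splits)
    then show ?thesis using sys_empty_part[OF sA[OF Z]] sys_empty_part[OF sB[OF Z]] by blast
  qed
  have "good (A \<union> B) N" unfolding good_def N_def
    using sys_amalg[OF sA sB agree] by auto
  moreover have "emb id A M N"
  proof (rule embI)
    fix L Z k V assume Z: "Z \<subseteq> A" and V: "adm L A k V"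
    show "(k, V) \<in> M L Z \<longleftrightarrow> (k, push id V) \<in> N L (id ` Z)"
    proof (cases "ctx L A Z")
      case True
      then have c: "ctx L (A \<union> B) Z" by (rule ctx_mono) simp
      have aZ: "a Z = A" using Z by (simp add: a_def)
      show ?thesis
        using amalg_left[OF sA[OF c] sB[OF c] agree[OF c], of "A \<union> B" k V] V Z c
        by (simp add: N_def U_def aZ)
    next
      case False
      then have "\<not> ctx L (A \<union> B) Z" using ctx_subset[OF _ Z] by blast
      then show ?thesis using good_empty[OF gA False] by (simp add: N_def)
    qed
  qed simp_all
  moreover have "emb id B M' N"
  proof (rule embI)
    fix L Z k V assume Z: "Z \<subseteq> B" and V: "adm L B k V"
    show "(k, V) \<in> M' L Z \<longleftrightarrow> (k, push id V) \<in> N L (id ` Z)"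
    proof (cases "ctx L B Z")
      case True
      then have c: "ctx L (A \<union> B) Z" by (rule ctx_mono) simp
      have bZ: "b Z = B" using Z by (simp add: b_def)
      have agree': "(k, V) \<in> U' L Z \<longleftrightarrow> (k, V) \<in> U L Z" if "adm L (b Z \<inter> a Z) k V" for k V
        using agree[OF c, of k V] that by (simp add: Int_commute)
      show ?thesis
        using amalg_left[OF sB[OF c] sA[OF c] agree', of "A \<union> B" k V] V Z c
        by (simp add: N_def U'_def bZ amalg_commute[of L "A \<union> B" "M' L Z"])
    next
      case False
      then have "\<not> ctx L (A \<union> B) Z" using ctx_subset[OF _ Z] by blast
      then show ?thesis using good_empty[OF gB False] by (simp add: N_def)
    qed
  qed simp_all
  ultimately show thesis by (rule that)
qed

text \<open>The point x may happen to lie in A, so it is first renamed to some y outside A; an even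
  shift beyond the maximum keeps the parity. The two structures then meet exactly in D.\<close>

lemma one_point_amalgam:
  assumes fin: "finite A" and gA: "good A M" and D: "D \<subseteq> A" and x: "x \<notin> D"
    and g: "good (insert x D) M'" and e: "emb id D M' M"
  obtains y N where "y \<notin> A" "even y = even x" "good (insert y A) N" "emb id A M N"
    "emb (id(x := y)) (insert x D) M' N"
proof -
  define y where "y = x + 2 * Suc (Max (insert 0 A))"
  have "y \<notin> A"
  proof
    assume "y \<in> A"
    then have "y \<le> Max (insert 0 A)" using fin by simp
    then show False by (simp add: y_def)
  qed
  have par: "even y = even x" by (simp add: y_def)
  have yD: "y \<notin> D" using \<open>y \<notin> A\<close> D by blast
  define \<sigma> where "\<sigma> = id(y := x)"
  have inj: "inj_on \<sigma> (insert y D)" using x by (auto simp: \<sigma>_def inj_on_def)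
  have img: "\<sigma> ` insert y D = insert x D" using yD by (auto simp: \<sigma>_def)
  have ps: "even (\<sigma> z) = even z" for z using par by (simp add: \<sigma>_def)
  have g': "good (insert y D) (pull \<sigma> (insert y D) M')"
    and e': "emb \<sigma> (insert y D) (pull \<sigma> (insert y D) M') M'"
    using good_pull[OF g inj ps] img by auto
  have int: "A \<inter> insert y D = D" using \<open>y \<notin> A\<close> D by blast
  have "emb id D (pull \<sigma> (insert y D) M') M'"
    by (rule emb_cong[OF emb_subset[OF e']]) (use yD in \<open>auto simp: \<sigma>_def\<close>)
  from emb_comp[OF this e] have "emb id D (pull \<sigma> (insert y D) M') M" by simp
  from emb_inverse[OF this, of id] have "emb id (A \<inter> insert y D) M (pull \<sigma> (insert y D) M')"
    by (simp add: int)
  from amalgamation[OF gA g' this] obtain N where N: "good (A \<union> insert y D) N" "emb id A M N"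
    "emb id (insert y D) (pull \<sigma> (insert y D) M') N" by blast
  have e'': "emb (id(x := y)) (insert x D) M' (pull \<sigma> (insert y D) M')"
  proof -
    have "(id(x := y)) (\<sigma> z) = z" if "z \<in> insert y D" for z
      using that x by (auto simp: \<sigma>_def)
    from emb_inverse[OF e' this] show ?thesis by (simp only: img)
  qed
  have "emb (id \<circ> id(x := y)) (insert x D) M' N"
    by (rule emb_comp[OF e'' N(3)]) auto
  moreover have "A \<union> insert y D = insert y A" using D by blast
  ultimately show thesis using that[OF \<open>y \<notin> A\<close> par _ N(2)] N(1) by simp
qed

end

lemma finite_subset_incseq:
  assumes "finite F" "F \<subseteq> (\<Union>i. A i)" "incseq A"
  shows "\<exists>i::nat. F \<subseteq> A i"
  using assms(1,2)
proof (induction F)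
  case (insert x F)
  then obtain i j where "F \<subseteq> A i" "x \<in> A j" by blast
  moreover have "A i \<subseteq> A (max i j)" "A j \<subseteq> A (max i j)"
    using assms(3) by (auto simp: incseq_def)
  ultimately show ?case by blast
qed simp

section \<open>Finiteness of the set of structures on a finite set, and the generic structure as a
  limit\<close>

context sizes
begin

definition facts :: "nat set \<Rightarrow> (nat \<times> nat set \<times> nat \<times> nat set set) set" where
  "facts A = {(L, Z, k, V). ctx L A Z \<and> k \<le> L \<and> adm L A k V}"

lemma finite_adm:
  assumes "finite A"
  shows "finite {V. adm L A k V}"
proof (rule finite_subset)
  show "{V. adm L A k V} \<subseteq> (\<lambda>W. {\<theta>. \<theta> \<inter> A \<in> W}) ` Pow (Pow A)"
  proof
    fix V assume "V \<in> {V. adm L A k V}"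
    then obtain P where P: "P \<subseteq> A" "supp P V" by (auto simp: adm_def)
    have "\<theta> \<inter> A \<in> V \<longleftrightarrow> \<theta> \<in> V" for \<theta>
      by (rule suppD[OF P(2)]) (use P(1) in blast)
    then have "V = {\<theta>. \<theta> \<inter> A \<in> V \<inter> Pow A}" by auto
    then show "V \<in> (\<lambda>W. {\<theta>. \<theta> \<inter> A \<in> W}) ` Pow (Pow A)" by blast
  qed
qed (use assms in simp)

text \<open>A context in A forces \<open>m L \<le> card A\<close>, and \<open>L < m L\<close> then
  leaves finitely many levels. At each of them a constraint is determined by the subsets of A that
  satisfy it.\<close>

lemma finite_facts:
  assumes "finite A"
  shows "finite (facts A)"
proof (rule finite_subset)
  show "facts A \<subseteq> (SIGMA L:{..card A}. SIGMA Z:Pow A. SIGMA k:{..L}. {V. adm L A k V})"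
  proof
    fix f assume "f \<in> facts A"
    then obtain L Z k V where f: "f = (L, Z, k, V)" "ctx L A Z" "k \<le> L" "adm L A k V"
      by (auto simp: facts_def)
    have "Z \<subseteq> A" "card Z = m L" using f(2) by (simp_all add: ctx_def)
    then have "L \<le> card A" using card_mono[OF assms, of Z] m_gt[of L] by simp
    then show "f \<in> (SIGMA L:{..card A}. SIGMA Z:Pow A. SIGMA k:{..L}. {V. adm L A k V})"
      using f \<open>Z \<subseteq> A\<close> by simp
  qed
  show "finite (SIGMA L:{..card A}. SIGMA Z:Pow A. SIGMA k:{..L}. {V. adm L A k V})"
    using assms finite_adm by (intro finite_SigmaI) auto
qed

lemma
  assumes "finite A"
  shows finite_good: "finite {M. good A M}"
    and card_good: "card {M. good A M} \<le> 2 ^ card (facts A)"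
proof -
  let ?h = "\<lambda>X L Z. {(k, V). (L, Z, k, V) \<in> X}"
  have sub: "{M. good A M} \<subseteq> ?h ` Pow (facts A)"
  proof
    fix M assume "M \<in> {M. good A M}"
    then have g: "good A M" by simp
    let ?X = "{(L, Z, k, V). (k, V) \<in> M L Z}"
    have "?X \<subseteq> facts A"
      using good_ctx[OF g] good_adm[OF g] sysD(1)[OF goodD[OF g]] by (auto simp: facts_def)
    moreover have "M = ?h ?X" by auto
    ultimately show "M \<in> ?h ` Pow (facts A)" by blast
  qed
  have fin: "finite (Pow (facts A))" using finite_facts[OF assms] by simp
  show "finite {M. good A M}" using sub finite_imageI[OF fin] by (rule finite_subset)
  have "card {M. good A M} \<le> card (?h ` Pow (facts A))"
    by (rule card_mono[OF finite_imageI[OF fin] sub])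
  also have "\<dots> \<le> card (Pow (facts A))" by (rule card_image_le[OF fin])
  also have "\<dots> = 2 ^ card (facts A)" by (rule card_Pow[OF finite_facts[OF assms]])
  finally show "card {M. good A M} \<le> 2 ^ card (facts A)" .
qed

text \<open>The extension tasks of the Fraisse construction. There are countably many because each
  finite set carries only finitely many structures.\<close>

definition one_point_types ::
  "(nat set \<times> nat \<times> (nat \<Rightarrow> nat set \<Rightarrow> (nat \<times> nat set set) set)) set" where
  "one_point_types = {(D, x, M). finite D \<and> x \<notin> D \<and> good (insert x D) M}"

lemma countable_one_point_types: "countable one_point_types"
proof (rule countable_subset)
  show "one_point_types \<subseteq> (SIGMA D:{D. finite D}. SIGMA x:UNIV. {M. good (insert x D) M})"
    by (auto simp: one_point_types_def)
  show "countable (SIGMA D:{D::nat set. finite D}. SIGMA x:UNIV. {M. good (insert x D) M})"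
    by (intro countable_SIGMA countable_Collect_finite) (auto intro!: countable_finite finite_good)
qed

lemma good_empty_structure: "good {} (\<lambda>_ _. {})"
proof -
  have "\<not> ctx L {} Z" for L Z using m_gt[of L] by (auto simp: ctx_def)
  then show ?thesis by (simp add: good_def)
qed

text \<open>Since the links are embeddings, a fact is decided at the first stage that contains its
  context and a support. Every filter axiom involves finitely many facts and is inherited from a
  sufficiently late stage.\<close>

lemma union_of_chain:
  fixes A :: "nat \<Rightarrow> nat set" and M
  assumes g: "\<And>i. good (A i) (M i)" and inc: "\<And>i. A i \<subseteq> A (Suc i)"
    and e: "\<And>i. emb id (A i) (M i) (M (Suc i))"
  defines "N \<equiv> \<lambda>L Z. \<Union>i. M i L Z"
  shows "good (\<Union>i. A i) N" and "emb id (A i) (M i) N"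
proof -
  have mono: "A i \<subseteq> A j" if "i \<le> j" for i j
    using lift_Suc_mono_le[of A, OF inc that] .
  then have incs: "incseq A" by (simp add: incseq_def)
  have emb_le: "emb id (A i) (M i) (M j)" if "i \<le> j" for i j
    using that
  proof (induction j rule: dec_induct)
    case base show ?case by (rule emb_id)
  next
    case (step n)
    have "emb (id \<circ> id) (A i) (M i) (M (Suc n))"
      by (rule emb_comp[OF step(3) e]) (use mono[OF step(1)] in simp)
    then show ?case by (simp only: id_o)
  qed
  have iff: "(k, V) \<in> M j L Z \<longleftrightarrow> (k, V) \<in> M i L Z"
    if "i \<le> j" "Z \<subseteq> A i" "adm L (A i) k V" for i j L Z k V
    using embD(3)[OF emb_le[OF that(1)] that(2,3)] by simp
  have up: "(k, V) \<in> M j L Z" if "i \<le> j" "(k, V) \<in> M i L Z" for i j L Z k V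
    using iff[OF that(1), of Z L k V] good_ctx[OF g that(2)] good_adm[OF g that(2)] that(2)
    by (simp add: ctx_def)
  show "emb id (A i) (M i) N" for i
  proof (rule embI)
    fix L Z k V assume *: "Z \<subseteq> A i" "adm L (A i) k V"
    show "(k, V) \<in> M i L Z \<longleftrightarrow> (k, push id V) \<in> N L (id ` Z)"
    proof
      assume "(k, push id V) \<in> N L (id ` Z)"
      then obtain j where "(k, V) \<in> M j L Z" by (auto simp: N_def)
      then have "(k, V) \<in> M (max i j) L Z" by (rule up[rotated]) simp
      then show "(k, V) \<in> M i L Z" using iff[of i "max i j", OF _ *] by simp
    qed (auto simp: N_def)
  qed simp_all
  show "good (\<Union>i. A i) N" unfolding good_def
  proof (intro allI conjI impI)
    fix L Z assume Z: "ctx L (\<Union>i. A i) Z"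
    then obtain i0 where i0: "Z \<subseteq> A i0"
      using finite_subset_incseq[OF _ _ incs, of Z] by (auto simp: ctx_def)
    have S: "sys L (A i) (M i L Z)" if "i0 \<le> i" for i
      using goodD[OF g] ctx_subset[OF Z] i0 mono[OF that] by blast
    have ex: "\<exists>i. (k, V) \<in> M i L Z \<and> i0 \<le> i \<and> j \<le> i" if kV: "(k, V) \<in> N L Z" for k V j
    proof -
      obtain i where "(k, V) \<in> M i L Z" using kV by (auto simp: N_def)
      then have "(k, V) \<in> M (max i (max i0 j)) L Z" by (rule up[rotated]) simp
      moreover have "i0 \<le> max i (max i0 j)" "j \<le> max i (max i0 j)" by auto
      ultimately show ?thesis by blast
    qed
    have adm: "adm L (\<Union>i. A i) k V" if "adm L (A i) k V" for i k V
      using adm_mono[OF that, of "\<Union>i. A i" k] by blast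
    show "sys L (\<Union>i. A i) (N L Z)" unfolding sys_def
    proof (intro conjI allI impI)
      fix k V assume "(k, V) \<in> N L Z"
      then obtain i where i: "(k, V) \<in> M i L Z" "i0 \<le> i" using ex by blast
      show "k \<le> L" by (rule sysD(1)[OF S i(1)]) (rule i)
      show "adm L (\<Union>i. A i) k V" by (rule adm[OF sysD(2)[OF S i(1)]]) (rule i)
      show "V \<noteq> {}" using sysD(3)[OF S[OF i(2)]] i(1) by blast
    next
      show "(0, UNIV) \<in> N L Z" using sysD(4)[OF S[OF order_refl]] by (auto simp: N_def)
    next
      fix k V k' V'
      assume kV: "(k, V) \<in> N L Z" and *: "V \<subseteq> V'" "k \<le> k'" "k' \<le> L" "adm L (\<Union>i. A i) k' V'"
      obtain P where P: "P \<subseteq> (\<Union>i. A i)" "finite P" "card P \<le> k' * 2 ^ L" "\<forall>x\<in>P. even x" "supp P V'"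
        using *(4) unfolding adm_def by blast
      obtain j where "P \<subseteq> A j" using finite_subset_incseq[OF P(2,1) incs] by blast
      then have j: "adm L (A j) k' V'" using P unfolding adm_def by blast
      obtain i where i: "(k, V) \<in> M i L Z" "i0 \<le> i" "j \<le> i" using ex[OF kV] by blast
      have "(k', V') \<in> M i L Z"
        by (rule sysD(5)[OF S[OF i(2)] i(1) *(1-3) adm_mono[OF j mono[OF i(3)] order_refl]])
      then show "(k', V') \<in> N L Z" by (auto simp: N_def)
    next
      fix k V k' V'
      assume kV: "(k, V) \<in> N L Z" "(k', V') \<in> N L Z" and le: "k + k' \<le> L"
      obtain j where j: "(k', V') \<in> M j L Z" using kV(2) by (auto simp: N_def)
      obtain i where i: "(k, V) \<in> M i L Z" "i0 \<le> i" "j \<le> i" using ex[OF kV(1)] by blast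
      have "(k + k', V \<inter> V') \<in> M i L Z"
        by (rule sysD(6)[OF S[OF i(2)] i(1) up[OF i(3) j] le])
      then show "(k + k', V \<inter> V') \<in> N L Z" by (auto simp: N_def)
    qed
  next
    fix L Z assume Z: "\<not> ctx L (\<Union>i. A i) Z"
    have "\<not> ctx L (A i) Z" for i using ctx_mono[of L "A i" Z "\<Union>i. A i"] Z by blast
    then show "N L Z = {}" using good_empty[OF g] by (simp add: N_def)
  qed
qed

lemma generic_structure_exists:
  obtains A M where "good A M"
    "\<And>D x M'. finite D \<Longrightarrow> D \<subseteq> A \<Longrightarrow> x \<notin> D \<Longrightarrow> good (insert x D) M' \<Longrightarrow> emb id D M' M \<Longrightarrow>
       \<exists>y. y \<in> A \<and> y \<notin> D \<and> emb (id(x := y)) (insert x D) M' M"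
proof -
  define I where "I = {(A, M). finite A \<and> good A M}"
  \<comment> \<open>A task whose premise fails at the present stage is met vacuously. It recurs
    after D has been absorbed, and if its premise holds by then, \<open>one_point_amalgam\<close>
    adjoins the new point.\<close>
  define step where "step = (\<lambda>(D, x, M') (A, M) (A', N). A \<subseteq> A' \<and> emb id A M N \<and>
    (D \<subseteq> A \<longrightarrow> emb id D M' M \<longrightarrow>
      (\<exists>y. y \<in> A' \<and> y \<notin> D \<and> emb (id(x := y)) (insert x D) M' N)))"
  have ex: "\<exists>p'\<in>I. step r p p'" if r: "r \<in> one_point_types" and p: "p \<in> I" for r p
  proof -
    obtain D x M' where rr: "r = (D, x, M')" by (cases r)
    obtain A M where pp: "p = (A, M)" by (cases p)
    have r': "finite D" "x \<notin> D" "good (insert x D) M'" using r by (auto simp: rr one_point_types_def)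
    have p': "finite A" "good A M" using p by (auto simp: pp I_def)
    show ?thesis
    proof (cases "D \<subseteq> A \<and> emb id D M' M")
      case True
      from one_point_amalgam[OF p' conjunct1[OF True] r'(2,3) conjunct2[OF True]]
      obtain y N where y: "y \<notin> A" "even y = even x" "good (insert y A) N" "emb id A M N"
        "emb (id(x := y)) (insert x D) M' N" by blast
      have "(insert y A, N) \<in> I" using y(3) p'(1) by (simp add: I_def)
      moreover have "step r p (insert y A, N)"
        unfolding step_def rr pp prod.case using y True by blast
      ultimately show ?thesis by blast
    next
      case False
      then have "step r p p" unfolding step_def rr pp prod.case using emb_id by blast
      then show ?thesis using p by blast
    qed
  qed
  have start: "({}, \<lambda>_ _. {}) \<in> I" by (simp add: I_def good_empty_structure)
  have ne: "one_point_types \<noteq> {}"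
  proof -
    have "\<not> ctx L {0} Z" for L Z
    proof
      assume c: "ctx L {0} Z"
      then have "Z = {}" by (auto simp: ctx_def)
      then show False using c m_gt[of L] by (simp add: ctx_def)
    qed
    then have "good (insert 0 {}) (\<lambda>_ _. {})" by (simp add: good_def)
    then have "({}, 0, \<lambda>_ _. {}) \<in> one_point_types" by (simp add: one_point_types_def)
    then show ?thesis by blast
  qed
  have "\<exists>p. p 0 = ({}, \<lambda>_ _. {}) \<and> (\<forall>i. p i \<in> I) \<and>
    (\<forall>i. \<exists>r\<in>one_point_types. step r (p i) (p (Suc i))) \<and>
    (\<forall>r\<in>one_point_types. \<forall>N. \<exists>i\<ge>N. step r (p i) (p (Suc i)))"
    by (rule chain_meeting_requirements[OF countable_one_point_types ne start ex])
  then obtain p where p: "\<And>i. p i \<in> I"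
    "\<And>i. \<exists>r\<in>one_point_types. step r (p i) (p (Suc i))"
    "\<And>r N. r \<in> one_point_types \<Longrightarrow> \<exists>i\<ge>N. step r (p i) (p (Suc i))" by blast
  define A where "A i = fst (p i)" for i
  define M where "M i = snd (p i)" for i
  define N where "N L Z = (\<Union>i. M i L Z)" for L Z
  have pAM: "p i = (A i, M i)" for i by (simp add: A_def M_def)
  have g: "good (A i) (M i)" for i using p(1)[of i] by (simp add: pAM I_def)
  have stepS: "A i \<subseteq> A (Suc i)" "emb id (A i) (M i) (M (Suc i))" for i
    using p(2)[of i] by (auto simp: pAM step_def)
  have gN: "good (\<Union>i. A i) N" and eN: "emb id (A i) (M i) N" for i
    using union_of_chain[of A M, OF g stepS] unfolding N_def by blast+
  show thesis
  proof (rule that[OF gN])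
    fix D x M'
    assume D: "finite D" "D \<subseteq> (\<Union>i. A i)" and x: "x \<notin> D" and gM: "good (insert x D) M'"
      and e: "emb id D M' N"
    have "incseq A" by (rule incseq_SucI) (rule stepS)
    then obtain n where n: "D \<subseteq> A n" using finite_subset_incseq[OF D] by blast
    have "(D, x, M') \<in> one_point_types" using D(1) x gM by (simp add: one_point_types_def)
    then obtain i where i: "i \<ge> n" "step (D, x, M') (p i) (p (Suc i))" using p(3) by blast
    have Di: "D \<subseteq> A i" using n lift_Suc_mono_le[of A, OF stepS(1) i(1)] by blast
    \<comment> \<open>The premise is given for the limit N; inverting the inclusion of stage i
      brings it down to that stage, where it triggers the task.\<close>
    have "emb id D N (M i)"
      using emb_inverse[OF emb_subset[OF eN[of i] Di], of id] by simp
    from emb_comp[OF e this] have "emb id D M' (M i)" by (simp add: id_o)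
    with i(2) Di obtain y where y: "y \<in> A (Suc i)" "y \<notin> D" "emb (id(x := y)) (insert x D) M' (M (Suc i))"
      by (auto simp: step_def pAM)
    have "(id(x := y)) ` insert x D \<subseteq> A (Suc i)" using y(1) Di stepS(1)[of i] by auto
    from emb_comp[OF y(3) eN this] have "emb (id(x := y)) (insert x D) M' N" by simp
    then show "\<exists>y. y \<in> (\<Union>i. A i) \<and> y \<notin> D \<and> emb (id(x := y)) (insert x D) M' N"
      using y(1,2) by blast
  qed
qed

end

section \<open>Universality and homogeneity of the generic structure\<close>

locale generic = sizes +
  fixes A :: "nat set" and M :: "nat \<Rightarrow> nat set \<Rightarrow> (nat \<times> nat set set) set"
  assumes good_AM: "good A M"
    and one_point_ext: "\<And>D x M'. finite D \<Longrightarrow> D \<subseteq> A \<Longrightarrow> x \<notin> D \<Longrightarrow> good (insert x D) M' \<Longrightarrow>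
      emb id D M' M \<Longrightarrow> \<exists>y. y \<in> A \<and> y \<notin> D \<and> emb (id(x := y)) (insert x D) M' M"
begin

text \<open>\<open>one_point_ext\<close> extends inclusions. Transporting N along the inverse of
  \<rho>, extended by a fresh name x' for x of the same parity, turns the task for \<rho> into one
  for the inclusion of the image of D.\<close>

lemma forth:
  assumes Q: "good Q N" and D: "finite D" "D \<subseteq> Q" and e: "emb \<rho> D N M" and im: "\<rho> ` D \<subseteq> A"
    and x: "x \<in> Q" "x \<notin> D"
  shows "\<exists>y\<in>A. y \<notin> \<rho> ` D \<and> emb (\<rho>(x := y)) (insert x D) N M"
proof -
  define x' where "x' = x + 2 * Suc (Max (insert 0 (\<rho> ` D)))"
  have x': "x' \<notin> \<rho> ` D"
  proof
    assume "x' \<in> \<rho> ` D"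
    then have "x' \<le> Max (insert 0 (\<rho> ` D))" using D by simp
    then show False by (simp add: x'_def)
  qed
  have par: "even x' = even x" by (simp add: x'_def)
  define \<tau> where "\<tau> = (inv_into D \<rho>)(x' := x)"
  have inv: "\<tau> (\<rho> z) = z" if "z \<in> D" for z
    using inv_into_f_f[OF embD(1)[OF e] that] that x' by (auto simp: \<tau>_def)
  have \<tau>x': "\<tau> x' = x" by (simp add: \<tau>_def)
  have inv': "\<tau> ((\<rho>(x := x')) z) = z" if "z \<in> insert x D" for z
    using that inv \<tau>x' by auto
  have img: "(\<rho>(x := x')) ` insert x D = insert x' (\<rho> ` D)" using x(2) by auto
  have e1: "emb \<tau> (\<rho> ` D) M N" by (rule emb_inverse[OF e inv])
  have inj: "inj_on \<tau> (insert x' (\<rho> ` D))"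
    using inv \<tau>x' x(2) by (auto simp: inj_on_def)
  have ps: "even (\<tau> z) = even z" if "z \<in> insert x' (\<rho> ` D)" for z
    using that embD(2)[OF e1, of z] \<tau>x' par by auto
  have sub: "\<tau> ` insert x' (\<rho> ` D) \<subseteq> Q" using inv \<tau>x' x(1) D(2) by auto
  let ?P = "pull \<tau> (insert x' (\<rho> ` D)) N"
  have g: "good (insert x' (\<rho> ` D)) ?P" and e2: "emb \<tau> (insert x' (\<rho> ` D)) ?P N"
    using good_pull[OF Q inj ps sub] by blast+
  have img2: "\<tau> ` insert x' (\<rho> ` D) = insert x D"
    using inv' by (simp only: img[symmetric] image_image) auto
  have "emb (\<rho>(x := x')) (\<tau> ` insert x' (\<rho> ` D)) N ?P"
  proof (rule emb_inverse[OF e2])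
    fix z assume "z \<in> insert x' (\<rho> ` D)"
    then obtain w where "w \<in> insert x D" "z = (\<rho>(x := x')) w" using img by blast
    then show "(\<rho>(x := x')) (\<tau> z) = z" using inv' by simp
  qed
  then have e3: "emb (\<rho>(x := x')) (insert x D) N ?P" by (simp only: img2)
  have e4: "emb (\<rho> \<circ> \<tau>) (\<rho> ` D) ?P M"
    by (rule emb_comp[OF emb_subset[OF e2] e]) (use inv in auto)
  have "emb id (\<rho> ` D) ?P M"
    by (rule emb_cong[OF e4]) (use inv in auto)
  from one_point_ext[OF _ im x' g this] D(1) obtain y where y: "y \<in> A" "y \<notin> \<rho> ` D"
    "emb (id(x' := y)) (insert x' (\<rho> ` D)) ?P M" by blast
  have "emb (id(x' := y) \<circ> \<rho>(x := x')) (insert x D) N M"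
    by (rule emb_comp[OF e3 y(3)]) (use img in auto)
  then have "emb (\<rho>(x := y)) (insert x D) N M"
    by (rule emb_cong) (use x' in auto)
  with y show ?thesis by blast
qed

lemma limit_map:
  fixes D :: "nat \<Rightarrow> nat set" and \<rho> :: "nat \<Rightarrow> nat \<Rightarrow> nat"
  assumes inc: "\<And>i. D i \<subseteq> D (Suc i)" and coh: "\<And>i z. z \<in> D i \<Longrightarrow> \<rho> (Suc i) z = \<rho> i z"
  obtains \<sigma> where "\<And>i z. z \<in> D i \<Longrightarrow> \<sigma> z = \<rho> i z"
proof -
  have mono: "D i \<subseteq> D j" if "i \<le> j" for i j by (rule lift_Suc_mono_le[of D, OF inc that])
  have coh': "\<rho> j z = \<rho> i z" if "i \<le> j" "z \<in> D i" for i j z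
    using that(1)
  proof (induction j rule: dec_induct)
    case (step n)
    have "z \<in> D n" using mono[OF step(1)] that(2) by blast
    from coh[OF this] step(3) show ?case by simp
  qed simp
  show thesis
  proof (rule that[of "\<lambda>z. \<rho> (LEAST i. z \<in> D i) z"])
    fix i z assume z: "z \<in> D i"
    show "\<rho> (LEAST i. z \<in> D i) z = \<rho> i z"
      by (rule coh'[symmetric]) (use z in \<open>auto intro: LeastI Least_le\<close>)
  qed
qed

text \<open>Going forth only, with every natural number as a requirement. The structure on Q may be
  infinite, as is the case for the glued powers later on.\<close>

lemma embedding:
  assumes Q: "good Q N"
  obtains \<iota> where "\<iota> ` Q \<subseteq> A" "\<And>D. finite D \<Longrightarrow> D \<subseteq> Q \<Longrightarrow> emb \<iota> D N M"
proof -
  define I where "I = {(D, \<rho>). finite D \<and> D \<subseteq> Q \<and> \<rho> ` D \<subseteq> A \<and> emb \<rho> D N M}"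
  define step :: "nat \<Rightarrow> nat set \<times> (nat \<Rightarrow> nat) \<Rightarrow> nat set \<times> (nat \<Rightarrow> nat) \<Rightarrow> bool"
    where "step = (\<lambda>x (D, \<rho>) (D', \<rho>'). D \<subseteq> D' \<and> (\<forall>z\<in>D. \<rho>' z = \<rho> z) \<and> (x \<in> Q \<longrightarrow> x \<in> D'))"
  have ex: "\<exists>p'\<in>I. step x p p'" if "p \<in> I" for x p
  proof -
    obtain D \<rho> where p: "p = (D, \<rho>)" by (cases p)
    have D: "finite D" "D \<subseteq> Q" "\<rho> ` D \<subseteq> A" "emb \<rho> D N M" using \<open>p \<in> I\<close> by (auto simp: p I_def)
    show ?thesis
    proof (cases "x \<in> Q \<and> x \<notin> D")
      case True
      then obtain y where y: "y \<in> A" "emb (\<rho>(x := y)) (insert x D) N M"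
        using forth[OF Q D(1,2,4,3)] by blast
      have "(insert x D, \<rho>(x := y)) \<in> I" using D y True by (auto simp: I_def)
      moreover have "step x p (insert x D, \<rho>(x := y))" using True by (auto simp: step_def p)
      ultimately show ?thesis by blast
    next
      case False
      then have "step x p p" by (auto simp: step_def p)
      then show ?thesis using that by blast
    qed
  qed
  \<comment> \<open>As \<open>m L\<close> is positive, the empty set is not a context, so neither
    structure has facts there.\<close>
  have "emb id {} N M"
  proof (rule embI)
    fix L k :: nat and Z :: "nat set" and V :: "nat set set"
    assume "Z \<subseteq> {}"
    then have "Z = {}" by simp
    moreover have "\<not> ctx L Q {}" "\<not> ctx L A {}" using m_gt[of L] by (auto simp: ctx_def)
    ultimately show "(k, V) \<in> N L Z \<longleftrightarrow> (k, push id V) \<in> M L (id ` Z)"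
      using good_empty[OF Q] good_empty[OF good_AM] by simp
  qed simp_all
  then have start: "({}, id) \<in> I" by (simp add: I_def)
  have "\<exists>p. p 0 = ({}, id) \<and> (\<forall>i. p i \<in> I) \<and> (\<forall>i. \<exists>r\<in>UNIV. step r (p i) (p (Suc i))) \<and>
    (\<forall>r\<in>UNIV. \<forall>N. \<exists>i\<ge>N. step r (p i) (p (Suc i)))"
    by (rule chain_meeting_requirements[OF _ _ start ex]) auto
  then obtain p where p: "\<And>i. p i \<in> I" "\<And>i. \<exists>r. step r (p i) (p (Suc i))"
    "\<And>r. \<exists>i. step r (p i) (p (Suc i))" by blast
  define D where "D i = fst (p i)" for i
  define \<rho> where "\<rho> i = snd (p i)" for i
  have pD: "p i = (D i, \<rho> i)" for i by (simp add: D_def \<rho>_def)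
  have pI: "finite (D i)" "D i \<subseteq> Q" "\<rho> i ` D i \<subseteq> A" "emb (\<rho> i) (D i) N M" for i
    using p(1)[of i] by (auto simp: pD I_def)
  have inc: "D i \<subseteq> D (Suc i)" and coh: "z \<in> D i \<Longrightarrow> \<rho> (Suc i) z = \<rho> i z" for i z
    using p(2)[of i] by (auto simp: pD step_def)
  have cover: "Q \<subseteq> (\<Union>i. D i)"
  proof
    fix x assume "x \<in> Q"
    obtain i where "step x (p i) (p (Suc i))" using p(3) by blast
    with \<open>x \<in> Q\<close> show "x \<in> (\<Union>i. D i)" by (auto simp: pD step_def)
  qed
  from limit_map[of D \<rho>, OF inc coh] obtain \<iota> where \<iota>: "\<And>i z. z \<in> D i \<Longrightarrow> \<iota> z = \<rho> i z" by blast
  show thesis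
  proof (rule that)
    show "\<iota> ` Q \<subseteq> A" using cover pI(3) \<iota> by fastforce
    fix E assume E: "finite E" "E \<subseteq> Q"
    have "incseq D" by (rule incseq_SucI) (rule inc)
    then obtain i where i: "E \<subseteq> D i" using finite_subset_incseq[OF E(1)] E(2) cover by blast
    have "emb \<iota> (D i) N M" by (rule emb_cong[OF pI(4)]) (rule \<iota>)
    then show "emb \<iota> E N M" using i by (rule emb_subset)
  qed
qed

text \<open>Back and forth: each stage puts x into the domain by \<open>forth\<close>, and then into
  the range by \<open>forth\<close> applied to the inverse map.\<close>

lemma homogeneity:
  assumes D0: "finite D0" "D0 \<subseteq> A" and e0: "emb \<rho>0 D0 M M" and im0: "\<rho>0 ` D0 \<subseteq> A"
  obtains \<sigma> where "bij_betw \<sigma> A A" "\<And>z. z \<in> D0 \<Longrightarrow> \<sigma> z = \<rho>0 z"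
    "\<And>D. finite D \<Longrightarrow> D \<subseteq> A \<Longrightarrow> emb \<sigma> D M M"
proof -
  define I where "I = {(D, \<rho>). finite D \<and> D \<subseteq> A \<and> \<rho> ` D \<subseteq> A \<and> emb \<rho> D M M}"
  define step :: "nat \<Rightarrow> nat set \<times> (nat \<Rightarrow> nat) \<Rightarrow> nat set \<times> (nat \<Rightarrow> nat) \<Rightarrow> bool"
    where "step = (\<lambda>x (D, \<rho>) (D', \<rho>'). D \<subseteq> D' \<and> (\<forall>z\<in>D. \<rho>' z = \<rho> z) \<and>
      (x \<in> A \<longrightarrow> x \<in> D' \<and> x \<in> \<rho>' ` D'))"
  have ex: "\<exists>p'\<in>I. step x p p'" if "p \<in> I" for x p
  proof (cases "x \<in> A")
    case xA: True
    obtain D \<rho> where p: "p = (D, \<rho>)" by (cases p)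
    have D: "finite D" "D \<subseteq> A" "\<rho> ` D \<subseteq> A" "emb \<rho> D M M" using \<open>p \<in> I\<close> by (auto simp: p I_def)
    obtain D1 \<rho>1 where 1: "finite D1" "D1 \<subseteq> A" "\<rho>1 ` D1 \<subseteq> A" "emb \<rho>1 D1 M M"
      "D \<subseteq> D1" "\<forall>z\<in>D. \<rho>1 z = \<rho> z" "x \<in> D1"
    proof (cases "x \<in> D")
      case True
      show thesis by (rule that[of D \<rho>]) (use D True in auto)
    next
      case False
      then obtain y where y: "y \<in> A" "emb (\<rho>(x := y)) (insert x D) M M"
        using forth[OF good_AM D(1,2,4,3) xA] by blast
      show thesis by (rule that[of "insert x D" "\<rho>(x := y)"]) (use D y xA False in auto)
    qed
    show ?thesis
    proof (cases "x \<in> \<rho>1 ` D1")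
      case True
      have "(D1, \<rho>1) \<in> I" using 1 by (simp add: I_def)
      moreover have "step x p (D1, \<rho>1)" using 1 True by (simp add: step_def p)
      ultimately show ?thesis by blast
    next
      case False
      define \<tau> where "\<tau> = inv_into D1 \<rho>1"
      have inv: "\<tau> (\<rho>1 z) = z" if "z \<in> D1" for z
        using inv_into_f_f[OF embD(1)[OF 1(4)] that] by (simp add: \<tau>_def)
      have \<tau>: "emb \<tau> (\<rho>1 ` D1) M M" by (rule emb_inverse[OF 1(4) inv])
      have img: "\<tau> ` \<rho>1 ` D1 = D1" using inv by force
      obtain y where y: "y \<in> A" "y \<notin> D1" "emb (\<tau>(x := y)) (insert x (\<rho>1 ` D1)) M M"
        using forth[OF good_AM _ 1(3) \<tau> _ xA False] 1(1,2) img by auto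
      have inv2: "(\<rho>1(y := x)) ((\<tau>(x := y)) z) = z" if "z \<in> insert x (\<rho>1 ` D1)" for z
        using that inv y(2) False by auto
      have "(\<tau>(x := y)) ` insert x (\<rho>1 ` D1) = insert y (\<tau> ` \<rho>1 ` D1)" using False by auto
      then have "emb (\<rho>1(y := x)) (insert y D1) M M"
        using emb_inverse[OF y(3) inv2] by (simp only: img)
      then have "(insert y D1, \<rho>1(y := x)) \<in> I" using 1 y xA by (auto simp: I_def)
      moreover have "step x p (insert y D1, \<rho>1(y := x))"
        using 1 y(2) by (auto simp: step_def p)
      ultimately show ?thesis by blast
    qed
  next
    case False
    then have "step x p p" by (cases p) (auto simp: step_def)
    then show ?thesis using that by blast
  qed
  have start: "(D0, \<rho>0) \<in> I" using D0 e0 im0 by (simp add: I_def)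
  have "\<exists>p. p 0 = (D0, \<rho>0) \<and> (\<forall>i. p i \<in> I) \<and> (\<forall>i. \<exists>r\<in>UNIV. step r (p i) (p (Suc i))) \<and>
    (\<forall>r\<in>UNIV. \<forall>N. \<exists>i\<ge>N. step r (p i) (p (Suc i)))"
    by (rule chain_meeting_requirements[OF _ _ start ex]) auto
  then obtain p where p: "p 0 = (D0, \<rho>0)" "\<And>i. p i \<in> I" "\<And>i. \<exists>r. step r (p i) (p (Suc i))"
    "\<And>r. \<exists>i. step r (p i) (p (Suc i))" by blast
  define D where "D i = fst (p i)" for i
  define \<rho> where "\<rho> i = snd (p i)" for i
  have pD: "p i = (D i, \<rho> i)" for i by (simp add: D_def \<rho>_def)
  have pI: "finite (D i)" "D i \<subseteq> A" "\<rho> i ` D i \<subseteq> A" "emb (\<rho> i) (D i) M M" for i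
    using p(2)[of i] by (auto simp: pD I_def)
  have inc: "D i \<subseteq> D (Suc i)" and coh: "z \<in> D i \<Longrightarrow> \<rho> (Suc i) z = \<rho> i z" for i z
    using p(3)[of i] by (auto simp: pD step_def)
  from limit_map[of D \<rho>, OF inc coh] obtain \<sigma> where \<sigma>: "\<And>i z. z \<in> D i \<Longrightarrow> \<sigma> z = \<rho> i z" by blast
  have cover: "\<exists>i. x \<in> D i \<and> x \<in> \<rho> i ` D i" if "x \<in> A" for x
  proof -
    obtain i where "step x (p i) (p (Suc i))" using p(4) by blast
    with that show ?thesis by (auto simp: pD step_def)
  qed
  have emb: "emb \<sigma> E M M" if E: "finite E" "E \<subseteq> A" for E
  proof -
    have "incseq D" by (rule incseq_SucI) (rule inc)
    moreover have "E \<subseteq> (\<Union>i. D i)" using E(2) cover by blast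
    ultimately obtain i where i: "E \<subseteq> D i" using finite_subset_incseq[OF E(1)] by blast
    have "emb \<sigma> (D i) M M" by (rule emb_cong[OF pI(4)]) (rule \<sigma>)
    then show ?thesis using i by (rule emb_subset)
  qed
  have "bij_betw \<sigma> A A" unfolding bij_betw_def
  proof
    show "inj_on \<sigma> A"
    proof (rule inj_onI)
      fix x y assume xy: "x \<in> A" "y \<in> A" "\<sigma> x = \<sigma> y"
      have "inj_on \<sigma> {x, y}" by (rule embD(1)[OF emb]) (use xy in auto)
      from inj_onD[OF this xy(3)] show "x = y" by simp
    qed
    show "\<sigma> ` A = A"
    proof
      show "\<sigma> ` A \<subseteq> A"
      proof
        fix y assume "y \<in> \<sigma> ` A"
        then obtain x where x: "x \<in> A" "y = \<sigma> x" by blast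
        then obtain i where "x \<in> D i" using cover by blast
        then show "y \<in> A" using x(2) \<sigma>[of x i] pI(3)[of i] by auto
      qed
      show "A \<subseteq> \<sigma> ` A"
      proof
        fix y assume "y \<in> A"
        then obtain i z where "z \<in> D i" "y = \<rho> i z" using cover by blast
        then show "y \<in> \<sigma> ` A" using \<sigma>[of z i] pI(2)[of i] by force
      qed
    qed
  qed
  moreover have "\<sigma> z = \<rho>0 z" if "z \<in> D0" for z
  proof -
    have "D 0 = D0" "\<rho> 0 = \<rho>0" using p(1) by (simp_all add: D_def \<rho>_def)
    then show ?thesis using \<sigma>[of z 0] that by simp
  qed
  ultimately show thesis using emb by (rule that)
qed

end

section \<open>Hyperedges\<close>

text \<open>The number \<open>b < 2 ^ L\<close> encodes the row of the table of \<open>{0,1}^L\<close> that has entry \<open>1\<close> exactly in the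
  columns \<open>i \<in> set_decode b\<close>; so a labelling satisfies \<open>Vc L e\<close> iff its values on \<open>e\<close> form a column.\<close>

definition Vc :: "nat \<Rightarrow> (nat \<Rightarrow> nat) \<Rightarrow> nat set set" where
  "Vc L e = {\<theta>. \<exists>i<L. \<forall>b<2 ^ L. e b \<in> \<theta> \<longleftrightarrow> i \<in> set_decode b}"

lemma push_Vc: "push \<rho> (Vc L e) = Vc L (\<rho> \<circ> e)"
  by (simp add: push_def Vc_def)

lemma Vc_cong: "(\<And>b. b < 2 ^ L \<Longrightarrow> e b = e' b) \<Longrightarrow> Vc L e = Vc L e'"
  by (simp add: Vc_def)

lemma adm_Vc:
  assumes "\<And>b. b < 2 ^ L \<Longrightarrow> even (e b) \<and> e b \<in> D"
  shows "adm L D 1 (Vc L e)"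
proof -
  have "supp (e ` {..<2 ^ L}) (Vc L e)"
  proof (rule suppI)
    fix \<theta> \<mu> assume eq: "\<theta> \<inter> e ` {..<2 ^ L} = \<mu> \<inter> e ` {..<2 ^ L}"
    have "e b \<in> \<theta> \<longleftrightarrow> e b \<in> \<mu>" if "b < 2 ^ L" for b
    proof -
      have "e b \<in> e ` {..<2 ^ L}" using that by simp
      then show ?thesis using eq by blast
    qed
    then show "\<theta> \<in> Vc L e \<longleftrightarrow> \<mu> \<in> Vc L e" by (simp add: Vc_def)
  qed
  moreover have "card (e ` {..<2 ^ L}) \<le> 1 * 2 ^ L"
    using card_image_le[of "{..<2 ^ L}" e] by simp
  ultimately show ?thesis unfolding adm_def using assms
    by (intro exI[of _ "e ` {..<2 ^ L}"]) auto
qed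

lemma ex_set_decode:
  assumes "B \<subseteq> {..<L}"
  obtains b where "b < 2 ^ L" "set_decode b = B"
proof -
  have "finite B" using assms finite_subset by blast
  have "set_encode B \<le> set_encode {..<L}"
    unfolding set_encode_def by (rule sum_mono2) (use assms in auto)
  also have "set_encode {..<L} < 2 ^ L"
    unfolding set_encode_def by (induction L) (simp_all add: lessThan_Suc)
  finally show thesis using that[of "set_encode B"] \<open>finite B\<close> by simp
qed

context sizes
begin

text \<open>The context is listed behind the points, so that a polymorphism moves contexts along
  with points. Only the set of the listed elements enters the condition, hence contexts are
  unordered. The grade is 1 because the constraint costs one hyperedge.\<close>

definition hyp :: "(nat \<Rightarrow> nat set \<Rightarrow> (nat \<times> nat set set) set) \<Rightarrow> nat \<Rightarrow> nat list \<Rightarrow> bool" where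
  "hyp N L t \<longleftrightarrow> length t = 2 ^ L + m L \<and> (\<forall>b<2 ^ L. even (t ! b)) \<and> distinct (drop (2 ^ L) t) \<and>
     (\<forall>z\<in>set (drop (2 ^ L) t). odd z) \<and> (1, Vc L (\<lambda>b. t ! b)) \<in> N L (set (drop (2 ^ L) t))"

definition rels :: "nat set \<Rightarrow> (nat \<Rightarrow> nat set \<Rightarrow> (nat \<times> nat set set) set) \<Rightarrow> (nat \<times> nat list set) set" where
  "rels A N = {(2 ^ L + m L, {t. set t \<subseteq> A \<and> hyp N L t}) | L. True}"

lemma hyp_emb:
  assumes e: "emb \<rho> D N N'" and t: "set t \<subseteq> D"
  shows "hyp N' L (map \<rho> t) \<longleftrightarrow> hyp N L t"
proof (cases "length t = 2 ^ L + m L")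
  case len: True
  let ?d = "drop (2 ^ L) t"
  have tb: "t ! b \<in> D" "map \<rho> t ! b = \<rho> (t ! b)" if "b < 2 ^ L" for b
    using that len t by (auto simp: subset_iff)
  have d: "set ?d \<subseteq> D" using t set_drop_subset by fastforce
  have 1: "(\<forall>b<2 ^ L. even (map \<rho> t ! b)) \<longleftrightarrow> (\<forall>b<2 ^ L. even (t ! b))"
    using tb embD(2)[OF e] by simp
  have 2: "distinct (map \<rho> ?d) \<longleftrightarrow> distinct ?d"
    using inj_on_subset[OF embD(1)[OF e] d] by (simp add: distinct_map)
  have 3: "(\<forall>z\<in>set (map \<rho> ?d). odd z) \<longleftrightarrow> (\<forall>z\<in>set ?d. odd z)"
    using embD(2)[OF e] d by auto
  have 4: "Vc L (\<lambda>b. map \<rho> t ! b) = push \<rho> (Vc L (\<lambda>b. t ! b))"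
    unfolding push_Vc by (rule Vc_cong) (simp add: tb)
  have 5: "(1, Vc L (\<lambda>b. t ! b)) \<in> N L (set ?d) \<longleftrightarrow>
      (1, Vc L (\<lambda>b. map \<rho> t ! b)) \<in> N' L (set (map \<rho> ?d))"
    if ev: "\<forall>b<2 ^ L. even (t ! b)"
    unfolding 4 set_map by (rule embD(3)[OF e d adm_Vc]) (use ev tb in blast)
  show ?thesis unfolding hyp_def drop_map 1 2 3 using 5 len by auto
qed (simp add: hyp_def)

end

section \<open>Orbits\<close>

lemma automorphism_comp:
  assumes s: "automorphism A Rels \<sigma>" and t: "automorphism A Rels \<tau>"
  shows "automorphism A Rels (\<tau> \<circ> \<sigma>)"
  unfolding automorphism_def
proof
  show "bij_betw (\<tau> \<circ> \<sigma>) A A"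
    using s t unfolding automorphism_def by (blast intro: bij_betw_trans)
  show "\<forall>(m, r)\<in>Rels. \<forall>x. length x = m \<and> set x \<subseteq> A \<longrightarrow> (x \<in> r) = (map (\<tau> \<circ> \<sigma>) x \<in> r)"
  proof (clarify)
    fix r and x :: "'a list"
    assume r: "(length x, r) \<in> Rels" and x: "set x \<subseteq> A"
    have "\<sigma> ` A = A" using s by (simp add: automorphism_def bij_betw_def)
    then have "set (map \<sigma> x) \<subseteq> A" using x by auto
    then have "(map \<sigma> x \<in> r) = (map \<tau> (map \<sigma> x) \<in> r)"
      using t r unfolding automorphism_def by fastforce
    moreover have "(x \<in> r) = (map \<sigma> x \<in> r)"
      using s r x unfolding automorphism_def by fastforce
    ultimately show "(x \<in> r) = (map (\<tau> \<circ> \<sigma>) x \<in> r)" by simp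
  qed
qed

text \<open>An entry is named by its first position, with its parity as last bit. The names carry
  points to points, record which entries coincide, and come from a set whose size depends only on
  the length of t.\<close>

definition canon :: "nat list \<Rightarrow> nat \<Rightarrow> nat" where
  "canon t x = 2 * (LEAST j. j < length t \<and> t ! j = x) + x mod 2"

lemma canon:
  assumes "x \<in> set t"
  shows "canon t x < 2 * length t" "even (canon t x) = even x" "t ! (canon t x div 2) = x"
proof -
  let ?P = "\<lambda>j. j < length t \<and> t ! j = x"
  from assms obtain j where "?P j" by (auto simp: in_set_conv_nth)
  then have P: "?P (LEAST j. ?P j)" by (rule LeastI)
  have "x mod 2 < 2" by simp
  then show "canon t x < 2 * length t" "t ! (canon t x div 2) = x"
    using P unfolding canon_def by auto
  show "even (canon t x) = even x" unfolding canon_def by presburger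
qed

context generic
begin

lemma emb_automorphism:
  assumes bij: "bij_betw \<sigma> A A" and emb: "\<And>D. finite D \<Longrightarrow> D \<subseteq> A \<Longrightarrow> emb \<sigma> D M M"
  shows "automorphism A (rels A M) \<sigma>"
  unfolding automorphism_def
proof
  show "\<forall>(m, r)\<in>rels A M. \<forall>t. length t = m \<and> set t \<subseteq> A \<longrightarrow> (t \<in> r) = (map \<sigma> t \<in> r)"
  proof (clarify)
    fix r and t :: "nat list"
    assume "(length t, r) \<in> rels A M" and t: "set t \<subseteq> A"
    then obtain L where r: "r = {t. set t \<subseteq> A \<and> hyp M L t}" by (auto simp: rels_def)
    have "set (map \<sigma> t) \<subseteq> A" using bij t by (auto simp: bij_betw_def)
    moreover have "hyp M L (map \<sigma> t) \<longleftrightarrow> hyp M L t"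
      by (rule hyp_emb[OF emb[of "set t"]]) (use t in auto)
    ultimately show "(t \<in> r) = (map \<sigma> t \<in> r)" using t by (simp add: r)
  qed
qed (rule bij)

text \<open>The isomorphism type of a tuple: the names record equalities and parities, and the
  second component is the structure on the entries, transported to the names along the inverse of
  \<open>canon t\<close>.\<close>

definition tuple_type :: "nat list \<Rightarrow> nat list \<times> (nat \<Rightarrow> nat set \<Rightarrow> (nat \<times> nat set set) set)" where
  "tuple_type t = (map (canon t) t,
     pull (\<lambda>y. t ! (y div 2)) (set (map (canon t) t)) M)"

lemma tuple_type_emb:
  assumes "set t \<subseteq> A"
  shows "good (set (map (canon t) t)) (snd (tuple_type t))"
    and "emb (\<lambda>y. t ! (y div 2)) (set (map (canon t) t)) (snd (tuple_type t)) M"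
    and "emb (canon t) (set t) M (snd (tuple_type t))"
proof -
  let ?\<rho> = "\<lambda>y. t ! (y div 2)" and ?S = "set (map (canon t) t)"
  have inj: "inj_on ?\<rho> ?S" by (rule inj_onI) (auto simp: canon(3))
  have par: "even (?\<rho> y) = even y" if "y \<in> ?S" for y using that canon(2,3)[of _ t] by auto
  have img: "?\<rho> ` ?S = set t" using canon(3)[of _ t] by force
  show g: "good ?S (snd (tuple_type t))"
    unfolding tuple_type_def snd_conv
    by (rule good_pull(1)[OF good_AM inj par]) (use img assms in auto)
  show e: "emb ?\<rho> ?S (snd (tuple_type t)) M"
    unfolding tuple_type_def snd_conv
    by (rule good_pull(2)[OF good_AM inj par]) (use img assms in auto)
  have "emb (canon t) (?\<rho> ` ?S) M (snd (tuple_type t))"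
    by (rule emb_inverse[OF e]) (auto simp: canon(3))
  then show "emb (canon t) (set t) M (snd (tuple_type t))" by (simp only: img)
qed

text \<open>Passing through the common copy on the names gives a partial isomorphism from t to t',
  which \<open>homogeneity\<close> extends to the whole structure.\<close>

lemma same_type_automorphism:
  assumes t: "set t \<subseteq> A" and t': "set t' \<subseteq> A" and eq: "tuple_type t = tuple_type t'"
  obtains \<sigma> where "automorphism A (rels A M) \<sigma>" "map \<sigma> t = t'"
proof -
  have s: "map (canon t) t = map (canon t') t'"
    using arg_cong[OF eq, of fst] by (simp add: tuple_type_def)
  have N: "snd (tuple_type t) = snd (tuple_type t')" using eq by simp
  have len: "length t = length t'" using arg_cong[OF s, of length] by simp
  define \<phi> where "\<phi> = (\<lambda>y. t' ! (y div 2)) \<circ> canon t"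
  have e: "emb \<phi> (set t) M M" unfolding \<phi>_def
  proof (rule emb_comp)
    show "emb (canon t) (set t) M (snd (tuple_type t))" by (rule tuple_type_emb(3)[OF t])
    show "emb (\<lambda>y. t' ! (y div 2)) (set (map (canon t') t')) (snd (tuple_type t)) M"
      unfolding N by (rule tuple_type_emb(2)[OF t'])
    show "canon t ` set t \<subseteq> set (map (canon t') t')" unfolding s[symmetric] by simp
  qed
  have \<phi>: "\<phi> (t ! i) = t' ! i" if "i < length t" for i
  proof -
    have "canon t (t ! i) = canon t' (t' ! i)"
      using arg_cong[OF s, of "\<lambda>l. l ! i"] that len by simp
    then show ?thesis using canon(3)[of "t' ! i" t'] that len by (simp add: \<phi>_def)
  qed
  have map\<phi>: "map \<phi> t = t'" by (rule nth_equalityI) (simp_all add: len \<phi>)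
  have im: "\<phi> ` set t \<subseteq> A" using arg_cong[OF map\<phi>, of set] t' by simp
  from homogeneity[OF _ t e im] obtain \<sigma> where \<sigma>: "bij_betw \<sigma> A A" "\<And>z. z \<in> set t \<Longrightarrow> \<sigma> z = \<phi> z"
    "\<And>D. finite D \<Longrightarrow> D \<subseteq> A \<Longrightarrow> emb \<sigma> D M M" by blast
  have "map \<sigma> t = t'" using map\<phi> \<sigma>(2) by (metis map_eq_conv)
  with emb_automorphism[OF \<sigma>(1,3)] show thesis by (rule that)
qed

text \<open>Orbits are counted by types: there are at most \<open>(2 * k) ^ k\<close> tuples of
  names, and for each of them at most \<open>2 ^ F\<close> structures on the names occurring in
  it.\<close>

lemma
  assumes F: "\<And>D. finite D \<Longrightarrow> card D \<le> k \<Longrightarrow> card (facts D) \<le> F"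
  shows finite_orbits: "finite (orbits A (rels A M) k)"
    and card_orbits: "card (orbits A (rels A M) k) \<le> (2 * k) ^ k * 2 ^ F"
proof -
  let ?T = "{t. length t = k \<and> set t \<subseteq> A}"
  let ?orb = "\<lambda>t. {map \<sigma> t | \<sigma>. automorphism A (rels A M) \<sigma>}"
  let ?S = "{s. set s \<subseteq> {..<2 * k} \<and> length s = k}"
  let ?X = "SIGMA s:?S. {N. good (set s) N}"
  have fS: "finite ?S" by (rule finite_lists_length_eq) simp
  have fN: "finite {N. good (set s) N}" for s by (rule finite_good) simp
  have fX: "finite ?X" using fS fN by (rule finite_SigmaI)
  have sub: "tuple_type ` ?T \<subseteq> ?X"
  proof
    fix x assume "x \<in> tuple_type ` ?T"
    then obtain t where t: "x = tuple_type t" "length t = k" "set t \<subseteq> A" by blast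
    have x: "x = (map (canon t) t, snd (tuple_type t))" by (simp add: t(1) tuple_type_def)
    have "map (canon t) t \<in> ?S" using canon(1)[of _ t] t(2) by auto
    with tuple_type_emb(1)[OF t(3)] show "x \<in> ?X" unfolding x by blast
  qed
  have orb_le: "?orb t' \<subseteq> ?orb t" if t: "t \<in> ?T" "t' \<in> ?T" and eq: "tuple_type t = tuple_type t'" for t t'
  proof
    fix y assume "y \<in> ?orb t'"
    then obtain \<tau> where \<tau>: "y = map \<tau> t'" "automorphism A (rels A M) \<tau>" by blast
    obtain \<sigma> where \<sigma>: "automorphism A (rels A M) \<sigma>" "map \<sigma> t = t'"
      using same_type_automorphism[OF _ _ eq] t by auto
    have "y = map (\<tau> \<circ> \<sigma>) t" using \<tau>(1) \<sigma>(2) by auto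
    then show "y \<in> ?orb t" using automorphism_comp[OF \<sigma>(1) \<tau>(2)] by blast
  qed
  let ?h = "\<lambda>x. ?orb (SOME t. t \<in> ?T \<and> tuple_type t = x)"
  have orbs: "orbits A (rels A M) k \<subseteq> ?h ` tuple_type ` ?T"
  proof
    fix y assume "y \<in> orbits A (rels A M) k"
    then obtain t where t: "y = ?orb t" "t \<in> ?T" unfolding orbits_def by blast
    let ?t = "SOME t'. t' \<in> ?T \<and> tuple_type t' = tuple_type t"
    have "?t \<in> ?T \<and> tuple_type ?t = tuple_type t" by (rule someI[of _ t]) (use t in simp)
    then have "?orb t = ?orb ?t" using orb_le[of t ?t] orb_le[of ?t t] t(2) by auto
    then have "y = ?h (tuple_type t)" using t(1) by simp
    then show "y \<in> ?h ` tuple_type ` ?T" using t(2) by blast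
  qed
  have fT: "finite (tuple_type ` ?T)" using sub fX by (rule finite_subset)
  show "finite (orbits A (rels A M) k)"
    using orbs finite_imageI[OF fT] by (rule finite_subset)
  have "card (orbits A (rels A M) k) \<le> card (?h ` tuple_type ` ?T)"
    by (rule card_mono[OF finite_imageI[OF fT] orbs])
  also have "\<dots> \<le> card (tuple_type ` ?T)" by (rule card_image_le[OF fT])
  also have "\<dots> \<le> card ?X" by (rule card_mono[OF fX sub])
  also have "\<dots> = (\<Sum>s\<in>?S. card {N. good (set s) N})" using fS fN by simp
  also have "\<dots> \<le> (\<Sum>s\<in>?S. 2 ^ F)"
  proof (rule sum_mono)
    fix s assume s: "s \<in> ?S"
    have "card {N. good (set s) N} \<le> 2 ^ card (facts (set s))" by (rule card_good) simp
    also have "\<dots> \<le> 2 ^ F" using F[of "set s"] card_length[of s] s by simp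
    finally show "card {N. good (set s) N} \<le> 2 ^ F" .
  qed
  also have "\<dots> = (2 * k) ^ k * 2 ^ F" using card_lists_length_eq[of "{..<2 * k}" k] by simp
  finally show "card (orbits A (rels A M) k) \<le> (2 * k) ^ k * 2 ^ F" .
qed

end

section \<open>Counting\<close>

text \<open>The bound \<open>4 ^ n / sqrt (2 * n + 1)\<close> for the central coefficient, squared
  to stay within the naturals. The ratio of successive coefficients reduces the induction step to
  \<open>(2 * n + 1) * (2 * n + 3) \<le> 4 * (n + 1)\<^sup>2\<close>.\<close>

lemma central_binomial_square: "(2 * n choose n)\<^sup>2 * (2 * n + 1) \<le> (16::nat) ^ n"
proof (induction n)
  case (Suc n)
  let ?b = "2 * n choose n" and ?c = "2 * Suc n choose Suc n"
  have b: "real ?b = fact (2 * n) / (fact n * fact n)"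
    using binomial_fact[of n "2 * n", where ?'a = real] by simp
  have c: "real ?c = fact (Suc (Suc (2 * n))) / (fact (Suc n) * fact (Suc n))"
    using binomial_fact[of "Suc n" "2 * Suc n", where ?'a = real] by simp
  have "real ?c * (real n + 1) = 2 * (2 * real n + 1) * real ?b"
    unfolding b c by (simp add: divide_simps) (simp add: algebra_simps)
  then have "real (?c * (n + 1)) = real (2 * (2 * n + 1) * ?b)"
    by (simp only: of_nat_mult of_nat_add of_nat_1 of_nat_numeral)
  then have rec: "?c * (n + 1) = 2 * (2 * n + 1) * ?b" by (simp only: of_nat_eq_iff)
  have "(?c\<^sup>2 * (2 * Suc n + 1)) * (n + 1)\<^sup>2 = (?c * (n + 1))\<^sup>2 * (2 * n + 3)"
    by (simp add: power2_eq_square algebra_simps)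
  also have "\<dots> = (?b\<^sup>2 * (2 * n + 1)) * (4 * (2 * n + 1) * (2 * n + 3))"
    unfolding rec by (simp add: power2_eq_square algebra_simps)
  also have "\<dots> \<le> 16 ^ n * (4 * (2 * n + 1) * (2 * n + 3))"
    using Suc by (rule mult_le_mono1)
  also have "\<dots> \<le> 16 ^ n * (16 * (n + 1)\<^sup>2)"
    by (rule mult_le_mono2) (simp add: power2_eq_square algebra_simps)
  also have "\<dots> = 16 ^ Suc n * (n + 1)\<^sup>2" by (simp only: power_Suc ac_simps)
  finally show ?case by (rule mult_right_le_imp_le) simp
qed simp

lemma binomial_square: "(k choose s)\<^sup>2 * k \<le> (4::nat) ^ k"
proof (cases "even k")
  case True
  then obtain n where k: "k = 2 * n" by blast
  have "(k choose s) \<le> (2 * n choose n)" using binomial_maximum[of k s] by (simp add: k)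
  then have "(k choose s)\<^sup>2 * k \<le> (2 * n choose n)\<^sup>2 * (2 * n + 1)"
    by (intro mult_le_mono power_mono) (simp_all add: k)
  also have "\<dots> \<le> 4 ^ k" using central_binomial_square[of n] by (simp add: k power_mult)
  finally show ?thesis .
next
  case False
  then obtain n where k: "k = 2 * n + 1" by (rule oddE)
  have b: "(2 * n choose j) \<le> (2 * n choose n)" for j using binomial_maximum[of "2 * n" j] by simp
  have "(k choose s) \<le> 2 * (2 * n choose n)"
  proof (cases s)
    case (Suc j)
    have "(k choose s) = (2 * n choose j) + (2 * n choose Suc j)" by (simp add: k Suc)
    then show ?thesis using b[of j] b[of "Suc j"] by linarith
  qed (use b[of 0] in simp)
  then have "(k choose s)\<^sup>2 * k \<le> (2 * (2 * n choose n))\<^sup>2 * (2 * n + 1)"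
    by (intro mult_le_mono power_mono) (simp_all add: k)
  also have "\<dots> = 4 * ((2 * n choose n)\<^sup>2 * (2 * n + 1))" by (simp add: power2_eq_square)
  also have "\<dots> \<le> 4 ^ k" using central_binomial_square[of n] by (simp add: k power_mult)
  finally show ?thesis .
qed

text \<open>Binomial coefficients are at most \<open>2 ^ k / sqrt k\<close>, so each is an
  arbitrarily small fraction of \<open>2 ^ k\<close> once k is large. This is what a fast growing
  \<open>m\<close> exploits.\<close>

lemma binomial_small:
  fixes c :: nat
  assumes "c\<^sup>2 \<le> k"
  shows "(k choose s) * c \<le> 2 ^ k"
proof -
  have "((k choose s) * c)\<^sup>2 = (k choose s)\<^sup>2 * c\<^sup>2" by (simp add: power_mult_distrib)
  also have "\<dots> \<le> (k choose s)\<^sup>2 * k" using assms by (rule mult_le_mono2)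
  also have "\<dots> \<le> (2 ^ k)\<^sup>2"
    using binomial_square[of k s] by (simp add: power2_eq_square flip: power_mult_distrib)
  finally show ?thesis by (rule power2_le_imp_le) simp
qed

text \<open>The factors are the number of grades, the number of constraints on
  \<open>L * 2 ^ L\<close> points, and the number of possible sizes of a support.\<close>

definition weight :: "nat \<Rightarrow> nat" where
  "weight L = (L + 1) * 2 ^ 2 ^ (L * 2 ^ L) * (L * 2 ^ L + 1)"

text \<open>The factor \<open>2 ^ (L + 2)\<close> makes the contributions of all levels add up to at
  most half of \<open>2 ^ k\<close>. Sets with fewer than \<open>m L\<close> elements contain no
  context of level L and contribute nothing.\<close>

locale large_sizes = sizes +
  assumes m_large: "m L \<le> k \<Longrightarrow> (k choose s) * (weight L * 2 ^ (L + 2)) \<le> 2 ^ k"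

lemma large_sizes_exist: obtains m where "large_sizes m"
proof
  \<comment> \<open>The square meets the premise of \<open>binomial_small\<close>; the summand
    \<open>L + 1\<close> ensures \<open>L < m L\<close>.\<close>
  show "large_sizes (\<lambda>L. (weight L * 2 ^ (L + 2))\<^sup>2 + L + 1)"
    by unfold_locales (simp, rule binomial_small, simp)
qed

section \<open>Counting the facts level by level\<close>

context sizes
begin

definition facts_at :: "nat \<Rightarrow> nat set \<Rightarrow> (nat set \<times> nat \<times> nat set set) set" where
  "facts_at L D = {(Z, k, V). ctx L D Z \<and> k \<le> L \<and> adm L D k V}"

text \<open>As the context \<open>Z\<close> is odd and the support \<open>P\<close> of the constraint is even, the pair is
  recovered from \<open>Z \<union> P\<close>.\<close>

lemma card_facts_at:
  assumes D: "finite D"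
  shows "finite (facts_at L D)"
    and "card (facts_at L D) \<le>
      (\<Sum>s = m L..m L + L * 2 ^ L. card D choose s) * ((L + 1) * 2 ^ 2 ^ (L * 2 ^ L))"
proof -
  let ?r = "L * 2 ^ L"
  let ?ev = "\<lambda>U. {x \<in> U. even (x::nat)}"
  let ?od = "\<lambda>U. {x \<in> U. odd (x::nat)}"
  let ?\<U> = "\<Union>s\<in>{m L..m L + ?r}. {U. U \<subseteq> D \<and> card U = s}"
  let ?\<U>' = "{U \<in> ?\<U>. card (?ev U) \<le> ?r}"
  let ?f = "\<lambda>U (k, W). (?od U, k, {\<theta>. \<theta> \<inter> ?ev U \<in> W})"
  let ?G = "\<lambda>U. ?f U ` ({..L} \<times> Pow (Pow (?ev U)))"
  have fin1: "finite ?\<U>" using D by simp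
  have finU: "finite U" if "U \<in> ?\<U>'" for U using that D finite_subset by blast
  have fin2: "finite ({..L} \<times> Pow (Pow (?ev U)))" if "U \<in> ?\<U>'" for U using finU[OF that] by simp
  have sub: "facts_at L D \<subseteq> (\<Union>U\<in>?\<U>'. ?G U)"
  proof
    fix x assume "x \<in> facts_at L D"
    then obtain Z k V where x: "x = (Z, k, V)" "ctx L D Z" "k \<le> L" "adm L D k V"
      by (auto simp: facts_at_def)
    obtain P where P: "P \<subseteq> D" "finite P" "card P \<le> k * 2 ^ L" "\<forall>x\<in>P. even x" "supp P V"
      using x(4) unfolding adm_def by blast
    have Z: "Z \<subseteq> D" "finite Z" "card Z = m L" "\<forall>z\<in>Z. odd z" using x(2) by (auto simp: ctx_def)
    have ev: "?ev (Z \<union> P) = P" and od: "?od (Z \<union> P) = Z" using P(4) Z(4) by auto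
    have "k * 2 ^ L \<le> ?r" using x(3) by simp
    then have cP: "card P \<le> ?r" using P(3) by linarith
    have "Z \<inter> P = {}" using P(4) Z(4) by blast
    then have "card (Z \<union> P) = m L + card P" using Z(2,3) P(2) by (simp add: card_Un_disjoint)
    then have "Z \<union> P \<in> ?\<U>" using Z(1) P(1) cP by auto
    then have U: "Z \<union> P \<in> ?\<U>'" using ev cP by simp
    have "\<theta> \<inter> P \<in> V \<longleftrightarrow> \<theta> \<in> V" for \<theta> by (rule suppD[OF P(5)]) blast
    then have "V = {\<theta>. \<theta> \<inter> P \<in> V \<inter> Pow P}" by auto
    then have "x = ?f (Z \<union> P) (k, V \<inter> Pow P)" by (simp only: x(1) ev od prod.case)
    moreover have "(k, V \<inter> Pow P) \<in> {..L} \<times> Pow (Pow (?ev (Z \<union> P)))" using x(3) ev by auto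
    ultimately show "x \<in> (\<Union>U\<in>?\<U>'. ?G U)" using U by blast
  qed
  have finU': "finite ?\<U>'" by (rule finite_subset[OF _ fin1]) blast
  have fin: "finite (\<Union>U\<in>?\<U>'. ?G U)" using finU' fin2 by (intro finite_UN_I finite_imageI)
  show "finite (facts_at L D)" using sub fin by (rule finite_subset)
  have "card (facts_at L D) \<le> card (\<Union>U\<in>?\<U>'. ?G U)" by (rule card_mono[OF fin sub])
  also have "\<dots> \<le> (\<Sum>U\<in>?\<U>'. card (?G U))" by (rule card_UN_le[OF finU'])
  also have "\<dots> \<le> (\<Sum>U\<in>?\<U>'. (L + 1) * 2 ^ 2 ^ ?r)"
  proof (rule sum_mono)
    fix U assume U: "U \<in> ?\<U>'"
    have fe: "finite (?ev U)" using finU[OF U] by simp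
    have "card (?G U) \<le> card ({..L} \<times> Pow (Pow (?ev U)))" by (rule card_image_le[OF fin2[OF U]])
    also have "\<dots> = (L + 1) * 2 ^ 2 ^ card (?ev U)" using fe by (simp add: card_cartesian_product card_Pow)
    also have "\<dots> \<le> (L + 1) * 2 ^ 2 ^ ?r"
      using U by (intro mult_le_mono2 power_increasing) auto
    finally show "card (?G U) \<le> (L + 1) * 2 ^ 2 ^ ?r" .
  qed
  also have "\<dots> = card ?\<U>' * ((L + 1) * 2 ^ 2 ^ ?r)" by simp
  also have "\<dots> \<le> (\<Sum>s = m L..m L + ?r. card D choose s) * ((L + 1) * 2 ^ 2 ^ ?r)"
  proof (rule mult_le_mono1)
    have "card ?\<U>' \<le> card ?\<U>" by (rule card_mono[OF fin1]) blast
    also have "\<dots> \<le> (\<Sum>s\<in>{m L..m L + ?r}. card {U. U \<subseteq> D \<and> card U = s})" by (rule card_UN_le) simp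
    also have "\<dots> = (\<Sum>s = m L..m L + ?r. card D choose s)"
      using n_subsets[OF D] by simp
    finally show "card ?\<U>' \<le> (\<Sum>s = m L..m L + ?r. card D choose s)" .
  qed
  finally show "card (facts_at L D) \<le> (\<Sum>s = m L..m L + ?r. card D choose s) * ((L + 1) * 2 ^ 2 ^ ?r)" .
qed

end

context large_sizes
begin

lemma card_facts_at_le:
  assumes D: "finite D"
  shows "card (facts_at L D) * 2 ^ (L + 2) \<le> 2 ^ card D"
proof (cases "m L \<le> card D")
  case True
  let ?r = "L * 2 ^ L" and ?d = "card D" and ?w = "(L + 1) * 2 ^ 2 ^ (L * 2 ^ L)"
  \<comment> \<open>The factor \<open>?r + 1\<close> is the number of binomial coefficients in the
    sum. It is also contained in \<open>weight L\<close>, so it is carried along and cancelled at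
    the end.\<close>
  have "(?r + 1) * (card (facts_at L D) * 2 ^ (L + 2))
      \<le> (?r + 1) * (((\<Sum>s = m L..m L + ?r. ?d choose s) * ?w) * 2 ^ (L + 2))"
    by (intro mult_le_mono order_refl card_facts_at(2)[OF D])
  also have "\<dots> = (\<Sum>s = m L..m L + ?r. (?d choose s) * (weight L * 2 ^ (L + 2)))"
    unfolding weight_def sum_distrib_right[symmetric] by (simp only: ac_simps)
  also have "\<dots> \<le> (\<Sum>s = m L..m L + ?r. 2 ^ ?d)" by (rule sum_mono) (rule m_large[OF True])
  also have "\<dots> = (?r + 1) * 2 ^ ?d" by simp
  finally show ?thesis by (simp only: mult_le_cancel1)
next
  case False
  have "facts_at L D = {}"
  proof (rule ccontr)
    assume "facts_at L D \<noteq> {}"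
    then obtain Z where "ctx L D Z" by (auto simp: facts_at_def)
    then show False using False card_mono[OF D, of Z] by (simp add: ctx_def)
  qed
  then show ?thesis by simp
qed

text \<open>A geometric series over the levels. The factor 2 is decisive: it bounds the number of
  structures by the square root of \<open>2 ^ 2 ^ card D\<close>, which leaves room for the tuples
  of names.\<close>

lemma card_facts:
  assumes D: "finite D"
  shows "2 * card (facts D) \<le> 2 ^ card D"
proof -
  let ?n = "Suc (card D)"
  have sub: "facts D \<subseteq> (SIGMA L:{..<?n}. facts_at L D)"
  proof
    fix f assume "f \<in> facts D"
    then obtain L Z k V where f: "f = (L, Z, k, V)" "ctx L D Z" "k \<le> L" "adm L D k V"
      by (auto simp: facts_def)
    have "L < ?n" using f(2) card_mono[OF D, of Z] m_gt[of L] by (simp add: ctx_def)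
    with f show "f \<in> (SIGMA L:{..<?n}. facts_at L D)" by (simp add: facts_at_def)
  qed
  have "card (facts D) \<le> card (SIGMA L:{..<?n}. facts_at L D)"
    by (rule card_mono[OF _ sub]) (use card_facts_at(1)[OF D] in auto)
  also have "\<dots> = (\<Sum>L<?n. card (facts_at L D))" using card_facts_at(1)[OF D] by simp
  finally have "real (card (facts D)) \<le> (\<Sum>L<?n. real (card (facts_at L D)))"
    by (simp flip: of_nat_sum del: sum.lessThan_Suc)
  also have "\<dots> \<le> (\<Sum>L<?n. 2 ^ card D * (1 / 2) ^ (L + 2))"
  proof (rule sum_mono)
    fix L
    have "real (card (facts_at L D) * 2 ^ (L + 2)) \<le> real (2 ^ card D)"
      using card_facts_at_le[OF D, of L] by (simp only: of_nat_le_iff)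
    then show "real (card (facts_at L D)) \<le> 2 ^ card D * (1 / 2) ^ (L + 2)"
      by (simp add: field_simps)
  qed
  also have "\<dots> = 2 ^ card D * (\<Sum>L<?n. (1 / 2) ^ (L + 2))" by (simp only: sum_distrib_left)
  also have "(\<Sum>L<n. (1 / 2) ^ (L + 2)) = (1 / 2 - (1 / 2) ^ (n + 1) :: real)" for n
    by (induction n) (simp_all add: field_simps)
  also have "2 ^ card D * (1 / 2 - (1 / 2) ^ (?n + 1)) \<le> 2 ^ card D * (1 / 2 :: real)"
    by (rule mult_left_mono) simp_all
  finally have "real (2 * card (facts D)) \<le> real (2 ^ card D)" by simp
  then show ?thesis by (simp only: of_nat_le_iff)
qed

end

locale generic_large = generic + large_sizes
begin

lemma orbits_bound:
  shows "finite (orbits A (rels A M) (Suc k))"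
    and "card (orbits A (rels A M) (Suc k)) \<le> (2 * Suc k) ^ Suc k * 2 ^ 2 ^ k"
proof -
  have F: "card (facts D) \<le> 2 ^ k" if "finite D" "card D \<le> Suc k" for D
  proof -
    have "2 * card (facts D) \<le> 2 ^ card D" by (rule card_facts[OF that(1)])
    also have "\<dots> \<le> 2 ^ Suc k" using that(2) by (rule power_increasing) simp
    finally show ?thesis by simp
  qed
  show "finite (orbits A (rels A M) (Suc k))"
    "card (orbits A (rels A M) (Suc k)) \<le> (2 * Suc k) ^ Suc k * 2 ^ 2 ^ k"
    by (rule finite_orbits[OF F], simp, simp) (rule card_orbits[OF F], simp, simp)
qed

lemma omega_categorical_rels: "omega_categorical A (rels A M)"
  unfolding omega_categorical_def
proof (intro allI impI)
  fix k :: nat assume "1 \<le> k"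
  then obtain j where "k = Suc j" by (cases k) auto
  then show "finite (orbits A (rels A M) k)" using orbits_bound(1) by simp
qed

lemma orbit_growth: "less_than_doubly_exp_growth A (rels A M)"
  unfolding less_than_doubly_exp_growth_def
proof (rule tendsto_sandwich)
  show "\<forall>\<^sub>F k in sequentially. 0 \<le> real (card (orbits A (rels A M) k)) / 2 ^ 2 ^ k" by simp
  show "\<forall>\<^sub>F k in sequentially. real (card (orbits A (rels A M) k)) / 2 ^ 2 ^ k \<le> (1 / 2) ^ k"
    unfolding eventually_sequentially
  proof (intro exI allI impI)
    \<comment> \<open>The exponent \<open>k * k + k\<close> accounts for the tuples of names and for
      the factor \<open>2 ^ k\<close> wanted in the limit. From 8 on it is at most half of
      \<open>2 ^ k\<close>, and the number of structures takes the other half.\<close>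
    fix k :: nat assume k8: "8 \<le> k"
    then obtain j where j: "k = Suc j" by (cases k) auto
    have quad: "k * k + k \<le> 2 ^ (k - 1)" using k8
    proof (induction k rule: dec_induct)
      case (step n)
      have "8 * n \<le> n * n" using step(1) by simp
      moreover have "Suc n * Suc n + Suc n = n * n + 3 * n + 2" by simp
      moreover have "(2::nat) ^ (Suc n - 1) = 2 * 2 ^ (n - 1)" using step(1) by (cases n) simp_all
      ultimately show ?case using step(1,3) by linarith
    qed simp
    have lin: "2 * k \<le> 2 ^ k" using k8
    proof (induction k rule: dec_induct)
      case (step n) then show ?case by simp
    qed simp
    have "card (orbits A (rels A M) k) * 2 ^ k \<le> ((2 * k) ^ k * 2 ^ 2 ^ j) * 2 ^ k"
      using orbits_bound(2)[of j] j by simp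
    also have "\<dots> \<le> ((2 ^ k) ^ k * 2 ^ 2 ^ j) * 2 ^ k"
      by (intro mult_le_mono1 power_mono lin) simp
    also have "\<dots> = 2 ^ (k * k + k + 2 ^ j)" by (simp add: power_add power_mult ac_simps)
    also have "\<dots> \<le> 2 ^ 2 ^ k"
    proof (rule power_increasing)
      show "k * k + k + 2 ^ j \<le> 2 ^ k" using quad by (simp add: j)
    qed simp
    finally have "real (card (orbits A (rels A M) k) * 2 ^ k) \<le> real (2 ^ 2 ^ k)"
      by (simp only: of_nat_le_iff)
    then show "real (card (orbits A (rels A M) k)) / 2 ^ 2 ^ k \<le> (1 / 2) ^ k"
      by (simp add: field_simps)
  qed
  show "(\<lambda>k. (1 / 2 :: real) ^ k) \<longlonglongrightarrow> 0" by (rule LIMSEQ_power_zero) simp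
qed simp

end

section \<open>A minion homomorphism to the projections\<close>

lemma minor_proj:
  assumes "i < n" "\<forall>i<n. \<pi> i < k"
  shows "minor UNIV n k \<pi> (proj n i) = proj k (\<pi> i)"
  using assms by (auto simp: minor_def proj_def tuples_def fun_eq_iff restrict_def)

lemma minor_apply:
  assumes "x \<in> tuples k A"
  shows "minor A n k \<pi> f x = f (restrict (\<lambda>i. x (\<pi> i)) {0..<n})"
  using assms by (simp add: minor_def)

lemma restrict_in_tuples: "(\<And>i. i < n \<Longrightarrow> x i \<in> A) \<Longrightarrow> restrict x {0..<n} \<in> tuples n A"
  by (auto simp: tuples_def)

lemma minor_in_Pol:
  assumes S: "rel_structure A Rels" and f: "f \<in> Pol A Rels n" and \<pi>: "\<forall>i<n. \<pi> i < k"
  shows "minor A n k \<pi> f \<in> Pol A Rels k"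
  unfolding Pol_def
proof (intro CollectI conjI ballI)
  have op: "f \<in> tuples n A \<rightarrow>\<^sub>E A" using f by (simp add: Pol_def is_op_def)
  show "is_op A k (minor A n k \<pi> f)"
    unfolding is_op_def minor_def
  proof (rule restrict_PiE_iff[THEN iffD2], rule ballI)
    fix x assume "x \<in> tuples k A"
    then have "x (\<pi> i) \<in> A" if "i < n" for i using \<pi> that by (auto simp: tuples_def)
    then show "f (restrict (\<lambda>i. x (\<pi> i)) {0..<n}) \<in> A"
      by (intro PiE_mem[OF op] restrict_in_tuples)
  qed
  fix R assume R: "R \<in> Rels"
  obtain l r where lr: "R = (l, r)" by (cases R)
  have r: "length t = l" "set t \<subseteq> A" if "t \<in> r" for t
    using S R that unfolding rel_structure_def lr by blast+
  have pres: "preserves n f (l, r)" using f R by (simp add: Pol_def lr)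
  show "preserves k (minor A n k \<pi> f) R"
    unfolding preserves_def lr prod.case
  proof (intro allI impI)
    fix x assume x: "\<forall>i<k. x i \<in> r"
    have "\<forall>i<n. x (\<pi> i) \<in> r" using x \<pi> by blast
    then have "map (\<lambda>j. f (restrict (\<lambda>i. x (\<pi> i) ! j) {0..<n})) [0..<l] \<in> r"
      using pres[unfolded preserves_def prod.case, THEN spec[of _ "\<lambda>i. x (\<pi> i)"]] by blast
    moreover have eq: "map (\<lambda>j. minor A n k \<pi> f (restrict (\<lambda>i. x i ! j) {0..<k})) [0..<l] =
        map (\<lambda>j. f (restrict (\<lambda>i. x (\<pi> i) ! j) {0..<n})) [0..<l]"
    proof (rule map_cong[OF refl])
      fix j assume j: "j \<in> set [0..<l]"
      have "restrict (\<lambda>i. x i ! j) {0..<k} \<in> tuples k A"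
      proof (rule restrict_in_tuples)
        fix i assume "i < k"
        then have "length (x i) = l" "set (x i) \<subseteq> A" using r x by blast+
        then show "x i ! j \<in> A" using j nth_mem[of j "x i"] by auto
      qed
      then show "minor A n k \<pi> f (restrict (\<lambda>i. x i ! j) {0..<k}) = f (restrict (\<lambda>i. x (\<pi> i) ! j) {0..<n})"
        using \<pi> by (simp add: minor_apply cong: restrict_cong)
    qed
    ultimately show "map (\<lambda>j. minor A n k \<pi> f (restrict (\<lambda>i. x i ! j) {0..<k})) [0..<l] \<in> r"
      by (simp only: eq)
  qed
qed

text \<open>The choices form a product of finite discrete spaces, compact by Tychonoff, and a
  condition on two coordinates is a finite union of closed cylinders. The finite intersection
  property therefore passes from finite subfamilies to X.\<close>

lemma compact_choice:
  fixes n :: "'a \<Rightarrow> nat" and C :: "'a \<Rightarrow> 'a \<Rightarrow> nat \<Rightarrow> nat \<Rightarrow> bool"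
  assumes fin: "\<And>F. finite F \<Longrightarrow> F \<subseteq> X \<Longrightarrow>
    \<exists>I. (\<forall>a\<in>F. I a < n a) \<and> (\<forall>a\<in>F. \<forall>b\<in>F. C a b (I a) (I b))"
  shows "\<exists>I. (\<forall>a\<in>X. I a < n a) \<and> (\<forall>a\<in>X. \<forall>b\<in>X. C a b (I a) (I b))"
proof -
  define T where "T = product_topology (\<lambda>a. discrete_topology {..<n a}) X"
  have top: "topspace T = (\<Pi>\<^sub>E a\<in>X. {..<n a})" by (simp add: T_def)
  define K where "K = (\<lambda>(a, b). {I \<in> topspace T. C a b (I a) (I b)})"
  have "compact_space T" unfolding T_def
    by (simp add: compact_space_product_topology compact_space_discrete_topology)
  have pos: "0 < n a" if "a \<in> X" for a using fin[of "{a}"] that by fastforce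
  have point: "closedin T {I \<in> topspace T. I a = i}" if "a \<in> X" for a i
  proof -
    have "closedin T {I \<in> topspace T. I a \<in> {i} \<inter> {..<n a}}"
      by (rule closedin_continuous_map_preimage[where Y = "discrete_topology {..<n a}"])
        (use that in \<open>auto simp: T_def intro: continuous_map_product_projection\<close>)
    moreover have "{I \<in> topspace T. I a \<in> {i} \<inter> {..<n a}} = {I \<in> topspace T. I a = i}"
      using that by (auto simp: top)
    ultimately show ?thesis by simp
  qed
  have closed: "closedin T (K p)" if p: "p \<in> X \<times> X" for p
  proof -
    obtain a b where ab: "p = (a, b)" "a \<in> X" "b \<in> X" using p by blast
    let ?S = "(\<lambda>(i, j). {I \<in> topspace T. I a = i} \<inter> {I \<in> topspace T. I b = j}) `
      {(i, j) \<in> {..<n a} \<times> {..<n b}. C a b i j}"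
    have "closedin T (\<Union>?S)"
    proof (rule closedin_Union)
      show "finite ?S" by (rule finite_imageI, rule finite_subset[of _ "{..<n a} \<times> {..<n b}"]) auto
      show "closedin T S" if S: "S \<in> ?S" for S
      proof -
        obtain i j where "S = {I \<in> topspace T. I a = i} \<inter> {I \<in> topspace T. I b = j}"
          using S by (elim imageE) (auto simp: split_beta)
        then show ?thesis using closedin_Int[OF point[OF ab(2), of i] point[OF ab(3), of j]] by simp
      qed
    qed
    moreover have "K p = \<Union>?S" using ab by (auto simp: K_def top)
    ultimately show ?thesis by simp
  qed
  \<comment> \<open>Including the whole space guarantees that a point of the intersection is an
    admissible choice even when X is empty.\<close>
  let ?U = "insert (topspace T) (K ` (X \<times> X))"
  have "\<Inter>?U \<noteq> {}"
  proof (rule \<open>compact_space T\<close>[unfolded compact_space_fip, rule_format], intro conjI ballI allI impI)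
    show "closedin T S" if "S \<in> ?U" for S using that closed by auto
    fix \<F> assume \<F>: "finite \<F> \<and> \<F> \<subseteq> ?U"
    then have "finite (\<F> - {topspace T})" "\<F> - {topspace T} \<subseteq> K ` (X \<times> X)" by auto
    from finite_subset_image[OF this] obtain P where P: "P \<subseteq> X \<times> X" "finite P"
      "\<F> - {topspace T} = K ` P" by blast
    define F where "F = fst ` P \<union> snd ` P"
    have "finite F" "F \<subseteq> X" using P(1,2) by (auto simp: F_def)
    from fin[OF this] obtain I where I: "\<forall>a\<in>F. I a < n a" "\<forall>a\<in>F. \<forall>b\<in>F. C a b (I a) (I b)"
      by blast
    \<comment> \<open>Off F any admissible value will do, and 0 is admissible because every
      \<open>n a\<close> is positive.\<close>
    define J where "J = restrict (\<lambda>a. if a \<in> F then I a else 0) X"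
    have J: "J \<in> topspace T"
      unfolding top J_def by (rule restrict_PiE_iff[THEN iffD2]) (use I(1) pos in simp)
    have JK: "J \<in> K p" if p: "p \<in> P" for p
    proof -
      obtain a b where ab: "p = (a, b)" by (cases p)
      have F: "a \<in> F" "b \<in> F" using p ab unfolding F_def by force+
      moreover have "a \<in> X" "b \<in> X" using P(1) p ab by auto
      moreover have "C a b (I a) (I b)" using I(2) F by blast
      ultimately show ?thesis using J by (simp add: K_def ab J_def)
    qed
    have "J \<in> S" if S: "S \<in> \<F>" for S
    proof (cases "S = topspace T")
      case False
      then have "S \<in> K ` P" using S unfolding P(3)[symmetric] by simp
      then show ?thesis using JK by (elim imageE) simp
    qed (use J in simp)
    then have "J \<in> \<Inter>\<F>" by (rule InterI)
    then show "\<Inter>\<F> \<noteq> {}" by (metis empty_iff)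
  qed
  then obtain I where I: "I \<in> \<Inter>?U" by (metis ex_in_conv)
  have It: "I \<in> topspace T" using I by simp
  have "C a b (I a) (I b)" if "a \<in> X" "b \<in> X" for a b
  proof -
    have "I \<in> K (a, b)" using I that by (meson InterD SigmaI imageI insertI2)
    then show ?thesis by (simp add: K_def)
  qed
  moreover have "I a < n a" if "a \<in> X" for a using It that by (auto simp: top)
  ultimately show ?thesis by blast
qed

text \<open>Grades add up under intersection, so up to L constraints of grade 1 remain jointly
  satisfiable.\<close>

lemma sys_Inter:
  assumes U: "sys L A U" and "finite E" and W: "\<And>e. e \<in> E \<Longrightarrow> (1, W e) \<in> U" and "card E \<le> L"
  shows "(card E, \<Inter>e\<in>E. W e) \<in> U"
  using assms(2-4)
proof (induction E)
  case (insert e E)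
  have "(card E, \<Inter>e\<in>E. W e) \<in> U" using insert by simp
  then have "(card E + 1, (\<Inter>e\<in>E. W e) \<inter> W e) \<in> U"
    by (rule sysD(6)[OF U]) (use insert in auto)
  then show ?case using insert by (simp add: Int_commute)
qed (simp add: sysD(4)[OF U])

context generic
begin

lemma rel_structure_rels: "A \<noteq> {} \<Longrightarrow> rel_structure A (rels A M)"
  by (auto simp: rel_structure_def rels_def hyp_def)

text \<open>The columns of the table are simultaneously satisfied by giving label 1 to
  \<open>d1\<close> only, since each tuple is then read as its own column. Hence they occur in a
  finite structure, which \<open>embedding\<close> places into A.\<close>

lemma template_exists:
  "\<exists>d0 d1 zs. length zs = m L \<and> d0 \<in> A \<and> d1 \<in> A \<and> set zs \<subseteq> A \<and>
    (\<forall>i<L. hyp M L (map (\<lambda>b. if i \<in> set_decode b then d1 else d0) [0..<2 ^ L] @ zs))"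
proof -
  let ?odd = "\<lambda>j::nat. 2 * j + 1"
  define ys where "ys = map ?odd [0..<m L]"
  define Q where "Q = insert 0 (insert 2 (set ys))"
  \<comment> \<open>All constraints satisfied by the single labelling \<open>{2}\<close>; this is
    consistent at every level, whatever the grades.\<close>
  define N where "N L' Z = (if ctx L' Q Z then {(k, V). k \<le> L' \<and> adm L' Q k V \<and> {2} \<in> V} else {})"
    for L' Z
  have "good Q N" unfolding good_def N_def sys_def by (auto intro: adm_Int)
  from embedding[OF this] obtain \<iota> where \<iota>: "\<iota> ` Q \<subseteq> A"
    "\<And>D. finite D \<Longrightarrow> D \<subseteq> Q \<Longrightarrow> emb \<iota> D N M" by blast
  have e: "emb \<iota> Q N M" by (rule \<iota>(2)) (simp_all add: Q_def)
  let ?t = "\<lambda>i. map (\<lambda>b. if i \<in> set_decode b then 2 else 0) [0..<2 ^ L] @ ys"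
  have tb: "?t i ! b = (if i \<in> set_decode b then 2 else 0)" if "b < 2 ^ L" for i b
    using that by (simp add: nth_append)
  have tQ: "set (?t i) \<subseteq> Q" for i by (auto simp: Q_def)
  have hyp: "hyp N L (?t i)" if i: "i < L" for i
  proof -
    have dist: "distinct ys" by (simp add: ys_def distinct_map inj_on_def)
    have "ctx L Q (set ys)"
      using distinct_card[OF dist] by (auto simp: ctx_def Q_def ys_def)
    moreover have "adm L Q 1 (Vc L (\<lambda>b. ?t i ! b))"
      by (rule adm_Vc) (auto simp: tb Q_def)
    moreover have "{2} \<in> Vc L (\<lambda>b. ?t i ! b)"
      unfolding Vc_def using i by (auto simp: tb)
    ultimately have "(1, Vc L (\<lambda>b. ?t i ! b)) \<in> N L (set ys)" using i by (simp add: N_def)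
    moreover have "length (?t i) = 2 ^ L + m L" by (simp add: ys_def)
    moreover have "\<forall>z\<in>set ys. odd z" by (auto simp: ys_def)
    ultimately show ?thesis unfolding hyp_def using dist tb by (simp del: nth_append)
  qed
  show ?thesis
  proof (intro exI conjI allI impI)
    show "length (map \<iota> ys) = m L" by (simp add: ys_def)
    show "\<iota> 0 \<in> A" "\<iota> 2 \<in> A" "set (map \<iota> ys) \<subseteq> A" using \<iota>(1) by (auto simp: Q_def)
    fix i assume i: "i < L"
    have "hyp M L (map \<iota> (?t i))" using hyp_emb[OF e tQ] hyp[OF i] by blast
    moreover have eq: "map \<iota> (?t i) = map (\<lambda>b. if i \<in> set_decode b then \<iota> 2 else \<iota> 0) [0..<2 ^ L] @ map \<iota> ys"
      by auto
    ultimately show "hyp M L (map (\<lambda>b. if i \<in> set_decode b then \<iota> 2 else \<iota> 0) [0..<2 ^ L] @ map \<iota> ys)"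
      by (simp only: eq)
  qed
qed

text \<open>A polymorphism applied to the columns gives a hyperedge whose context is the image of
  \<open>zs\<close> under its diagonal. A minor has the same diagonal, so it shares context and
  labelling with the original function; the column read off by the labelling is the chosen
  coordinate.\<close>

lemma finite_choice:
  fixes F :: "(nat \<times> ((nat \<Rightarrow> nat) \<Rightarrow> nat)) set"
  assumes F: "finite F" "\<And>n f. (n, f) \<in> F \<Longrightarrow> f \<in> Pol A (rels A M) n"
  shows "\<exists>I. (\<forall>a\<in>F. I a < fst a) \<and>
    (\<forall>a\<in>F. \<forall>b\<in>F. \<forall>\<pi>. (\<forall>i<fst a. \<pi> i < fst b) \<longrightarrow> snd b = minor A (fst a) (fst b) \<pi> (snd a) \<longrightarrow>
      I b = \<pi> (I a))"
proof -
  \<comment> \<open>L serves twice: functions of arity at most L find enough columns as arguments,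
    and the at most L resulting hyperedges in one context have a common satisfying
    labelling.\<close>
  define L where "L = card F + Max (insert 0 (fst ` F))"
  have nL: "n \<le> L" if "(n, f) \<in> F" for n f
  proof -
    have "n \<in> insert 0 (fst ` F)" using that by force
    then have "n \<le> Max (insert 0 (fst ` F))" using F(1) by simp
    then show ?thesis by (simp add: L_def)
  qed
  obtain d0 d1 zs where zs: "length zs = m L" "set zs \<subseteq> A"
    and d: "d0 \<in> A" "d1 \<in> A"
    and hyp: "\<And>i. i < L \<Longrightarrow> hyp M L (map (\<lambda>b. if i \<in> set_decode b then d1 else d0) [0..<2 ^ L] @ zs)"
    using template_exists[of L] by blast
  define t where "t i = map (\<lambda>b. if i \<in> set_decode b then d1 else d0) [0..<2 ^ L] @ zs" for i
  have tA: "set (t i) \<subseteq> A" for i using d zs(2) by (auto simp: t_def)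
  define e where "e n f b = f (restrict (\<lambda>i. if i \<in> set_decode b then d1 else d0) {0..<n})"
    for n :: nat and f :: "(nat \<Rightarrow> nat) \<Rightarrow> nat" and b
  define dg where "dg n f = map (\<lambda>z. f (restrict (\<lambda>_. z) {0..<n})) zs"
    for n :: nat and f :: "(nat \<Rightarrow> nat) \<Rightarrow> nat"
  have edge: "(1, Vc L (e n f)) \<in> M L (set (dg n f))" if nf: "(n, f) \<in> F" for n f
  proof -
    let ?l = "2 ^ L + m L"
    let ?r = "map (\<lambda>j. f (restrict (\<lambda>i. t i ! j) {0..<n})) [0..<?l]"
    have "preserves n f (?l, {t. set t \<subseteq> A \<and> hyp M L t})"
      using F(2)[OF nf] by (auto simp: Pol_def rels_def)
    moreover have "t i \<in> {t. set t \<subseteq> A \<and> hyp M L t}" if "i < n" for i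
      using that nL[OF nf] tA hyp[of i] by (simp add: t_def)
    ultimately have "?r \<in> {t. set t \<subseteq> A \<and> hyp M L t}"
      unfolding preserves_def prod.case by blast
    then have r: "(1, Vc L (\<lambda>b. ?r ! b)) \<in> M L (set (drop (2 ^ L) ?r))" by (simp add: hyp_def)
    have "?r ! b = e n f b" if "b < 2 ^ L" for b
      using that by (simp add: e_def t_def nth_append cong: restrict_cong)
    then have "Vc L (\<lambda>b. ?r ! b) = Vc L (e n f)" by (rule Vc_cong)
    moreover have "drop (2 ^ L) ?r = dg n f"
      by (rule nth_equalityI) (simp_all add: dg_def zs(1) t_def nth_append cong: restrict_cong)
    ultimately show ?thesis using r by simp
  qed
  have ex: "\<exists>\<theta>. \<forall>(n, f)\<in>F. set (dg n f) = Z \<longrightarrow> \<theta> \<in> Vc L (e n f)" for Z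
  proof (cases "\<exists>(n, f)\<in>F. set (dg n f) = Z")
    case True
    then obtain n0 f0 where "(n0, f0) \<in> F" "set (dg n0 f0) = Z" by blast
    then have S: "sys L A (M L Z)" using edge[of n0 f0] goodD[OF good_AM] good_ctx[OF good_AM] by blast
    let ?E = "{a \<in> F. set (dg (fst a) (snd a)) = Z}"
    have "card ?E \<le> card F" using F(1) by (intro card_mono) auto
    then have "card ?E \<le> L" by (simp add: L_def)
    then have "(card ?E, \<Inter>a\<in>?E. Vc L (e (fst a) (snd a))) \<in> M L Z"
      by (intro sys_Inter[OF S]) (use edge F(1) in auto)
    then have "(\<Inter>a\<in>?E. Vc L (e (fst a) (snd a))) \<noteq> {}" using sysD(3)[OF S] by metis
    then obtain \<theta> where "\<theta> \<in> (\<Inter>a\<in>?E. Vc L (e (fst a) (snd a)))" by blast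
    then show ?thesis by (intro exI[of _ \<theta>]) auto
  qed auto
  have "\<exists>\<theta>. \<forall>Z. \<forall>(n, f)\<in>F. set (dg n f) = Z \<longrightarrow> \<theta> Z \<in> Vc L (e n f)"
    by (rule choice) (use ex in blast)
  then obtain \<theta> where \<theta>: "\<And>n f. (n, f) \<in> F \<Longrightarrow> \<theta> (set (dg n f)) \<in> Vc L (e n f)" by blast
  have "\<exists>I. \<forall>a\<in>F. I a < L \<and> (\<forall>b<2 ^ L.
      e (fst a) (snd a) b \<in> \<theta> (set (dg (fst a) (snd a))) \<longleftrightarrow> I a \<in> set_decode b)"
  proof (rule bchoice, rule ballI)
    fix a assume "a \<in> F"
    then show "\<exists>i. i < L \<and> (\<forall>b<2 ^ L.
        e (fst a) (snd a) b \<in> \<theta> (set (dg (fst a) (snd a))) \<longleftrightarrow> i \<in> set_decode b)"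
      using \<theta>[of "fst a" "snd a"] by (simp add: Vc_def)
  qed
  then obtain I where I: "\<And>a. a \<in> F \<Longrightarrow> I a < L"
    "\<And>a b. a \<in> F \<Longrightarrow> b < 2 ^ L \<Longrightarrow>
      e (fst a) (snd a) b \<in> \<theta> (set (dg (fst a) (snd a))) \<longleftrightarrow> I a \<in> set_decode b"
    by blast
  show ?thesis
  proof (intro exI[of _ I] conjI ballI allI impI)
    fix a assume "a \<in> F"
    moreover obtain n f where a: "a = (n, f)" by (cases a)
    ultimately have nf: "(n, f) \<in> F" by simp
    \<comment> \<open>For an index beyond the arity, the rows of \<open>{}\<close> and of
      \<open>{I (n, f)}\<close> agree in the first n columns, although the labelling separates the
      two values of f.\<close>
    have "I (n, f) < n"
    proof (rule ccontr)
      assume ge: "\<not> I (n, f) < n"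
      obtain b0 where b0: "b0 < 2 ^ L" "set_decode b0 = {}" using ex_set_decode[of "{}" L] by auto
      obtain b1 where b1: "b1 < 2 ^ L" "set_decode b1 = {I (n, f)}"
        using ex_set_decode[of "{I (n, f)}" L] I(1)[OF nf] by auto
      have "e n f b0 = e n f b1"
        unfolding e_def b0(2) b1(2) using ge by (intro arg_cong[where f = f] restrict_ext) auto
      then show False using I(2)[OF nf b0(1)] I(2)[OF nf b1(1)] b0(2) b1(2) by simp
    qed
    then show "I a < fst a" by (simp add: a)
  next
    fix a c \<pi>
    assume "a \<in> F" "c \<in> F" and "\<forall>i<fst a. \<pi> i < fst c" "snd c = minor A (fst a) (fst c) \<pi> (snd a)"
    moreover obtain n f where a: "a = (n, f)" by (cases a)
    moreover obtain k g where c: "c = (k, g)" by (cases c)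
    ultimately have nf: "(n, f) \<in> F" and kg: "(k, g) \<in> F" and \<pi>: "\<forall>i<n. \<pi> i < k"
      and g: "g = minor A n k \<pi> f" by simp_all
    have dg: "dg k g = dg n f" unfolding dg_def
    proof (rule map_cong[OF refl])
      fix z assume "z \<in> set zs"
      then have "restrict (\<lambda>_. z) {0..<k} \<in> tuples k A" using zs(2) by (intro restrict_in_tuples) auto
      then show "g (restrict (\<lambda>_. z) {0..<k}) = f (restrict (\<lambda>_. z) {0..<n})"
        using \<pi> by (simp add: g minor_apply cong: restrict_cong)
    qed
    \<comment> \<open>On the row with its only 1 in column \<open>I (k, g)\<close>, the minor g
      takes the value of f on the row given by the preimage under \<pi>. The label there is 1, so
      the coordinate chosen for f lies in this preimage.\<close>
    obtain b' where b': "b' < 2 ^ L" "set_decode b' = {I (k, g)}"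
      using ex_set_decode[of "{I (k, g)}" L] I(1)[OF kg] by auto
    have "{i. i < n \<and> \<pi> i = I (k, g)} \<subseteq> {..<L}" using nL[OF nf] by auto
    then obtain b where b: "b < 2 ^ L" "set_decode b = {i. i < n \<and> \<pi> i = I (k, g)}"
      by (rule ex_set_decode)
    have "e k g b' = e n f b"
    proof -
      have "restrict (\<lambda>i. if i \<in> set_decode b' then d1 else d0) {0..<k} \<in> tuples k A"
        using d by (intro restrict_in_tuples) auto
      then have "e k g b' = f (restrict (\<lambda>i. restrict (\<lambda>i. if i \<in> set_decode b' then d1 else d0) {0..<k} (\<pi> i)) {0..<n})"
        unfolding e_def g by (rule minor_apply)
      also have "\<dots> = e n f b"
        unfolding e_def b(2) b'(2) using \<pi> by (intro arg_cong[where f = f] restrict_ext) auto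
      finally show ?thesis .
    qed
    then have "I (n, f) \<in> set_decode b"
      using I(2)[OF kg b'(1)] I(2)[OF nf b(1)] dg b'(2) by simp
    then show "I c = \<pi> (I a)" using b(2) by (simp add: a c)
  qed
qed

lemma ex_minion_hom:
  assumes "A \<noteq> {}"
  shows "\<exists>\<xi>. minion_hom A (Pol A (rels A M)) (UNIV :: bool set) Proj_clone \<xi>"
proof -
  define X where "X = {(n :: nat, f). 1 \<le> n \<and> f \<in> Pol A (rels A M) n}"
  define C where "C = (\<lambda>(n :: nat, f) (k :: nat, g) i j.
    \<forall>\<pi>. (\<forall>i<n. \<pi> i < k) \<longrightarrow> g = minor A n k \<pi> f \<longrightarrow> j = \<pi> i)"
  have "\<exists>I. (\<forall>a\<in>X. I a < fst a) \<and> (\<forall>a\<in>X. \<forall>b\<in>X. C a b (I a) (I b))"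
  proof (rule compact_choice)
    fix F assume F: "finite F" "F \<subseteq> X"
    have "\<And>n f. (n, f) \<in> F \<Longrightarrow> f \<in> Pol A (rels A M) n" using F(2) by (auto simp: X_def)
    from finite_choice[OF F(1) this]
    show "\<exists>I. (\<forall>a\<in>F. I a < fst a) \<and> (\<forall>a\<in>F. \<forall>b\<in>F. C a b (I a) (I b))"
      unfolding C_def split_beta .
  qed
  then obtain I where I: "\<And>a. a \<in> X \<Longrightarrow> I a < fst a"
    "\<And>a b. a \<in> X \<Longrightarrow> b \<in> X \<Longrightarrow> C a b (I a) (I b)"
    by blast
  have "minion_hom A (Pol A (rels A M)) UNIV Proj_clone (\<lambda>n f. proj n (I (n, f)))"
    unfolding minion_hom_def
  proof (intro conjI allI impI ballI)
    fix n f assume "1 \<le> n" "f \<in> Pol A (rels A M) n"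
    then show "proj n (I (n, f)) \<in> Proj_clone n"
      using I(1)[of "(n, f)"] by (auto simp: Proj_clone_def X_def)
  next
    fix n k :: nat and f \<pi>
    assume n: "1 \<le> n" and k: "1 \<le> k" and f: "f \<in> Pol A (rels A M) n" and \<pi>: "\<forall>i<n. \<pi> i < k"
    let ?g = "minor A n k \<pi> f"
    have g: "?g \<in> Pol A (rels A M) k" by (rule minor_in_Pol[OF rel_structure_rels[OF assms] f \<pi>])
    have "I (k, ?g) = \<pi> (I (n, f))" 
      using I(2)[of "(n, f)" "(k, ?g)"] n k f g \<pi> by (auto simp: X_def C_def)
    moreover have "I (n, f) < n" using I(1)[of "(n, f)"] n f by (simp add: X_def)
    ultimately show "proj k (I (k, ?g)) = minor UNIV n k \<pi> (proj n (I (n, f)))"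
      using minor_proj[OF _ \<pi>] by simp
  qed
  then show ?thesis by blast
qed

end

section \<open>Local identities\<close>

text \<open>The two powers of A are coded by naturals so that the codes meet exactly in the
  arguments to be identified; \<open>ix \<sigma> s\<close> is the subset attached to coordinate s.
  At levels that can notice the identification, K exceeds the number of elements in L hyperedges
  with a common context.\<close>

locale gluing = generic +
  fixes F :: "nat set" and K :: nat and N :: "bool \<Rightarrow> nat" and ix :: "bool \<Rightarrow> nat \<Rightarrow> nat set"
    and q :: "bool \<Rightarrow> (nat \<Rightarrow> nat) \<Rightarrow> nat"
  assumes F: "finite F" "F \<subseteq> A"
    and K: "2 \<le> K" "m L \<le> card F \<Longrightarrow> L * 2 ^ L + m L < K"
    and out: "k < K \<Longrightarrow> l < K \<Longrightarrow> \<exists>s<N \<sigma>. k \<notin> ix \<sigma> s \<and> l \<notin> ix \<sigma> s"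
    and sep: "k < K \<Longrightarrow> l < K \<Longrightarrow> k \<noteq> l \<Longrightarrow> \<exists>s<N \<sigma>. k \<in> ix \<sigma> s \<and> l \<notin> ix \<sigma> s"
    and ix_empty: "\<exists>s<N True. ix True s = {}"
    and ix_single: "k < K \<Longrightarrow> \<exists>s<N False. ix False s = {k}"
    and q_inj: "inj_on (q \<sigma>) (tuples (N \<sigma>) A)"
    and q_glue: "u \<in> tuples (N True) A \<Longrightarrow> v \<in> tuples (N False) A \<Longrightarrow> q True u = q False v \<longleftrightarrow>
      (\<exists>k<K. \<exists>x\<in>F. \<exists>y\<in>F. u = restrict (\<lambda>s. if k \<in> ix True s then y else x) {0..<N True} \<and>
        v = restrict (\<lambda>s. if k \<in> ix False s then y else x) {0..<N False})"
    and q_par: "u \<in> tuples (N \<sigma>) A \<Longrightarrow> odd (q \<sigma> u) \<longleftrightarrow> (\<forall>s<N \<sigma>. odd (u s))"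
begin

abbreviation row :: "bool \<Rightarrow> nat \<Rightarrow> nat \<Rightarrow> nat \<Rightarrow> nat \<Rightarrow> nat" where
  "row \<sigma> k x y \<equiv> restrict (\<lambda>s. if k \<in> ix \<sigma> s then y else x) {0..<N \<sigma>}"

lemma row_tuple: "x \<in> F \<Longrightarrow> y \<in> F \<Longrightarrow> row \<sigma> k x y \<in> tuples (N \<sigma>) A"
  by (rule restrict_in_tuples) (use F(2) in auto)

text \<open>A coordinate outside both k and l gives x = x', one inside k but outside l gives y = x'.
  The condition x \<noteq> y excludes the constant rows, which belong to all indices.\<close>

lemma row_inj:
  assumes "row \<sigma> k x y = row \<sigma> l x' y'" "k < K" "l < K" "x \<noteq> y"
  shows "k = l"
proof (rule ccontr)
  assume "k \<noteq> l"
  have at: "(if k \<in> ix \<sigma> s then y else x) = (if l \<in> ix \<sigma> s then y' else x')" if "s < N \<sigma>" for s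
    using fun_cong[OF assms(1), of s] that by simp
  obtain s where "s < N \<sigma>" "k \<notin> ix \<sigma> s \<and> l \<notin> ix \<sigma> s" using out[OF assms(2,3)] by blast
  with at[of s] have "x = x'" by simp
  moreover obtain s where "s < N \<sigma>" "k \<in> ix \<sigma> s \<and> l \<notin> ix \<sigma> s"
    using sep[OF assms(2,3) \<open>k \<noteq> l\<close>] by blast
  with at[of s] have "y = x'" by simp
  ultimately show False using assms(4) by simp
qed

lemma N_pos: "0 < N \<sigma>"
  using out[of 0 0 \<sigma>] K(1) by auto

definition Q :: "nat set" where
  "Q = (\<Union>\<sigma>. q \<sigma> ` tuples (N \<sigma>) A)"

text \<open>These are the hyperedges of the power, as lists of tuples.\<close>

definition is_rows :: "bool \<Rightarrow> nat \<Rightarrow> (nat \<Rightarrow> nat) list \<Rightarrow> bool" where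
  "is_rows \<sigma> L X \<longleftrightarrow> length X = 2 ^ L + m L \<and> set X \<subseteq> tuples (N \<sigma>) A \<and>
     (\<forall>s<N \<sigma>. hyp M L (map (\<lambda>u. u s) X))"

definition edges :: "nat \<Rightarrow> nat set \<Rightarrow> nat list set" where
  "edges L Z = {map (q \<sigma>) X | \<sigma> X. is_rows \<sigma> L X \<and> set (drop (2 ^ L) (map (q \<sigma>) X)) = Z}"

text \<open>The filters generated by the images of the hyperedges of both powers, each edge counting
  1. Their consistency is the content of \<open>edges_consistent\<close>.\<close>

definition glued :: "nat \<Rightarrow> nat set \<Rightarrow> (nat \<times> nat set set) set" where
  "glued L Z = (if ctx L Q Z then {(k, V). k \<le> L \<and> adm L Q k V \<and>
     (\<exists>E. finite E \<and> E \<subseteq> edges L Z \<and> card E \<le> k \<and> (\<Inter>t\<in>E. Vc L (\<lambda>b. t ! b)) \<subseteq> V)} else {})"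

text \<open>If \<pi> acts on each edge as a coordinate projection, it sends the edges to hyperedges
  of A in one context. These have a common satisfying labelling, and its preimage under \<pi>
  satisfies all of E.\<close>

lemma projectable_consistent:
  assumes E: "finite E" "card E \<le> L"
    and \<pi>: "\<And>t. t \<in> E \<Longrightarrow> \<exists>\<sigma> X s. t = map (q \<sigma>) X \<and> is_rows \<sigma> L X \<and> set (drop (2 ^ L) t) = Z \<and>
      s < N \<sigma> \<and> (\<forall>u\<in>set X. \<pi> (q \<sigma> u) = u s)"
  shows "(\<Inter>t\<in>E. Vc L (\<lambda>b. t ! b)) \<noteq> {}"
proof (cases "E = {}")
  case False
  have mem: "(1, push \<pi> (Vc L (\<lambda>b. t ! b))) \<in> M L (\<pi> ` Z)" if t: "t \<in> E" for t
  proof -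
    obtain \<sigma> X s where X: "t = map (q \<sigma>) X" "is_rows \<sigma> L X" "set (drop (2 ^ L) t) = Z" "s < N \<sigma>"
      "\<forall>u\<in>set X. \<pi> (q \<sigma> u) = u s" using \<pi>[OF t] by blast
    have m: "map (\<lambda>u. u s) X = map \<pi> t" using X(1,5) by simp
    have len: "length t = 2 ^ L + m L" using X(1,2) by (simp add: is_rows_def)
    have "hyp M L (map \<pi> t)" using X(2,4) unfolding is_rows_def m[symmetric] by blast
    then have "(1, Vc L (\<lambda>b. map \<pi> t ! b)) \<in> M L (set (drop (2 ^ L) (map \<pi> t)))"
      by (simp add: hyp_def)
    moreover have "set (drop (2 ^ L) (map \<pi> t)) = \<pi> ` Z" using X(3) by (simp add: drop_map)
    moreover have "Vc L (\<lambda>b. map \<pi> t ! b) = push \<pi> (Vc L (\<lambda>b. t ! b))"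
      unfolding push_Vc by (rule Vc_cong) (use len in simp)
    ultimately show ?thesis by simp
  qed
  from False obtain t0 where "t0 \<in> E" by blast
  from mem[OF this] have S: "sys L A (M L (\<pi> ` Z))"
    using goodD[OF good_AM] good_ctx[OF good_AM] by blast
  have "(card E, \<Inter>t\<in>E. push \<pi> (Vc L (\<lambda>b. t ! b))) \<in> M L (\<pi> ` Z)"
    by (rule sys_Inter[OF S E(1) mem E(2)])
  then have "(\<Inter>t\<in>E. push \<pi> (Vc L (\<lambda>b. t ! b))) \<noteq> {}" using sysD(3)[OF S, of "card E"] by auto
  then obtain \<theta> where "\<theta> \<in> (\<Inter>t\<in>E. push \<pi> (Vc L (\<lambda>b. t ! b)))" by blast
  then have "\<pi> -` \<theta> \<in> (\<Inter>t\<in>E. Vc L (\<lambda>b. t ! b))" by (simp add: push_def)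
  then show ?thesis by blast
qed simp

text \<open>Pigeonhole: by \<open>row_inj\<close>, non-constant rows of different indices are
  different, so fewer than K elements must miss all those of some index.\<close>

lemma unused_index:
  assumes W: "finite W" "card W < K"
  obtains k0 where "k0 < K" "\<And>x y. x \<in> F \<Longrightarrow> y \<in> F \<Longrightarrow> x \<noteq> y \<Longrightarrow> q True (row True k0 x y) \<notin> W"
proof (rule ccontr)
  assume "\<not> thesis"
  then have "\<forall>k\<in>{..<K}. \<exists>w. \<exists>x\<in>F. \<exists>y\<in>F. x \<noteq> y \<and> w = q True (row True k x y) \<and> w \<in> W"
    using that by blast
  from bchoice[OF this] obtain w where
    w: "\<forall>k\<in>{..<K}. \<exists>x\<in>F. \<exists>y\<in>F. x \<noteq> y \<and> w k = q True (row True k x y) \<and> w k \<in> W" by blast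
  have "inj_on w {..<K}"
  proof (rule inj_onI)
    fix k l assume kl: "k \<in> {..<K}" "l \<in> {..<K}" "w k = w l"
    obtain x y where x: "x \<in> F" "y \<in> F" "x \<noteq> y" "w k = q True (row True k x y)" using w kl(1) by blast
    obtain x' y' where y: "x' \<in> F" "y' \<in> F" "w l = q True (row True l x' y')" using w kl(2) by blast
    have "row True k x y = row True l x' y'"
      by (rule inj_onD[OF q_inj _ row_tuple[OF x(1,2)] row_tuple[OF y(1,2)]])
        (use x(4) y(3) kl(3) in simp)
    from row_inj[OF this _ _ x(3)] kl show "k = l" by simp
  qed
  moreover have "w ` {..<K} \<subseteq> W" using w by blast
  ultimately have "card {..<K} \<le> card W" using W(1) by (rule card_inj_on_le)
  then show False using W(2) by simp
qed

text \<open>Each element of a context shared by both powers is an identified tuple, so its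
  coordinate 0 lies in F. These coordinates are distinct because they list a context of A.\<close>

lemma mixed_edges:
  assumes X: "is_rows True L X" and Y: "is_rows False L Y"
    and eq: "set (drop (2 ^ L) (map (q True) X)) = set (drop (2 ^ L) (map (q False) Y))"
  shows "m L \<le> card F"
proof -
  let ?d = "drop (2 ^ L) (map (\<lambda>u. u 0) X)"
  have h: "hyp M L (map (\<lambda>u. u 0) X)" using X N_pos by (simp add: is_rows_def)
  then have dist: "distinct ?d" by (simp add: hyp_def)
  have len: "length ?d = m L" using X by (simp add: is_rows_def)
  have "set ?d \<subseteq> F"
  proof
    fix z assume "z \<in> set ?d"
    then obtain u where u: "u \<in> set (drop (2 ^ L) X)" "z = u 0" by (auto simp: drop_map)
    have "q True u \<in> set (drop (2 ^ L) (map (q False) Y))"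
      unfolding eq[symmetric] using u(1) by (simp add: drop_map)
    then obtain v where v: "v \<in> set (drop (2 ^ L) Y)" "q True u = q False v" by (auto simp: drop_map)
    have "u \<in> tuples (N True) A" using X in_set_dropD[OF u(1)] by (auto simp: is_rows_def)
    moreover have "v \<in> tuples (N False) A" using Y in_set_dropD[OF v(1)] by (auto simp: is_rows_def)
    ultimately obtain k x y where "x \<in> F" "y \<in> F" "u = row True k x y"
      using q_glue v(2) by blast
    then show "z \<in> F" using u(2) N_pos[of True] by simp
  qed
  then have "card (set ?d) \<le> card F" using F(1) by (rule card_mono[rotated])
  then show ?thesis using distinct_card[OF dist] len by simp
qed

lemma edges_consistent:
  assumes E: "finite E" "E \<subseteq> edges L Z" "card E \<le> L"
  shows "(\<Inter>t\<in>E. Vc L (\<lambda>b. t ! b)) \<noteq> {}"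
proof -
  have edge: "\<exists>\<sigma> X. t = map (q \<sigma>) X \<and> is_rows \<sigma> L X \<and> set (drop (2 ^ L) t) = Z" if "t \<in> E" for t
    using E(2) that unfolding edges_def by blast
  define side where "side \<sigma> t \<longleftrightarrow> (\<exists>X. t = map (q \<sigma>) X \<and> is_rows \<sigma> L X \<and> set (drop (2 ^ L) t) = Z)"
    for \<sigma> t
  have side: "side True t \<or> side False t" if "t \<in> E" for t
    using edge[OF that] unfolding side_def by (metis (full_types))
  have tup: "u \<in> tuples (N \<sigma>) A" if "is_rows \<sigma> L X" "u \<in> set X" for \<sigma> X u
    using that by (auto simp: is_rows_def)
  define inv where "inv \<sigma> = inv_into (tuples (N \<sigma>) A) (q \<sigma>)" for \<sigma>
  have inv: "inv \<sigma> (q \<sigma> u) = u" if "u \<in> tuples (N \<sigma>) A" for \<sigma> u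
    unfolding inv_def by (rule inv_into_f_f[OF q_inj that])
  show ?thesis
  proof (cases "\<exists>\<sigma>. \<forall>t\<in>E. side \<sigma> t")
    case True
    then obtain \<sigma> where \<sigma>: "\<And>t. t \<in> E \<Longrightarrow> side \<sigma> t" by blast
    show ?thesis
    proof (rule projectable_consistent[OF E(1,3), where \<pi> = "\<lambda>w. inv \<sigma> w 0" and Z = Z])
      fix t assume "t \<in> E"
      then obtain X where X: "t = map (q \<sigma>) X" "is_rows \<sigma> L X" "set (drop (2 ^ L) t) = Z"
        using \<sigma> unfolding side_def by blast
      moreover have "\<forall>u\<in>set X. inv \<sigma> (q \<sigma> u) 0 = u 0" using inv tup[OF X(2)] by simp
      ultimately show "\<exists>\<sigma>' X s. t = map (q \<sigma>') X \<and> is_rows \<sigma>' L X \<and> set (drop (2 ^ L) t) = Z \<and>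
        s < N \<sigma>' \<and> (\<forall>u\<in>set X. inv \<sigma> (q \<sigma>' u) 0 = u s)" using N_pos by blast
    qed
  next
    case False
    then obtain t1 t2 where t: "t1 \<in> E" "\<not> side False t1" "t2 \<in> E" "\<not> side True t2" by blast
    then have "side True t1" "side False t2" using side by blast+
    then obtain X1 X2 where "is_rows True L X1" "is_rows False L X2"
      "set (drop (2 ^ L) (map (q True) X1)) = Z" "set (drop (2 ^ L) (map (q False) X2)) = Z"
      unfolding side_def by blast
    then have small: "m L \<le> card F" using mixed_edges by metis
    define W where "W = Z \<union> (\<Union>t\<in>E. set (take (2 ^ L) t))"
    have len: "length t = 2 ^ L + m L" if "t \<in> E" for t
      using edge[OF that] by (auto simp: is_rows_def)
    have Z: "set (drop (2 ^ L) t) = Z" if "t \<in> E" for t using edge[OF that] by blast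
    have "finite Z" using Z[OF t(1)] by (metis List.finite_set)
    then have finW: "finite W" using E(1) by (simp add: W_def)
    have "card Z \<le> m L" using card_length[of "drop (2 ^ L) t1"] Z[OF t(1)] len[OF t(1)] by simp
    moreover have "card (\<Union>t\<in>E. set (take (2 ^ L) t)) \<le> L * 2 ^ L"
    proof -
      have "card (\<Union>t\<in>E. set (take (2 ^ L) t)) \<le> (\<Sum>t\<in>E. card (set (take (2 ^ L) t)))"
        by (rule card_UN_le[OF E(1)])
      also have "\<dots> \<le> (\<Sum>t\<in>E. 2 ^ L)"
      proof (rule sum_mono)
        fix t assume "t \<in> E"
        show "card (set (take (2 ^ L) t)) \<le> 2 ^ L"
          using card_length[of "take (2 ^ L) t"] by simp
      qed
      also have "\<dots> \<le> L * 2 ^ L" using E(3) by simp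
      finally show ?thesis .
    qed
    ultimately have "card W < K"
      using card_Un_le[of Z "\<Union>t\<in>E. set (take (2 ^ L) t)"] K(2)[OF small] by (simp add: W_def)
    from unused_index[OF finW this] obtain k0 where k0: "k0 < K"
      "\<And>x y. x \<in> F \<Longrightarrow> y \<in> F \<Longrightarrow> x \<noteq> y \<Longrightarrow> q True (row True k0 x y) \<notin> W" by metis
    obtain s0 where s0: "s0 < N True" "ix True s0 = {}" using ix_empty by blast
    obtain s1 where s1: "s1 < N False" "ix False s1 = {k0}" using ix_single[OF k0(1)] by blast
    define \<pi> where "\<pi> w = (if w \<in> q True ` tuples (N True) A then inv True w s0 else inv False w s1)" for w
    have tW: "set t \<subseteq> W" if "t \<in> E" for t
    proof -
      have "set t = set (take (2 ^ L) t) \<union> set (drop (2 ^ L) t)"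
        by (metis append_take_drop_id set_append)
      then show ?thesis using Z[OF that] that by (auto simp: W_def)
    qed
    have \<pi>T: "\<pi> (q True u) = u s0" if "u \<in> tuples (N True) A" for u
      using that inv by (simp add: \<pi>_def)
    have \<pi>F: "\<pi> (q False v) = v s1" if v: "v \<in> tuples (N False) A" and vW: "q False v \<in> W" for v
    proof (cases "q False v \<in> q True ` tuples (N True) A")
      case True
      then obtain u where u: "u \<in> tuples (N True) A" "q True u = q False v" by (metis imageE)
      then obtain k x y where k: "k < K" "x \<in> F" "y \<in> F" "u = row True k x y" "v = row False k x y"
        using q_glue[OF u(1) v] by blast
      have "\<pi> (q False v) = u s0" using \<pi>T[OF u(1)] u(2) by simp
      also have "\<dots> = x" using k(4) s0 by simp
      \<comment> \<open>The coordinate with subset \<open>{k0}\<close> reads y instead of x only for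
        k = k0, and then x = y because no non-constant row of index \<open>k0\<close>
        occurs.\<close>
      also have "x = v s1"
      proof (cases "k = k0 \<and> x \<noteq> y")
        case True
        then show ?thesis using k0(2)[OF k(2,3)] u(2) k(4) vW by simp
      next
        case False
        then show ?thesis using k(5) s1 by auto
      qed
      finally show ?thesis .
    next
      case False
      then show ?thesis using inv[OF v] by (simp add: \<pi>_def)
    qed
    show ?thesis
    proof (rule projectable_consistent[OF E(1,3), where \<pi> = \<pi> and Z = Z])
      fix t assume tE: "t \<in> E"
      from side[OF tE] show "\<exists>\<sigma> X s. t = map (q \<sigma>) X \<and> is_rows \<sigma> L X \<and> set (drop (2 ^ L) t) = Z \<and>
        s < N \<sigma> \<and> (\<forall>u\<in>set X. \<pi> (q \<sigma> u) = u s)"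
      proof
        assume "side True t"
        then obtain X where X: "t = map (q True) X" "is_rows True L X" "set (drop (2 ^ L) t) = Z"
          unfolding side_def by blast
        moreover have "\<forall>u\<in>set X. \<pi> (q True u) = u s0" using \<pi>T tup[OF X(2)] by simp
        ultimately show ?thesis using s0(1) by blast
      next
        assume "side False t"
        then obtain X where X: "t = map (q False) X" "is_rows False L X" "set (drop (2 ^ L) t) = Z"
          unfolding side_def by blast
        moreover have "\<forall>u\<in>set X. \<pi> (q False u) = u s1"
          using \<pi>F tup[OF X(2)] tW[OF tE] X(1) by auto
        ultimately show ?thesis using s1(1) by blast
      qed
    qed
  qed
qed

lemma good_glued: "good Q glued"
  unfolding good_def
proof (intro allI conjI impI)
  fix L Z assume c: "ctx L Q Z"
  have mem: "(k, V) \<in> glued L Z \<longleftrightarrow> k \<le> L \<and> adm L Q k V \<and>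
     (\<exists>E. finite E \<and> E \<subseteq> edges L Z \<and> card E \<le> k \<and> (\<Inter>t\<in>E. Vc L (\<lambda>b. t ! b)) \<subseteq> V)" for k V
    using c by (simp add: glued_def)
  show "sys L Q (glued L Z)" unfolding sys_def
  proof (intro conjI allI impI)
    fix k V assume "(k, V) \<in> glued L Z"
    then obtain E where E: "k \<le> L" "adm L Q k V" "finite E" "E \<subseteq> edges L Z" "card E \<le> k"
      "(\<Inter>t\<in>E. Vc L (\<lambda>b. t ! b)) \<subseteq> V" unfolding mem by blast
    show "k \<le> L" "adm L Q k V" using E by simp_all
    have "card E \<le> L" using E(1,5) by simp
    from edges_consistent[OF E(3,4) this] show "V \<noteq> {}" using E(6) by blast
  next
    show "(0, UNIV) \<in> glued L Z" unfolding mem by (auto intro: exI[of _ "{}"])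
  next
    fix k V k' V'
    assume kV: "(k, V) \<in> glued L Z" and *: "V \<subseteq> V'" "k \<le> k'" "k' \<le> L" "adm L Q k' V'"
    from kV obtain E where E: "finite E" "E \<subseteq> edges L Z" "card E \<le> k"
      "(\<Inter>t\<in>E. Vc L (\<lambda>b. t ! b)) \<subseteq> V" unfolding mem by blast
    have "card E \<le> k'" "(\<Inter>t\<in>E. Vc L (\<lambda>b. t ! b)) \<subseteq> V'" using E(3,4) * by auto
    with E * show "(k', V') \<in> glued L Z" unfolding mem by blast
  next
    fix k V k' V'
    assume kV: "(k, V) \<in> glued L Z" "(k', V') \<in> glued L Z" and le: "k + k' \<le> L"
    from kV(1) obtain E where E: "adm L Q k V" "finite E" "E \<subseteq> edges L Z" "card E \<le> k"
      "(\<Inter>t\<in>E. Vc L (\<lambda>b. t ! b)) \<subseteq> V" unfolding mem by blast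
    from kV(2) obtain E' where E': "adm L Q k' V'" "finite E'" "E' \<subseteq> edges L Z" "card E' \<le> k'"
      "(\<Inter>t\<in>E'. Vc L (\<lambda>b. t ! b)) \<subseteq> V'" unfolding mem by blast
    have "card (E \<union> E') \<le> k + k'" using card_Un_le[of E E'] E(4) E'(4) by linarith
    moreover have "(\<Inter>t\<in>E \<union> E'. Vc L (\<lambda>b. t ! b)) \<subseteq> V \<inter> V'"
      unfolding INF_union using E(5) E'(5) by blast
    moreover have "finite (E \<union> E')" "E \<union> E' \<subseteq> edges L Z" using E(2,3) E'(2,3) by auto
    ultimately show "(k + k', V \<inter> V') \<in> glued L Z"
      unfolding mem using adm_Int[OF E(1) E'(1)] le by blast
  qed
qed (simp add: glued_def)

text \<open>This makes \<open>q \<sigma>\<close> a homomorphism from the power to the glued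
  structure. Tuples of points have an even entry and are coded by points; tuples of context elements
  have only odd entries and are coded by context elements.\<close>

lemma hyp_glued:
  assumes X: "is_rows \<sigma> L X"
  shows "hyp glued L (map (q \<sigma>) X)"
proof -
  let ?t = "map (q \<sigma>) X" and ?d = "drop (2 ^ L) X"
  have len: "length X = 2 ^ L + m L" and tup: "set X \<subseteq> tuples (N \<sigma>) A"
    and h: "\<And>s. s < N \<sigma> \<Longrightarrow> hyp M L (map (\<lambda>u. u s) X)"
    using X by (auto simp: is_rows_def)
  have h0: "hyp M L (map (\<lambda>u. u 0) X)" by (rule h[OF N_pos])
  have "(1, Vc L (\<lambda>b. map (\<lambda>u. u 0) X ! b)) \<in> M L (set (drop (2 ^ L) (map (\<lambda>u. u 0) X)))"
    using h0 by (simp add: hyp_def)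
  \<comment> \<open>Level 0 has no hyperedges, since their grade 1 must not exceed the
    level.\<close>
  then have L: "1 \<le> L"
    using sysD(1)[OF goodD[OF good_AM good_ctx[OF good_AM]]] by blast
  have ev: "even (?t ! b) \<and> ?t ! b \<in> Q" if b: "b < 2 ^ L" for b
  proof -
    have u: "X ! b \<in> tuples (N \<sigma>) A" using tup len b by auto
    have "even (map (\<lambda>u. u 0) X ! b)" using h0 b unfolding hyp_def by blast
    then have "even ((X ! b) 0)" using len b by simp
    then have "\<not> odd (q \<sigma> (X ! b))" using q_par[OF u] N_pos[of \<sigma>] by blast
    then show ?thesis using u len b by (auto simp: Q_def)
  qed
  have tupd: "set ?d \<subseteq> tuples (N \<sigma>) A" using tup set_drop_subset[of "2 ^ L" X] by blast
  have od: "odd (q \<sigma> u)" if u: "u \<in> set ?d" for u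
  proof -
    have "odd (u s)" if "s < N \<sigma>" for s using h[OF that] u by (simp add: hyp_def drop_map)
    then show ?thesis using q_par tupd u by blast
  qed
  have "distinct (map (\<lambda>u. u 0) ?d)" using h0 by (simp add: hyp_def drop_map)
  then have "distinct ?d" by (simp add: distinct_map)
  then have dist: "distinct (map (q \<sigma>) ?d)"
    using inj_on_subset[OF q_inj tupd] by (simp add: distinct_map)
  have c: "ctx L Q (set (map (q \<sigma>) ?d))"
    using distinct_card[OF dist] od tupd len by (auto simp: ctx_def Q_def)
  have "?t \<in> edges L (set (map (q \<sigma>) ?d))" unfolding edges_def using X by (auto simp: drop_map)
  then have "(1, Vc L (\<lambda>b. ?t ! b)) \<in> glued L (set (map (q \<sigma>) ?d))"
    using c L adm_Vc[OF ev] by (auto simp: glued_def intro!: exI[of _ "{?t}"])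
  then show ?thesis
    unfolding hyp_def using len ev dist od by (simp add: drop_map)
qed

text \<open>Composing \<open>q \<sigma>\<close> with an embedding of the glued structure into A
  gives the polymorphisms; the identities hold because their arguments have been identified.\<close>

lemma identities:
  "\<exists>f. (\<forall>\<sigma>. f \<sigma> \<in> Pol A (rels A M) (N \<sigma>)) \<and>
    (\<forall>k<K. \<forall>x\<in>F. \<forall>y\<in>F. f True (row True k x y) = f False (row False k x y))"
proof -
  from embedding[OF good_glued] obtain \<iota> where \<iota>: "\<iota> ` Q \<subseteq> A"
    "\<And>D. finite D \<Longrightarrow> D \<subseteq> Q \<Longrightarrow> emb \<iota> D glued M" by metis
  define f where "f \<sigma> = restrict (\<lambda>u. \<iota> (q \<sigma> u)) (tuples (N \<sigma>) A)" for \<sigma>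
  have val: "\<iota> (q \<sigma> u) \<in> A" if "u \<in> tuples (N \<sigma>) A" for \<sigma> u
    using \<iota>(1) that by (auto simp: Q_def)
  have "f \<sigma> \<in> Pol A (rels A M) (N \<sigma>)" for \<sigma>
    unfolding Pol_def
  proof (intro CollectI conjI ballI)
    show "is_op A (N \<sigma>) (f \<sigma>)"
      unfolding is_op_def f_def by (rule restrict_PiE_iff[THEN iffD2]) (use val in blast)
    fix R assume "R \<in> rels A M"
    then obtain L where R: "R = (2 ^ L + m L, {t. set t \<subseteq> A \<and> hyp M L t})" by (auto simp: rels_def)
    let ?l = "2 ^ L + m L"
    show "preserves (N \<sigma>) (f \<sigma>) R"
      unfolding preserves_def R prod.case
    proof (intro allI impI)
      fix x assume x: "\<forall>i<N \<sigma>. x i \<in> {t. set t \<subseteq> A \<and> hyp M L t}"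
      define X where "X = map (\<lambda>j. restrict (\<lambda>i. x i ! j) {0..<N \<sigma>}) [0..<?l]"
      have lenx: "length (x i) = ?l" "set (x i) \<subseteq> A" "hyp M L (x i)" if "i < N \<sigma>" for i
        using x that by (auto simp: hyp_def)
      have tup: "set X \<subseteq> tuples (N \<sigma>) A"
      proof
        fix u assume "u \<in> set X"
        then obtain j where j: "j < ?l" "u = restrict (\<lambda>i. x i ! j) {0..<N \<sigma>}" by (auto simp: X_def)
        have "x i ! j \<in> A" if "i < N \<sigma>" for i
          using lenx[OF that] nth_mem[of j "x i"] j(1) by auto
        then show "u \<in> tuples (N \<sigma>) A" unfolding j(2) by (rule restrict_in_tuples)
      qed
      have "map (\<lambda>u. u s) X = x s" if "s < N \<sigma>" for s
        by (rule nth_equalityI) (use lenx[OF that] that in \<open>simp_all add: X_def\<close>)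
      then have rows: "is_rows \<sigma> L X" unfolding is_rows_def using tup lenx(3) by (simp add: X_def)
      let ?t = "map (q \<sigma>) X"
      have tQ: "set ?t \<subseteq> Q" using tup by (auto simp: Q_def)
      have "hyp M L (map \<iota> ?t)"
        using hyp_emb[OF \<iota>(2)[OF _ tQ] order_refl] hyp_glued[OF rows] by simp
      moreover have "set (map \<iota> ?t) \<subseteq> A" using tQ \<iota>(1) by auto
      moreover have eq: "map (\<lambda>j. f \<sigma> (restrict (\<lambda>i. x i ! j) {0..<N \<sigma>})) [0..<?l] = map \<iota> ?t"
      proof -
        have "map (\<lambda>j. f \<sigma> (restrict (\<lambda>i. x i ! j) {0..<N \<sigma>})) [0..<?l] = map (f \<sigma>) X"
          by (simp add: X_def)
        also have "\<dots> = map (\<lambda>u. \<iota> (q \<sigma> u)) X"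
          by (rule map_cong[OF refl]) (use tup in \<open>auto simp: f_def\<close>)
        finally show ?thesis by simp
      qed
      ultimately show "map (\<lambda>j. f \<sigma> (restrict (\<lambda>i. x i ! j) {0..<N \<sigma>})) [0..<?l] \<in> {t. set t \<subseteq> A \<and> hyp M L t}"
        unfolding eq by blast
    qed
  qed
  moreover have "f True (row True k x y) = f False (row False k x y)" if "k < K" "x \<in> F" "y \<in> F" for k x y
  proof -
    have t: "row True k x y \<in> tuples (N True) A" "row False k x y \<in> tuples (N False) A"
      using row_tuple[OF that(2,3)] by blast+
    have "q True (row True k x y) = q False (row False k x y)"
      using q_glue[OF t] that by blast
    then show ?thesis using t by (simp add: f_def)
  qed
  ultimately show ?thesis by blast
qed

end

section \<open>Coding two glued sets by natural numbers\<close>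

lemma glue_code:
  fixes U V :: "'a set" and G :: "'a \<Rightarrow> 'a \<Rightarrow> bool" and P :: "bool \<Rightarrow> 'a \<Rightarrow> bool"
  assumes cU: "countable U" and cV: "countable V"
    and GU: "\<And>u v. G u v \<Longrightarrow> u \<in> U"
    and G1: "\<And>u u' v. G u v \<Longrightarrow> G u' v \<Longrightarrow> u = u'" and G2: "\<And>u v v'. G u v \<Longrightarrow> G u v' \<Longrightarrow> v = v'"
    and P: "\<And>u v. G u v \<Longrightarrow> P True u = P False v"
  shows "\<exists>q :: bool \<Rightarrow> 'a \<Rightarrow> nat. inj_on (q True) U \<and> inj_on (q False) V \<and>
    (\<forall>u\<in>U. \<forall>v\<in>V. q True u = q False v \<longleftrightarrow> G u v) \<and>
    (\<forall>u\<in>U. odd (q True u) = P True u) \<and> (\<forall>v\<in>V. odd (q False v) = P False v)"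
proof -
  define X where "X = Pair True ` U \<union> Pair False ` V"
  have "countable X" using cU cV by (simp add: X_def)
  then have inj: "inj_on (to_nat_on X) X" by (rule inj_on_to_nat_on)
  \<comment> \<open>The last bit carries the parity, the remaining bits number the disjoint
    union.\<close>
  define code where "code p = 2 * to_nat_on X p + (if P (fst p) (snd p) then 1 else 0)" for p
  have code_half: "code p div 2 = to_nat_on X p" for p by (simp add: code_def)
  have code_odd: "odd (code p) = P (fst p) (snd p)" for p by (simp add: code_def)
  have code_inj: "p = p'" if "code p = code p'" "p \<in> X" "p' \<in> X" for p p'
    using inj_onD[OF inj _ that(2,3)] arg_cong[OF that(1), of "\<lambda>n. n div 2"] by (simp add: code_half)
  \<comment> \<open>G is a partial bijection, so an element of V that is identified with some
    element of U can take over the code of this unique partner.\<close>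
  define rep where "rep v = (if \<exists>u. G u v then (True, THE u. G u v) else (False, v))" for v
  have rep1: "rep v = (True, u)" if "G u v" for u v
  proof -
    have "(THE u. G u v) = u" by (rule the_equality[of "\<lambda>u. G u v"]) (use that G1 in auto)
    then show ?thesis using that by (auto simp: rep_def)
  qed
  have rep2: "rep v = (False, v)" if "\<nexists>u. G u v" for v using that by (simp add: rep_def)
  have repX: "rep v \<in> X" if "v \<in> V" for v
  proof (cases "\<exists>u. G u v")
    case True
    then show ?thesis using rep1 GU by (force simp: X_def)
  next
    case False
    then show ?thesis using rep2 that by (simp add: X_def)
  qed
  have UX: "(True, u) \<in> X" if "u \<in> U" for u using that by (simp add: X_def)
  define q where "q \<sigma> v = (if \<sigma> then code (True, v) else code (rep v))" for \<sigma> v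
  have "inj_on (q True) U"
    by (rule inj_onI) (use code_inj UX in \<open>force simp: q_def\<close>)
  moreover have "inj_on (q False) V"
  proof (rule inj_onI)
    fix v v' assume v: "v \<in> V" "v' \<in> V" "q False v = q False v'"
    then have eq: "rep v = rep v'" using code_inj[OF _ repX repX] by (simp add: q_def)
    show "v = v'"
    proof (cases "\<exists>u. G u v")
      case True
      then obtain u where u: "G u v" by blast
      then have "rep v' = (True, u)" using rep1 eq by simp
      then obtain u' where u': "G u' v'" using rep2[of v'] by auto
      then have "u' = u" using rep1[OF u'] \<open>rep v' = (True, u)\<close> by simp
      then show ?thesis using G2 u u' by blast
    next
      case False
      then have e: "rep v' = (False, v)" using rep2 eq by simp
      then have "\<nexists>u. G u v'" using rep1[of _ v'] by force
      then show ?thesis using rep2[of v'] e by simp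
    qed
  qed
  moreover have "q True u = q False v \<longleftrightarrow> G u v" if "u \<in> U" "v \<in> V" for u v
  proof
    assume "q True u = q False v"
    then have "code (True, u) = code (rep v)" by (simp add: q_def)
    from code_inj[OF this UX[OF that(1)] repX[OF that(2)]] have e: "rep v = (True, u)" by simp
    then obtain u' where u': "G u' v" using rep2[of v] by auto
    then show "G u v" using rep1[OF u'] e by simp
  next
    assume "G u v"
    then show "q True u = q False v" using rep1 by (simp add: q_def)
  qed
  moreover have "odd (q True u) = P True u" for u by (simp add: q_def code_odd)
  moreover have "odd (q False v) = P False v" for v
  proof (cases "\<exists>u. G u v")
    case True
    then obtain u where u: "G u v" by blast
    then show ?thesis using rep1[OF u] P[OF u] by (simp add: q_def code_odd)
  next
    case False
    then show ?thesis using rep2 by (simp add: q_def code_odd)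
  qed
  ultimately show ?thesis by (intro exI[of _ q]) simp
qed

text \<open>A spare index corrects the parity of a subset without touching k and l. This is why the
  families below are taken with K at least 3.\<close>

lemma third_index: "\<exists>j\<le>2. j \<noteq> k \<and> j \<noteq> (l :: nat)"
proof -
  have "\<not> {..2} \<subseteq> {k, l}"
    using card_mono[of "{k, l}" "{..2}"] card_insert_le_m1[of 2 "{l}" k] by auto
  then show ?thesis by auto
qed

definition parity_family :: "nat \<Rightarrow> bool \<Rightarrow> nat set set" where
  "parity_family K \<sigma> = {c. c \<subseteq> {..<K} \<and> even (card c) = \<sigma>}"

lemma parity_family_out:
  assumes "3 \<le> K"
  shows "\<exists>c\<in>parity_family K \<sigma>. k \<notin> c \<and> l \<notin> c"
proof (cases \<sigma>)
  case True
  then show ?thesis by (intro bexI[of _ "{}"]) (simp_all add: parity_family_def)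
next
  case False
  obtain j where "j \<le> 2" "j \<noteq> k" "j \<noteq> l" using third_index by blast
  then show ?thesis
    using False assms by (intro bexI[of _ "{j}"]) (simp_all add: parity_family_def)
qed

lemma parity_family_sep:
  assumes "3 \<le> K" "k < K" "k \<noteq> l"
  shows "\<exists>c\<in>parity_family K \<sigma>. k \<in> c \<and> l \<notin> c"
proof (cases \<sigma>)
  case False
  then show ?thesis
    using assms by (intro bexI[of _ "{k}"]) (simp_all add: parity_family_def)
next
  case True
  obtain j where "j \<le> 2" "j \<noteq> k" "j \<noteq> l" using third_index by blast
  then show ?thesis
    using True assms by (intro bexI[of _ "{k, j}"]) (simp_all add: parity_family_def)
qed

context generic
begin

lemma local_identities:
  assumes F: "finite F" "F \<subseteq> A"
  obtains K :: nat and N :: "bool \<Rightarrow> nat" and ix :: "bool \<Rightarrow> nat \<Rightarrow> nat set" and f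
  where "\<And>\<sigma>. 1 \<le> N \<sigma>" "\<And>\<sigma>. f \<sigma> \<in> Pol A (rels A M) (N \<sigma>)"
    "\<And>i j. i < N True \<Longrightarrow> j < N False \<Longrightarrow> \<exists>k<K. k \<in> ix True i \<longleftrightarrow> k \<notin> ix False j"
    "\<And>k x y. k < K \<Longrightarrow> x \<in> F \<Longrightarrow> y \<in> F \<Longrightarrow>
      f True (restrict (\<lambda>s. if k \<in> ix True s then y else x) {0..<N True}) =
      f False (restrict (\<lambda>s. if k \<in> ix False s then y else x) {0..<N False})"
proof -
  \<comment> \<open>Levels with \<open>m L \<le> card F\<close> satisfy
    \<open>L \<le> card F\<close>, so this K is large enough for all of them at once; the summand 3
    provides spare indices.\<close>
  define K where "K = card F * 2 ^ card F + card F + 3"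
  have K3: "3 \<le> K" by (simp add: K_def)
  have Kbig: "L * 2 ^ L + m L < K" if "m L \<le> card F" for L
  proof -
    have "L \<le> card F" using that m_gt[of L] by simp
    then have "L * 2 ^ L \<le> card F * 2 ^ card F" by (intro mult_le_mono power_increasing) simp_all
    then show ?thesis using that by (simp add: K_def)
  qed
  define N where "N \<sigma> = card (parity_family K \<sigma>)" for \<sigma>
  have "finite (parity_family K \<sigma>)" for \<sigma>
    by (rule finite_subset[of _ "Pow {..<K}"]) (auto simp: parity_family_def)
  then have "\<forall>\<sigma>. \<exists>h. bij_betw h {0..<N \<sigma>} (parity_family K \<sigma>)"
    unfolding N_def using ex_bij_betw_nat_finite by blast
  from choice[OF this] obtain ix where
    "\<forall>\<sigma>. bij_betw (ix \<sigma>) {0..<N \<sigma>} (parity_family K \<sigma>)" by blast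
  then have ix: "ix \<sigma> ` {0..<N \<sigma>} = parity_family K \<sigma>" for \<sigma> by (simp add: bij_betw_def)
  have ixE: "\<exists>s<N \<sigma>. ix \<sigma> s = c" if "c \<in> parity_family K \<sigma>" for \<sigma> c
    using that unfolding ix[symmetric] by auto
  have out: "\<exists>s<N \<sigma>. k \<notin> ix \<sigma> s \<and> l \<notin> ix \<sigma> s" for k l \<sigma>
    using parity_family_out[OF K3, of \<sigma> k l] ixE by blast
  have sep: "\<exists>s<N \<sigma>. k \<in> ix \<sigma> s \<and> l \<notin> ix \<sigma> s" if "k < K" "k \<noteq> l" for k l \<sigma>
    using parity_family_sep[OF K3 that, of \<sigma>] ixE by blast
  let ?row = "\<lambda>\<sigma> k x y. restrict (\<lambda>s. if k \<in> ix \<sigma> s then y else x) {0..<N \<sigma>}"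
  \<comment> \<open>Needed for the gluing relation to be a partial bijection: equal rows on one side
    force equal rows on the other. For different indices this happens only if all four values
    coincide.\<close>
  have row_eq: "?row \<tau> k x y = ?row \<tau> l x' y'"
    if e: "?row \<sigma> k x y = ?row \<sigma> l x' y'" and k: "k < K" "l < K" for \<sigma> \<tau> k l x y x' y'
  proof -
    have at: "(if k \<in> ix \<sigma> s then y else x) = (if l \<in> ix \<sigma> s then y' else x')" if "s < N \<sigma>" for s
      using fun_cong[OF e, of s] that by simp
    obtain s where "s < N \<sigma>" "k \<notin> ix \<sigma> s" "l \<notin> ix \<sigma> s" using out by blast
    with at[of s] have x: "x = x'" by simp
    show ?thesis
    proof (cases "k = l")
      case True
      obtain k' where "k' \<noteq> k" by (metis n_not_Suc_n)
      then obtain s where "s < N \<sigma>" "k \<in> ix \<sigma> s" using sep[OF k(1)] by metis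
      with at[of s] True have y: "y = y'" by simp
      show ?thesis unfolding x y True ..
    next
      case False
      obtain s where s: "s < N \<sigma>" "k \<in> ix \<sigma> s" "l \<notin> ix \<sigma> s" using sep[OF k(1) False] by blast
      obtain s' where s': "s' < N \<sigma>" "l \<in> ix \<sigma> s'" "k \<notin> ix \<sigma> s'" using sep[OF k(2)] False by metis
      have "y = x'" "x = y'" using at[OF s(1)] at[OF s'(1)] s s' by simp_all
      then have eq: "y' = x" "y = x" "x' = x" using x by simp_all
      show ?thesis unfolding eq if_cancel ..
    qed
  qed
  have all_odd: "(\<forall>s<N \<sigma>. odd (?row \<sigma> k x y s)) \<longleftrightarrow> odd x \<and> odd y" if k: "k < K" for \<sigma> k x y
  proof -
    obtain s where s: "s < N \<sigma>" "k \<notin> ix \<sigma> s" using out by blast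
    obtain k' where "k' \<noteq> k" by (metis n_not_Suc_n)
    then obtain s' where s': "s' < N \<sigma>" "k \<in> ix \<sigma> s'" using sep[OF k] by metis
    show ?thesis
    proof
      assume *: "\<forall>s<N \<sigma>. odd (?row \<sigma> k x y s)"
      show "odd x \<and> odd y"
        using *[rule_format, OF s(1)] *[rule_format, OF s'(1)] s s' by simp
    qed simp
  qed
  let ?G = "\<lambda>u v. \<exists>k<K. \<exists>x\<in>F. \<exists>y\<in>F. u = ?row True k x y \<and> v = ?row False k x y"
  let ?P = "\<lambda>\<sigma> u. \<forall>s<N \<sigma>. odd (u s)"
  have "\<exists>q :: bool \<Rightarrow> (nat \<Rightarrow> nat) \<Rightarrow> nat. inj_on (q True) (tuples (N True) A) \<and>
    inj_on (q False) (tuples (N False) A) \<and>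
    (\<forall>u\<in>tuples (N True) A. \<forall>v\<in>tuples (N False) A. q True u = q False v \<longleftrightarrow> ?G u v) \<and>
    (\<forall>u\<in>tuples (N True) A. odd (q True u) = ?P True u) \<and>
    (\<forall>v\<in>tuples (N False) A. odd (q False v) = ?P False v)"
  proof (rule glue_code)
    have "countable (tuples n A)" for n
      unfolding tuples_def by (rule countable_PiE) simp_all
    then show "countable (tuples (N True) A)" "countable (tuples (N False) A)" by blast+
    show "u \<in> tuples (N True) A" if G: "?G u v" for u v
    proof -
      obtain k x y where "x \<in> F" "y \<in> F" "u = ?row True k x y" using G by blast
      then show ?thesis using F(2) by (auto intro!: restrict_in_tuples)
    qed
    show "u = u'" if G: "?G u v" "?G u' v" for u u' v
    proof -
      obtain k x y where 1: "k < K" "u = ?row True k x y" "v = ?row False k x y" using G(1) by blast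
      obtain l x' y' where 2: "l < K" "u' = ?row True l x' y'" "v = ?row False l x' y'" using G(2) by blast
      show ?thesis unfolding 1(2) 2(2) by (rule row_eq[OF trans[OF 1(3)[symmetric] 2(3)] 1(1) 2(1)])
    qed
    show "v = v'" if G: "?G u v" "?G u v'" for u v v'
    proof -
      obtain k x y where 1: "k < K" "u = ?row True k x y" "v = ?row False k x y" using G(1) by blast
      obtain l x' y' where 2: "l < K" "u = ?row True l x' y'" "v' = ?row False l x' y'" using G(2) by blast
      show ?thesis unfolding 1(3) 2(3) by (rule row_eq[OF trans[OF 1(2)[symmetric] 2(2)] 1(1) 2(1)])
    qed
    show "?P True u = ?P False v" if G: "?G u v" for u v
    proof -
      obtain k x y where 1: "k < K" "u = ?row True k x y" "v = ?row False k x y" using G by blast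
      show ?thesis unfolding 1(2,3) all_odd[OF 1(1)] ..
    qed
  qed
  then obtain q :: "bool \<Rightarrow> (nat \<Rightarrow> nat) \<Rightarrow> nat" where q: "inj_on (q True) (tuples (N True) A)"
    "inj_on (q False) (tuples (N False) A)"
    "\<forall>u\<in>tuples (N True) A. \<forall>v\<in>tuples (N False) A. q True u = q False v \<longleftrightarrow> ?G u v"
    "\<forall>u\<in>tuples (N True) A. odd (q True u) = ?P True u"
    "\<forall>v\<in>tuples (N False) A. odd (q False v) = ?P False v" by blast
  interpret g: gluing m A M F K N ix q
  proof unfold_locales
    show "finite F" "F \<subseteq> A" by (rule F)+
    show "2 \<le> K" using K3 by simp
    show "m L \<le> card F \<Longrightarrow> L * 2 ^ L + m L < K" for L by (rule Kbig)
    show "\<exists>s<N \<sigma>. k \<notin> ix \<sigma> s \<and> l \<notin> ix \<sigma> s" for k l \<sigma> by (rule out)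
    show "k < K \<Longrightarrow> k \<noteq> l \<Longrightarrow> \<exists>s<N \<sigma>. k \<in> ix \<sigma> s \<and> l \<notin> ix \<sigma> s" for k l \<sigma> by (rule sep)
    show "\<exists>s<N True. ix True s = {}" by (rule ixE) (simp add: parity_family_def)
    show "k < K \<Longrightarrow> \<exists>s<N False. ix False s = {k}" for k
      by (rule ixE) (simp add: parity_family_def)
    show "inj_on (q \<sigma>) (tuples (N \<sigma>) A)" for \<sigma> using q(1,2) by (cases \<sigma>) simp_all
    show "u \<in> tuples (N True) A \<Longrightarrow> v \<in> tuples (N False) A \<Longrightarrow> q True u = q False v \<longleftrightarrow> ?G u v"
      for u v using q(3) by blast
    show "u \<in> tuples (N \<sigma>) A \<Longrightarrow> odd (q \<sigma> u) \<longleftrightarrow> (\<forall>s<N \<sigma>. odd (u s))" for u \<sigma>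
      using q(4,5) by (cases \<sigma>) simp_all
  qed
  obtain f where f: "\<And>\<sigma>. f \<sigma> \<in> Pol A (rels A M) (N \<sigma>)"
    "\<And>k x y. k < K \<Longrightarrow> x \<in> F \<Longrightarrow> y \<in> F \<Longrightarrow> f True (?row True k x y) = f False (?row False k x y)"
    using g.identities by blast
  show thesis
  proof (rule that[of N f K ix])
    show "1 \<le> N \<sigma>" for \<sigma> using g.N_pos[of \<sigma>] by simp
    show "f \<sigma> \<in> Pol A (rels A M) (N \<sigma>)" for \<sigma> by (rule f)
    show "\<exists>k<K. k \<in> ix True i \<longleftrightarrow> k \<notin> ix False j" if "i < N True" "j < N False" for i j
    proof (rule ccontr)
      assume "\<nexists>k. k < K \<and> (k \<in> ix True i \<longleftrightarrow> k \<notin> ix False j)"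
      moreover have T: "ix True i \<in> parity_family K True" using ix[of True] that(1) by auto
      moreover have Fa: "ix False j \<in> parity_family K False" using ix[of False] that(2) by auto
      ultimately have "ix True i = ix False j" by (auto simp: parity_family_def)
      then show False using T Fa by (simp add: parity_family_def)
    qed
    show "k < K \<Longrightarrow> x \<in> F \<Longrightarrow> y \<in> F \<Longrightarrow> f True (?row True k x y) = f False (?row False k x y)" for k x y
      by (rule f)
  qed
qed

text \<open>Let F collect the entries of the finite set S given by uniform continuity in arity 2.
  For every k the binary minors of the two functions agree on S and must have the same image, but
  some k separates the even subset from the odd subset attached to the selected coordinates.\<close>

lemma no_uniformly_continuous_minion_hom:
  assumes ne: "A \<noteq> {}"
    and hom: "minion_hom A (Pol A (rels A M)) (UNIV :: bool set) Proj_clone \<xi>"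
    and uc: "unif_continuous A (Pol A (rels A M)) (UNIV :: bool set) \<xi>"
  shows False
proof -
  let ?B = "tuples 2 (UNIV :: bool set)"
  have "finite ?B" unfolding tuples_def by (rule finite_PiE) simp_all
  then have "\<exists>S. finite S \<and> S \<subseteq> tuples 2 A \<and> (\<forall>f\<in>Pol A (rels A M) 2. \<forall>g\<in>Pol A (rels A M) 2.
      (\<forall>x\<in>S. f x = g x) \<longrightarrow> (\<forall>y\<in>?B. \<xi> 2 f y = \<xi> 2 g y))"
    using uc[unfolded unif_continuous_def, THEN spec[of _ 2]] by simp
  then obtain S where S: "finite S" "S \<subseteq> tuples 2 A"
    "\<And>f g y. f \<in> Pol A (rels A M) 2 \<Longrightarrow> g \<in> Pol A (rels A M) 2 \<Longrightarrow> (\<And>x. x \<in> S \<Longrightarrow> f x = g x) \<Longrightarrow>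
      y \<in> ?B \<Longrightarrow> \<xi> 2 f y = \<xi> 2 g y" by metis
  define F where "F = (\<lambda>x. x 0) ` S \<union> (\<lambda>x. x 1) ` S"
  have "x i \<in> A" if x: "x \<in> S" and i: "i < 2" for x i
  proof -
    have "x \<in> {0..<2} \<rightarrow>\<^sub>E A" using S(2) x unfolding tuples_def by blast
    then show ?thesis by (rule PiE_mem) (use i in simp)
  qed
  then have F: "finite F" "F \<subseteq> A" using S(1) by (auto simp: F_def)
  from local_identities[OF F] obtain K :: nat and N :: "bool \<Rightarrow> nat" and ix f
    where N: "\<And>\<sigma>. 1 \<le> N \<sigma>" and f: "\<And>\<sigma>. f \<sigma> \<in> Pol A (rels A M) (N \<sigma>)"
      and ix: "\<And>i j. i < N True \<Longrightarrow> j < N False \<Longrightarrow> \<exists>k<K. k \<in> ix True i \<longleftrightarrow> k \<notin> ix False j"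
      and id: "\<And>k x y. k < K \<Longrightarrow> x \<in> F \<Longrightarrow> y \<in> F \<Longrightarrow>
        f True (restrict (\<lambda>s. if k \<in> ix True s then y else x) {0..<N True}) =
        f False (restrict (\<lambda>s. if k \<in> ix False s then y else x) {0..<N False})" by metis
  have "\<exists>i<N \<sigma>. \<xi> (N \<sigma>) (f \<sigma>) = proj (N \<sigma>) i" for \<sigma>
    using hom N[of \<sigma>] f[of \<sigma>] unfolding minion_hom_def Proj_clone_def by blast
  then obtain c where c: "\<And>\<sigma>. c \<sigma> < N \<sigma>" "\<And>\<sigma>. \<xi> (N \<sigma>) (f \<sigma>) = proj (N \<sigma>) (c \<sigma>)" by metis
  obtain k where k: "k < K" "k \<in> ix True (c True) \<longleftrightarrow> k \<notin> ix False (c False)"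
    using ix[OF c(1) c(1)] by blast
  define \<pi> :: "bool \<Rightarrow> nat \<Rightarrow> nat" where "\<pi> \<sigma> s = (if k \<in> ix \<sigma> s then 1 else 0)" for \<sigma> s
  have \<pi>: "\<forall>s<N \<sigma>. \<pi> \<sigma> s < 2" for \<sigma> by (simp add: \<pi>_def)
  define h where "h \<sigma> = minor A (N \<sigma>) 2 (\<pi> \<sigma>) (f \<sigma>)" for \<sigma>
  have hPol: "h \<sigma> \<in> Pol A (rels A M) 2" for \<sigma>
    unfolding h_def by (rule minor_in_Pol[OF rel_structure_rels[OF ne] f \<pi>])
  have \<xi>h: "\<xi> 2 (h \<sigma>) = proj 2 (\<pi> \<sigma> (c \<sigma>))" for \<sigma>
  proof -
    have "\<xi> 2 (h \<sigma>) = minor UNIV (N \<sigma>) 2 (\<pi> \<sigma>) (\<xi> (N \<sigma>) (f \<sigma>))"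
      unfolding h_def using hom N[of \<sigma>] f[of \<sigma>] \<pi>[of \<sigma>] unfolding minion_hom_def by simp
    then show ?thesis using minor_proj[OF c(1) \<pi>] by (simp add: c(2))
  qed
  have agree: "h True x = h False x" if x: "x \<in> S" for x
  proof -
    have xt: "x \<in> tuples 2 A" using S(2) x by blast
    have xF: "x 0 \<in> F" "x 1 \<in> F" using x by (auto simp: F_def)
    have "h \<sigma> x = f \<sigma> (restrict (\<lambda>s. if k \<in> ix \<sigma> s then x 1 else x 0) {0..<N \<sigma>})" for \<sigma>
      unfolding h_def minor_apply[OF xt]
      by (intro arg_cong[where f = "f \<sigma>"] restrict_ext) (simp add: \<pi>_def)
    then show ?thesis using id[OF k(1) xF] by simp
  qed
  \<comment> \<open>The pair (0, 1) distinguishes the two binary projections.\<close>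
  let ?y = "restrict (\<lambda>i. i = 1) {0..<2} :: nat \<Rightarrow> bool"
  have y: "?y \<in> ?B" by (rule restrict_in_tuples) simp
  have val: "proj 2 (\<pi> \<sigma> (c \<sigma>)) ?y \<longleftrightarrow> k \<in> ix \<sigma> (c \<sigma>)" for \<sigma>
    using y by (simp add: proj_def \<pi>_def)
  have "\<xi> 2 (h True) ?y = \<xi> 2 (h False) ?y" by (rule S(3)[OF hPol hPol agree y])
  then show False using k(2) unfolding \<xi>h val by blast
qed

end

theorem theorem1p4:
  shows "\<exists>(A :: nat set) Rels.
    rel_structure A Rels \<and>
    omega_categorical A Rels \<and> less_than_doubly_exp_growth A Rels \<and>
    (\<exists>\<xi>. minion_hom A (Pol A Rels) (UNIV :: bool set) Proj_clone \<xi>) \<and>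
    \<not> (\<exists>\<xi>. minion_hom A (Pol A Rels) (UNIV :: bool set) Proj_clone \<xi> \<and>
           unif_continuous A (Pol A Rels) (UNIV :: bool set) \<xi>)"
proof -
  obtain m where "large_sizes m" by (rule large_sizes_exist)
  then interpret large_sizes m .
  obtain A M where good: "good A M" and ext: "\<And>D x M'. finite D \<Longrightarrow> D \<subseteq> A \<Longrightarrow> x \<notin> D \<Longrightarrow>
      good (insert x D) M' \<Longrightarrow> emb id D M' M \<Longrightarrow>
      \<exists>y. y \<in> A \<and> y \<notin> D \<and> emb (id(x := y)) (insert x D) M' M"
    by (rule generic_structure_exists) metis
  interpret generic_large m A M
    by unfold_locales (rule good, rule ext)
  \<comment> \<open>Any level yields the points \<open>d0\<close> and \<open>d1\<close> of the
    template; level 0 is as good as any other.\<close>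
  have ne: "A \<noteq> {}" using template_exists[of 0] by blast
  show ?thesis
    using rel_structure_rels[OF ne] omega_categorical_rels orbit_growth ex_minion_hom[OF ne]
      no_uniformly_continuous_minion_hom[OF ne] by blast
qed

end
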